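(* Let $p$ be an odd prime. (1) The elements of $V$ separate tangent vectors on $X_{\pm}(4p)$: for every point $x\in X_{\pm}(4p)$ (cusps included), there exists an element of $V$ (viewed as a weight-$1$ form on $\Gamma_{\pm}(4p)$) that vanishes at $x$ to order exactly $1$, order being measured with respect to a local parameter of the curve $X_{\pm}(4p)$ at $x$. (2) If $z,z'$ in the upper half plane $\mathcal{H}$ satisfy $F(z)=F(z')$, then there exists $\beta\in\Gamma_{\pm}(4p)$ with $z'=\beta z$. Hence $z,z'$ give the same noncuspidal point of $X_{\pm}(4p)$, and the elements of $V$ separate the noncuspidal points of $X_{\pm}(4p)$.
   Context: $\Gamma(N)\subset SL(2,\mathbb{Z})$ is the principal congruence subgroup of level $N$, $X(N)$ its compactified modular curve, $\mathcal{M}_k(\Gamma)$ the space of weight-$k$ holomorphic modular forms on $\Gamma$. Define $\Gamma_{\pm}(4p)=\{\beta\in\Gamma(4):\beta\equiv\pm I\pmod p\}$ and let $X_{\pm}(4p)$ be its compactified modular curve. For $\alpha=\begin{pmatrix}a&b\\c&d\end{pmatrix}$ with $\det\alpha>0$, $(f|\alpha)(z)=f(\alpha z)(cz+d)^{-1}$. With $q=e^{2\pi iz}$, $\theta(z)=\sum_{n\in\mathbb{Z}}q^{n^2}$, $\phi(z)=\theta(z)-\theta((z+2)/4)$, $M=\theta^2$, $N=2\theta\phi$, $P=\phi^2$ (a basis of $\mathcal{M}_1(\Gamma(4))$). $V\subset\mathcal{M}_1(\Gamma(4p))$ is the span of all $f|\alpha$ with $f\in\mathcal{M}_1(\Gamma(4))$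 and $\alpha$ a primitive integral matrix of determinant $1$ or $p$; equivalently, the span of $f(z)$, $f((z+b)/p)$ for $f\in\{M,N,P\}$, $0\le b<p$. All elements of $V$ lie in $\mathcal{M}_1(\Gamma_{\pm}(4p))$. Let $f_1,\dots,f_d$ be a basis of $V$; $F$ is the map $z\mapsto[f_1(z):\cdots:f_d(z)]\in\mathbb{P}^{d-1}$, which is well defined on the extended upper half plane and induces a morphism $X_{\pm}(4p)\to\mathbb{P}^{d-1}$. *)

theory Defs
  imports
    "HOL-Complex_Analysis.Complex_Analysis"
    "HOL-Number_Theory.Cong"
    "HOL-Library.Function_Algebras"
begin

type_synonym imat = "int ^ 2 ^ 2"

definition SL2Z :: "imat set" where
  "SL2Z = {A. det A = 1}"

definition mat_cong :: "int \<Rightarrow> imat \<Rightarrow> imat \<Rightarrow> bool" where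
  "mat_cong m A B \<longleftrightarrow> (\<forall>i j. [A $ i $ j = B $ i $ j] (mod m))"

definition principal_congruence :: "nat \<Rightarrow> imat set" where
  "principal_congruence m = {A \<in> SL2Z. mat_cong (int m) A (mat 1)}"

definition Gamma_pm :: "nat \<Rightarrow> imat set" where
  "Gamma_pm p =
     {A \<in> principal_congruence 4. mat_cong (int p) A (mat 1) \<or> mat_cong (int p) A (- mat 1)}"

definition primitive_mat :: "imat \<Rightarrow> bool" where
  "primitive_mat A \<longleftrightarrow> Gcd {A $ i $ j | i j. True} = 1"

definition translation_mat :: "nat \<Rightarrow> imat" where
  "translation_mat h = vector [vector [1, int h], vector [0, 1]]"

definition uhp :: "complex set" where
  "uhp = {z. Im z > 0}"

definition mat_moebius :: "imat \<Rightarrow> complex \<Rightarrow> complex" where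
  "mat_moebius A =
     moebius (of_int (A $ 1 $ 1)) (of_int (A $ 1 $ 2)) (of_int (A $ 2 $ 1)) (of_int (A $ 2 $ 2))"

definition slash :: "(complex \<Rightarrow> complex) \<Rightarrow> imat \<Rightarrow> complex \<Rightarrow> complex" where
  "slash f A z = f (mat_moebius A z) / (of_int (A $ 2 $ 1) * z + of_int (A $ 2 $ 2))"

text \<open>
  Functions on the upper half plane are represented by functions on \<open>\<complex>\<close> that vanish outside it,
  so that linear independence and spans have their usual meaning. For \<open>det A > 0\<close> this
  normalisation is preserved by \<^term>\<open>\<lambda>f. slash f A\<close>. Holomorphy at the cusps is boundedness of all
  \<open>f|\<sigma>\<close>, \<open>\<sigma> \<in> SL(2,\<int>)\<close>, near \<open>\<i>\<infinity>\<close>.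
\<close>
definition modular_forms1 :: "imat set \<Rightarrow> (complex \<Rightarrow> complex) set" where
  "modular_forms1 G =
     {f. (\<forall>z. z \<notin> uhp \<longrightarrow> f z = 0) \<and>
         f holomorphic_on uhp \<and>
         (\<forall>A\<in>G. \<forall>z\<in>uhp. slash f A z = f z) \<and>
         (\<forall>A\<in>SL2Z. \<exists>B C. \<forall>z. Im z > 0 \<and> Im z \<ge> B \<longrightarrow> norm (slash f A z) \<le> C)}"

definition scale_fun :: "complex \<Rightarrow> (complex \<Rightarrow> complex) \<Rightarrow> complex \<Rightarrow> complex" where
  "scale_fun c f = (\<lambda>z. c * f z)"

global_interpretation cfun: vector_space scale_fun
  by unfold_locales (auto simp: scale_fun_def fun_eq_iff algebra_simps)

definition V_space :: "nat \<Rightarrow> (complex \<Rightarrow> complex) set" where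
  "V_space p = cfun.span
     {slash f A | f A. f \<in> modular_forms1 (principal_congruence 4) \<and>
                       primitive_mat A \<and> (det A = 1 \<or> det A = int p)}"

definition is_basis :: "(complex \<Rightarrow> complex) list \<Rightarrow> (complex \<Rightarrow> complex) set \<Rightarrow> bool" where
  "is_basis fs W \<longleftrightarrow> distinct fs \<and> cfun.independent (set fs) \<and> cfun.span (set fs) = W"

text \<open>
  A point \<open>[v\<^sub>1 : \<dots> : v\<^sub>d]\<close> of projective space is the class of \<open>v\<close> under scaling by nonzero
  constants.
\<close>
definition proj_point :: "complex list \<Rightarrow> complex list set" where
  "proj_point v = {map (\<lambda>x. c * x) v | c. c \<noteq> 0}"

definition proj_map :: "(complex \<Rightarrow> complex) list \<Rightarrow> complex \<Rightarrow> complex list set" where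
  "proj_map fs z = proj_point (map (\<lambda>f. f z) fs)"

text \<open>The extended upper half plane; \<^term>\<open>Cusp None\<close> is the cusp \<open>\<infinity>\<close>.\<close>
datatype xpoint = Inner complex | Cusp "rat option"

definition ext_uhp :: "xpoint set" where
  "ext_uhp = Inner ` uhp \<union> range Cusp"

fun act :: "imat \<Rightarrow> xpoint \<Rightarrow> xpoint" where
  "act A (Inner z) = Inner (mat_moebius A z)"
| "act A (Cusp None) =
     (if A $ 2 $ 1 = 0 then Cusp None
      else Cusp (Some (of_int (A $ 1 $ 1) / of_int (A $ 2 $ 1))))"
| "act A (Cusp (Some r)) =
     (if of_int (A $ 2 $ 1) * r + of_int (A $ 2 $ 2) = 0 then Cusp None
      else Cusp (Some ((of_int (A $ 1 $ 1) * r + of_int (A $ 1 $ 2)) /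
                       (of_int (A $ 2 $ 1) * r + of_int (A $ 2 $ 2)))))"

definition orbit :: "imat set \<Rightarrow> xpoint \<Rightarrow> xpoint set" where
  "orbit G x = {act A x | A. A \<in> G}"

definition modular_curve :: "imat set \<Rightarrow> xpoint set set" where
  "modular_curve G = orbit G ` ext_uhp"

definition noncuspidal_points :: "imat set \<Rightarrow> xpoint set set" where
  "noncuspidal_points G = orbit G ` Inner ` uhp"

text \<open>
  The order of the stabiliser of \<open>z\<close> in the image of \<open>G\<close> in \<open>PSL(2,\<int>)\<close>: if it is \<open>e\<close>, a local
  parameter of the curve at the image of \<open>z\<close> is \<open>((w - z) / (w - cnj z))\<^sup>e\<close>.
\<close>
definition ramification_index :: "imat set \<Rightarrow> complex \<Rightarrow> nat" where
  "ramification_index G z = card ((\<lambda>A. {A, - A}) ` {A \<in> G. mat_moebius A z = z})"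

text \<open>
  The width \<open>h\<close> of the cusp \<open>\<sigma>\<infinity>\<close>: a local parameter of the curve there is
  \<open>exp (2\<pi>\<i>w/h)\<close> with \<open>w = \<sigma>\<^sup>-\<^sup>1z\<close>.
\<close>
definition cusp_width :: "imat set \<Rightarrow> imat \<Rightarrow> nat" where
  "cusp_width G \<sigma> =
     (LEAST h. h > 0 \<and> (\<exists>A\<in>G. A ** \<sigma> = \<sigma> ** translation_mat h \<or> A ** \<sigma> = - (\<sigma> ** translation_mat h)))"

text \<open>
  \<open>vanishes_to_order_at G f s n\<close>: the form \<open>f\<close> is not identically zero and its order at \<open>s\<close>, in
  the local parameter of the curve of \<open>G\<close>, is exactly \<open>n\<close>. At a cusp this is the order at \<open>0\<close> of the
  \<open>q\<close>-expansion of \<open>f|\<sigma>\<close>.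
\<close>
fun vanishes_to_order_at ::
    "imat set \<Rightarrow> (complex \<Rightarrow> complex) \<Rightarrow> xpoint \<Rightarrow> nat \<Rightarrow> bool" where
  "vanishes_to_order_at G f (Inner z) n \<longleftrightarrow>
     (\<exists>\<^sub>F w in at z. f w \<noteq> 0) \<and> zorder f z = int (ramification_index G z * n)"
| "vanishes_to_order_at G f (Cusp s) n \<longleftrightarrow>
     (\<exists>\<sigma>\<in>SL2Z. act \<sigma> (Cusp None) = Cusp s \<and>
       (\<exists>g. g holomorphic_on ball 0 1 \<and>
            (\<forall>z\<in>uhp. slash f \<sigma> z =
                      g (exp (2 * of_real pi * \<i> * z / of_nat (cusp_width G \<sigma>)))) \<and>
            (\<exists>\<^sub>F w in at 0. g w \<noteq> 0) \<and> zorder g 0 = int n))"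

text \<open>
  The order at a point of the curve, i.e. at an orbit. For \<open>f \<in> modular_forms1 G\<close> it does not
  depend on the representative \<open>s\<close>, nor on \<open>\<sigma>\<close> above.
\<close>
definition vanishes_to_order ::
    "imat set \<Rightarrow> (complex \<Rightarrow> complex) \<Rightarrow> xpoint set \<Rightarrow> nat \<Rightarrow> bool" where
  "vanishes_to_order G f x n \<longleftrightarrow> (\<exists>s\<in>x. vanishes_to_order_at G f s n)"

end

(*
For tau in the upper half plane and each non-trivial sign character of the lattice L = Z + Z tau
there is, by Liouville, exactly one function with that character having simple poles of residue 1
at L and no others; two of them are sums of cosecants. Uniqueness makes them equivariant under
SL(2,Z), so their values at half periods are weight 1 forms on Gamma(4). The square of the
derivative of such a function is a quartic polynomial in the function itself, whose coefficients
are given by those values. Hence proportional values at tau and tau' yield homothetic functions,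
so homothetic lattices, and comparing characters and values at half periods gives an element of
Gamma(4) whose automorphy factor is the factor of proportionality. Point separation follows by
applying this to z and to (z + s)/p; local injectivity gives simple zeros in the upper half plane,
and the q-expansion of the form theta_2^2 at z/p gives them at the cusps.
*)
theory Submission
  imports Defs
begin

no_notation fps_nth (infixl "$" 75)

section \<open>Lattices and quasi-periodic functions\<close>

text \<open>The obstacle is signs. Squares of theta constants, or the lattice alone, determine a
  matrix only up to sign and weak congruences, whereas the applications to z and to all (z + s)/p
  must speak of one and the same matrix. This works because the factor of proportionality is the
  automorphy factor itself and not just a multiple of it: it is common to all these points and pins
  the matrix down. Hence the use of the square roots of P - e_i (P the Weierstrass function, e_i its
  values at half periods) in place of P: their half period values retain the signs that P loses, and
  these signs lift congruences modulo 2 to congruences modulo 4. In weight 1, double series over the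
  lattice do not converge absolutely; a sign -1 in the direction of the period 1 sums each row to a
  cosecant, which decays exponentially away from the real axis. At the cusps no injectivity argument
  is available. There an explicit form is used: \<open>thB\<close> has a simple zero in exp(\<pi> i
  \<tau>/2), and for \<tau> = z/p this is exp(2 \<pi> i z/(4p)), the local parameter for width
  4p.\<close>

definition period_lattice :: "complex \<Rightarrow> complex set" where
  "period_lattice \<tau> = {of_int m + of_int n * \<tau> | m n. True}"

lemma period_latticeI [intro]: "of_int m + of_int n * \<tau> \<in> period_lattice \<tau>"
  by (auto simp: period_lattice_def)

lemma zero_in_period_lattice [simp]: "0 \<in> period_lattice \<tau>"
  using period_latticeI[of 0 0 \<tau>] by simp

lemma period_lattice_add:
  assumes "u \<in> period_lattice \<tau>" "v \<in> period_lattice \<tau>"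
  shows "u + v \<in> period_lattice \<tau>"
proof -
  obtain m n k l where "u = of_int m + of_int n * \<tau>" "v = of_int k + of_int l * \<tau>"
    using assms by (auto simp: period_lattice_def)
  hence "u + v = of_int (m + k) + of_int (n + l) * \<tau>" by (simp add: algebra_simps)
  thus ?thesis by (simp only: period_latticeI)
qed

lemma period_lattice_uminus_iff [simp]: "- u \<in> period_lattice \<tau> \<longleftrightarrow> u \<in> period_lattice \<tau>"
proof -
  have "- u \<in> period_lattice \<tau>" if u: "u \<in> period_lattice \<tau>" for u
  proof -
    obtain m n where "u = of_int m + of_int n * \<tau>" using u by (auto simp: period_lattice_def)
    hence "- u = of_int (- m) + of_int (- n) * \<tau>" by simp
    thus ?thesis by (simp only: period_latticeI)
  qed
  from this[of u] this[of "-u"] show ?thesis by auto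
qed

lemma period_lattice_add_iff [simp]:
  assumes "v \<in> period_lattice \<tau>"
  shows "u + v \<in> period_lattice \<tau> \<longleftrightarrow> u \<in> period_lattice \<tau>"
proof
  assume "u + v \<in> period_lattice \<tau>"
  moreover have "- v \<in> period_lattice \<tau>" using assms by simp
  ultimately have "u + v + (- v) \<in> period_lattice \<tau>" by (rule period_lattice_add)
  thus "u \<in> period_lattice \<tau>" by simp
qed (use assms period_lattice_add in blast)

lemma one_in_period_lattice [simp]: "1 \<in> period_lattice \<tau>"
  and tau_in_period_lattice [simp]: "\<tau> \<in> period_lattice \<tau>"
  using period_latticeI[of 1 0 \<tau>] period_latticeI[of 0 1 \<tau>] by simp_all

lemma period_lattice_coords:
  assumes "Im \<tau> > 0" "of_int m + of_int n * \<tau> = of_int k + of_int l * \<tau>"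
  shows "m = k" "n = l"
proof -
  have "of_int n * Im \<tau> = of_int l * Im \<tau>" using assms(2) by (simp add: complex_eq_iff)
  thus nl: "n = l" using assms(1) by (metis less_irrefl mult_cancel_right of_int_eq_iff)
  show "m = k" using assms(2) nl by (metis add_right_cancel of_int_eq_iff)
qed

lemma countable_period_lattice: "countable (period_lattice \<tau>)"
proof -
  have "period_lattice \<tau> = (\<lambda>(m, n). of_int m + of_int n * \<tau>) ` (UNIV :: (int \<times> int) set)"
    by (auto simp: period_lattice_def)
  thus ?thesis by simp
qed

text \<open>A vector with n = 0 is an integer; any other has imaginary part at least
  \<open>Im \<tau>\<close> in modulus. This minimum is the radius of the punctured discs on which
  all expansions at 0 are made.\<close>

lemma period_lattice_norm_ge:
  assumes "Im \<tau> > 0" "u \<in> period_lattice \<tau>" "u \<noteq> 0"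
  shows "norm u \<ge> min 1 (Im \<tau>)"
proof -
  obtain m n where u: "u = of_int m + of_int n * \<tau>" using assms by (auto simp: period_lattice_def)
  show ?thesis
  proof (cases "n = 0")
    case True
    hence "norm u = of_int \<bar>m\<bar>" using u by simp
    moreover have "m \<noteq> 0" using u True assms by auto
    ultimately show ?thesis by linarith
  next
    case False
    have "Im \<tau> \<le> of_int \<bar>n\<bar> * Im \<tau>" using False assms by simp
    also have "\<dots> = \<bar>Im u\<bar>" using u assms by (simp add: abs_mult)
    also have "\<dots> \<le> norm u" by (rule abs_Im_le_cmod)
    finally show ?thesis by simp
  qed
qed

lemma period_lattice_separated:
  assumes "Im \<tau> > 0" "u \<in> period_lattice \<tau>" "v \<in> period_lattice \<tau>" "norm (v - u) < min 1 (Im \<tau>)"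
  shows "v = u"
proof (rule ccontr)
  assume "v \<noteq> u"
  have "v + (- u) \<in> period_lattice \<tau>" using assms by (intro period_lattice_add) auto
  hence "norm (v + (- u)) \<ge> min 1 (Im \<tau>)"
    using period_lattice_norm_ge[of \<tau> "v + (- u)"] assms(1) \<open>v \<noteq> u\<close> by simp
  thus False using assms by simp
qed

lemma closed_period_lattice:
  assumes "Im \<tau> > 0" shows "closed (period_lattice \<tau>)"
proof (rule discrete_imp_closed)
  show "0 < min 1 (Im \<tau>)" using assms by simp
  show "\<forall>x\<in>period_lattice \<tau>. \<forall>y\<in>period_lattice \<tau>. dist y x < min 1 (Im \<tau>) \<longrightarrow> y = x"
    using period_lattice_separated[OF assms] by (auto simp: dist_norm)
qed

lemma open_compl_period_lattice [simp]: "Im \<tau> > 0 \<Longrightarrow> open (- period_lattice \<tau>)"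
  using closed_period_lattice by auto

text \<open>The parallelogram is taken closed, at the price of uniqueness, so that it is
  compact.\<close>

lemma period_lattice_reduce:
  assumes "Im \<tau> > 0"
  obtains m n s t where "z = of_int m + of_int n * \<tau> + (of_real s + of_real t * \<tau>)"
    "0 \<le> s" "s \<le> 1" "0 \<le> t" "t \<le> 1"
proof -
  define y where "y = Im z / Im \<tau>"
  define x where "x = Re z - y * Re \<tau>"
  have z: "z = of_real x + of_real y * \<tau>" using assms by (simp add: complex_eq_iff x_def y_def)
  show ?thesis
  proof (rule that[of "\<lfloor>x\<rfloor>" "\<lfloor>y\<rfloor>" "frac x" "frac y"])
    show "z = of_int \<lfloor>x\<rfloor> + of_int \<lfloor>y\<rfloor> * \<tau> + (of_real (frac x) + of_real (frac y) * \<tau>)"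
      unfolding z frac_def by (simp add: algebra_simps)
    show "0 \<le> frac x" "frac x \<le> 1" "0 \<le> frac y" "frac y \<le> 1"
      using frac_lt_1[of x] frac_lt_1[of y] by (auto simp: frac_ge_0)
  qed
qed

text \<open>Nothing is asked on the lattice: the function may have poles there, and its values at
  them carry no information.\<close>

definition quasi_periodic :: "complex \<Rightarrow> complex \<Rightarrow> complex \<Rightarrow> (complex \<Rightarrow> complex) \<Rightarrow> bool" where
  "quasi_periodic \<tau> a b f \<longleftrightarrow> f holomorphic_on - period_lattice \<tau> \<and>
     (\<forall>z. z \<notin> period_lattice \<tau> \<longrightarrow> f (z + 1) = a * f z \<and> f (z + \<tau>) = b * f z)"

lemma quasi_periodicD:
  assumes "quasi_periodic \<tau> a b f" "z \<notin> period_lattice \<tau>" "a \<noteq> 0" "b \<noteq> 0"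
  shows "f (z + (of_int m + of_int n * \<tau>)) = a powi m * b powi n * f z"
proof -
  have 1: "f (z + of_nat k) = a ^ k * f z" if "z \<notin> period_lattice \<tau>" for k z
  proof (induction k)
    case (Suc k)
    have "z + of_nat k \<notin> period_lattice \<tau>"
      using that period_latticeI[of "int k" 0 \<tau>] by simp
    hence "f (z + of_nat k + 1) = a * f (z + of_nat k)" using assms(1) by (simp add: quasi_periodic_def)
    thus ?case using Suc by (simp add: add_ac)
  qed simp
  have 2: "f (z + of_nat k * \<tau>) = b ^ k * f z" if "z \<notin> period_lattice \<tau>" for k z
  proof (induction k)
    case (Suc k)
    have "z + of_nat k * \<tau> \<notin> period_lattice \<tau>"
      using that period_latticeI[of 0 "int k" \<tau>] by simp
    hence "f (z + of_nat k * \<tau> + \<tau>) = b * f (z + of_nat k * \<tau>)"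
      using assms(1) by (simp add: quasi_periodic_def)
    thus ?case using Suc by (simp add: algebra_simps)
  qed simp
  have 3: "f (z + of_int k) = a powi k * f z" if z: "z \<notin> period_lattice \<tau>" for k z
  proof (cases k rule: int_cases2)
    case (nonneg l)
    thus ?thesis using 1[OF z, of l] by simp
  next
    case k: (nonpos l)
    have "z + of_int k \<notin> period_lattice \<tau>" using z period_latticeI[of k 0 \<tau>] by simp
    from 1[OF this, of l] show ?thesis using assms(3) k by (simp add: power_int_minus field_simps)
  qed
  have 4: "f (z + of_int k * \<tau>) = b powi k * f z" if z: "z \<notin> period_lattice \<tau>" for k z
  proof (cases k rule: int_cases2)
    case (nonneg l)
    thus ?thesis using 2[OF z, of l] by simp
  next
    case k: (nonpos l)
    have "z + of_int k * \<tau> \<notin> period_lattice \<tau>" using z period_latticeI[of 0 k \<tau>] by simp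
    from 2[OF this, of l] show ?thesis using assms(4) k by (simp add: power_int_minus field_simps)
  qed
  have "z + of_int n * \<tau> \<notin> period_lattice \<tau>" using assms(2) period_latticeI[of 0 n \<tau>] by simp
  from 3[OF this, of m] 4[OF assms(2), of n] show ?thesis by (simp add: algebra_simps)
qed

lemma norm_power_int_1: "norm (a :: complex) = 1 \<Longrightarrow> norm (a powi m) = 1"
  by (simp add: norm_power_int)

text \<open>The limit makes the singularity at 0 removable, and the multipliers transport this to
  every lattice point. Multipliers of modulus 1 leave the absolute value periodic, so the extension
  is bounded by its values on a compact parallelogram. A constant with a multiplier other than 1 is
  zero.\<close>

lemma quasi_periodic_Liouville:
  assumes tau: "Im \<tau> > 0" and h: "quasi_periodic \<tau> a b h" and ab: "norm a = 1" "norm b = 1"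
    and lim: "((\<lambda>z. z * h z) \<longlongrightarrow> 0) (at 0)"
  obtains c where "\<And>z. z \<notin> period_lattice \<tau> \<Longrightarrow> h z = c" "a \<noteq> 1 \<or> b \<noteq> 1 \<Longrightarrow> c = 0"
proof -
  define L where "L = period_lattice \<tau>"
  define r where "r = min 1 (Im \<tau>)"
  have r: "r > 0" using tau by (simp add: r_def)
  have ab0: "a \<noteq> 0" "b \<noteq> 0" using ab by auto
  have nL: "z \<notin> L" if "w \<in> L" "z \<in> ball w r - {w}" for z w
    using period_lattice_separated[OF tau, of w z] that
    by (auto simp: L_def r_def dist_norm norm_minus_commute)
  have holh: "h holomorphic_on - L" using h by (simp add: quasi_periodic_def L_def)
  have 0: "0 \<in> L" by (simp add: L_def)
  have "h holomorphic_on ball 0 r - {0}"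
    by (rule holomorphic_on_subset[OF holh]) (use nL[OF 0] in auto)
  moreover have "0 \<in> interior (ball (0::complex) r)" using r by simp
  ultimately obtain g where g: "g holomorphic_on ball 0 r" "\<And>z. z \<in> ball 0 r - {0} \<Longrightarrow> g z = h z"
    using holomorphic_on_extend_lim[of h "ball 0 r" 0] lim by auto
  \<comment> \<open>The lattice values of \<open>h\<close> are arbitrary, so they are replaced by
    limits; \<open>near\<close> shows that around each lattice point \<open>H\<close> is a translate
    of \<open>g\<close> up to a factor of modulus 1.\<close>
  define H where "H = (\<lambda>z. if z \<in> L then Lim (at z) h else h z)"
  have near: "\<exists>x. norm x = 1 \<and> (\<forall>z\<in>ball w r. H z = x * g (z - w))" if w: "w \<in> L" for w
  proof -
    obtain m n where wmn: "w = of_int m + of_int n * \<tau>" using w by (auto simp: L_def period_lattice_def)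
    define x where "x = a powi m * b powi n"
    have hx: "h z = x * g (z - w)" if z: "z \<in> ball w r - {w}" for z
    proof -
      have "z - w \<in> ball 0 r - {0}" using z by (auto simp: dist_norm norm_minus_commute)
      moreover from this have "z - w \<notin> L" using nL[OF 0] by blast
      ultimately have "h (z - w + w) = x * h (z - w)" "g (z - w) = h (z - w)"
        using quasi_periodicD[OF h _ ab0, of "z - w" m n] g(2) by (simp_all add: L_def x_def wmn)
      thus ?thesis by simp
    qed
    have cont: "isCont (\<lambda>z. x * g (z - w)) w"
    proof -
      have "(\<lambda>z. x * g (z - w)) holomorphic_on ball w r"
        by (intro holomorphic_intros holomorphic_on_compose_gen[OF _ g(1), unfolded o_def])
           (auto simp: dist_norm norm_minus_commute)
      hence "continuous_on (ball w r) (\<lambda>z. x * g (z - w))" by (rule holomorphic_on_imp_continuous_on)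
      thus ?thesis using r by (simp add: continuous_on_eq_continuous_at)
    qed
    have "h \<midarrow>w\<rightarrow> x * g 0"
    proof (rule Lim_transform_within_open)
      show "((\<lambda>z. x * g (z - w)) \<longlongrightarrow> x * g 0) (at w)" using cont by (simp add: isCont_def)
      show "open (ball w r)" "w \<in> ball w r" using r by auto
      show "\<And>z. z \<in> ball w r \<Longrightarrow> z \<noteq> w \<Longrightarrow> x * g (z - w) = h z" using hx by simp
    qed
    hence "H w = x * g 0" using w by (simp add: H_def tendsto_Lim)
    moreover have "H z = x * g (z - w)" if "z \<in> ball w r - {w}" for z
      using hx[OF that] nL[OF w that] by (simp add: H_def)
    moreover have "norm x = 1" using ab by (simp add: x_def norm_mult norm_power_int_1)
    ultimately show ?thesis by (metis Diff_iff diff_self empty_iff insert_iff)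
  qed
  have holH: "H holomorphic_on UNIV"
  proof -
    have "H field_differentiable (at z)" for z
    proof (cases "z \<in> L")
      case True
      obtain x where x: "\<forall>u\<in>ball z r. H u = x * g (u - z)" using near[OF True] by auto
      have "(\<lambda>u. x * g (u - z)) holomorphic_on ball z r"
        by (intro holomorphic_intros holomorphic_on_compose_gen[OF _ g(1), unfolded o_def])
           (auto simp: dist_norm norm_minus_commute)
      hence "H holomorphic_on ball z r" by (rule holomorphic_transform) (use x in auto)
      thus ?thesis using r by (simp add: holomorphic_on_imp_differentiable_at)
    next
      case False
      have "H holomorphic_on - L" using holh
        by (rule holomorphic_transform) (auto simp: H_def)
      thus ?thesis using False tau by (intro holomorphic_on_imp_differentiable_at) (auto simp: L_def)
    qed
    thus ?thesis by (simp add: holomorphic_on_def field_differentiable_at_within)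
  qed
  define K where "K = (\<lambda>(s, t). of_real s + of_real t * \<tau>) ` ({0..1::real} \<times> {0..1::real})"
  have "compact K" unfolding K_def
    by (intro compact_continuous_image compact_Times)
       (auto intro!: continuous_intros simp: case_prod_unfold)
  moreover have "continuous_on K H"
    using holH holomorphic_on_imp_continuous_on holomorphic_on_subset by blast
  ultimately have "bounded (H ` K)" using compact_continuous_image compact_imp_bounded by blast
  then obtain M where M: "\<And>k. k \<in> K \<Longrightarrow> norm (H k) \<le> M" by (auto simp: bounded_iff)
  have "norm (H z) \<le> max M (norm (g 0))" for z
  proof (cases "z \<in> L")
    case True
    with near[OF this] r show ?thesis by (fastforce simp: norm_mult)
  next
    case False
    obtain m n s t where z: "z = of_int m + of_int n * \<tau> + (of_real s + of_real t * \<tau>)"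
      "0 \<le> s" "s \<le> 1" "0 \<le> t" "t \<le> 1" by (rule period_lattice_reduce[OF tau])
    define k where "k = of_real s + of_real t * \<tau>"
    have zk: "z = k + (of_int m + of_int n * \<tau>)" using z by (simp add: k_def)
    have kK: "k \<in> K" using z by (force simp: k_def K_def)
    have k: "k \<notin> L" using False period_lattice_add[OF _ period_latticeI, of k \<tau> m n] by (auto simp: L_def zk)
    hence "h z = a powi m * b powi n * h k"
      unfolding zk using quasi_periodicD[OF h _ ab0] by (simp add: L_def)
    hence "norm (h z) = norm (h k)" using ab by (simp add: norm_mult norm_power_int_1)
    thus ?thesis using M[OF kK] k False by (simp add: H_def)
  qed
  hence "bounded (range H)" unfolding bounded_iff by blast
  then obtain c where c: "\<And>z. H z = c" using Liouville_theorem[OF holH] by (auto simp: constant_on_def)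
  show ?thesis
  proof (rule that)
    fix z assume "z \<notin> period_lattice \<tau>"
    thus "h z = c" using c[of z] by (simp add: H_def L_def)
  next
    assume ne: "a \<noteq> 1 \<or> b \<noteq> 1"
    obtain z where z: "z \<notin> L" using nL[OF 0, of "of_real (r/2)"] r by auto
    have "h (z + 1) = a * h z" "h (z + \<tau>) = b * h z" using h z by (auto simp: quasi_periodic_def L_def)
    moreover have "z + 1 \<notin> L" "z + \<tau> \<notin> L" using z by (auto simp: L_def)
    ultimately have "c = a * c" "c = b * c" using c[of z] c[of "z+1"] c[of "z+\<tau>"] z by (auto simp: H_def)
    thus "c = 0" using ne by auto
  qed
qed

section \<open>Functions with a sign character and simple poles on the lattice\<close>

text \<open>Classically, the square root of P - e_i with residue 1 at 0, for the Weierstrass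
  function P and its half period value e_i; up to scaling, one of the Jacobi functions cs, ds, ns.
  \<open>a\<close> and \<open>b\<close> are the signs under translation by 1 and \<tau>. The trivial
  character is excluded: added constants would destroy uniqueness.\<close>

definition jacobi_fun :: "complex \<Rightarrow> complex \<Rightarrow> complex \<Rightarrow> (complex \<Rightarrow> complex) \<Rightarrow> bool" where
  "jacobi_fun \<tau> a b f \<longleftrightarrow> Im \<tau> > 0 \<and> a \<in> {1, -1} \<and> b \<in> {1, -1} \<and> (a, b) \<noteq> (1, 1) \<and>
     quasi_periodic \<tau> a b f \<and> ((\<lambda>z. z * f z) \<longlongrightarrow> 1) (at 0)"

lemma jacobi_fun_holomorphic: "jacobi_fun \<tau> a b f \<Longrightarrow> f holomorphic_on - period_lattice \<tau>"
  by (simp add: jacobi_fun_def quasi_periodic_def)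

lemma jacobi_fun_shift:
  assumes "jacobi_fun \<tau> a b f" "z \<notin> period_lattice \<tau>"
  shows "f (z + (of_int m + of_int n * \<tau>)) = a powi m * b powi n * f z"
  using assms by (intro quasi_periodicD) (auto simp: jacobi_fun_def)

lemma quasi_periodic_lincomb:
  assumes "quasi_periodic \<tau> a b f" "quasi_periodic \<tau> a b g"
  shows "quasi_periodic \<tau> a b (\<lambda>z. f z - g z)" "quasi_periodic \<tau> a b (\<lambda>z. f z + g z)"
  using assms by (auto simp: quasi_periodic_def algebra_simps intro!: holomorphic_intros)

lemma quasi_periodic_mult:
  assumes "quasi_periodic \<tau> a b f" "quasi_periodic \<tau> a' b' g"
  shows "quasi_periodic \<tau> (a * a') (b * b') (\<lambda>z. f z * g z)"
  using assms by (auto simp: quasi_periodic_def intro!: holomorphic_intros)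

lemma jacobi_fun_unique:
  assumes f: "jacobi_fun \<tau> a b f" and g: "jacobi_fun \<tau> a b g" and z: "z \<notin> period_lattice \<tau>"
  shows "f z = g z"
proof -
  have "((\<lambda>z. z * f z - z * g z) \<longlongrightarrow> 1 - 1) (at 0)"
    using f g by (intro tendsto_intros) (auto simp: jacobi_fun_def)
  hence lim: "((\<lambda>z. z * (f z - g z)) \<longlongrightarrow> 0) (at 0)" by (simp add: algebra_simps)
  have "Im \<tau> > 0" "quasi_periodic \<tau> a b (\<lambda>z. f z - g z)" "norm a = 1" "norm b = 1"
    and ne: "a \<noteq> 1 \<or> b \<noteq> 1"
    using f g by (auto simp: jacobi_fun_def intro: quasi_periodic_lincomb)
  from quasi_periodic_Liouville[OF this(1-4) lim] obtain c where "f z - g z = c" "c = 0"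
    using z ne by metis
  thus ?thesis by simp
qed

lemma tendsto_uminus_at_0:
  assumes "(F \<longlongrightarrow> l) (at (0 :: complex))"
  shows "((\<lambda>z. F (- z)) \<longlongrightarrow> l) (at 0)"
proof -
  have "filterlim uminus (at (0 :: complex)) (at 0)"
    by (rule filterlim_atI) (auto intro!: tendsto_eq_intros simp: eventually_at_filter)
  from filterlim_compose[OF assms this] show ?thesis .
qed

text \<open>A sign is its own inverse, so \<open>- f (- z)\<close> has the same character and
  residue as \<open>f\<close>; uniqueness applies.\<close>

lemma jacobi_fun_uminus:
  assumes f: "jacobi_fun \<tau> a b f" and z: "z \<notin> period_lattice \<tau>"
  shows "f (- z) = - f z"
proof -
  have tau: "Im \<tau> > 0" using f by (simp add: jacobi_fun_def)
  have ab: "a \<in> {1, -1}" "b \<in> {1, -1}" using f by (auto simp: jacobi_fun_def)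
  have per: "f (- (z + 1)) = a * f (- z)" "f (- (z + \<tau>)) = b * f (- z)" if "z \<notin> period_lattice \<tau>" for z
    using that jacobi_fun_shift[OF f, of "-z" "-1" 0] jacobi_fun_shift[OF f, of "-z" 0 "-1"] ab
    by auto
  have "((\<lambda>z. (- z) * f (- z)) \<longlongrightarrow> 1) (at 0)"
    by (rule tendsto_uminus_at_0) (use f in \<open>simp add: jacobi_fun_def\<close>)
  hence "jacobi_fun \<tau> a b (\<lambda>z. - f (- z))"
    using f per unfolding jacobi_fun_def quasi_periodic_def
    by (auto intro!: holomorphic_intros holomorphic_on_compose_gen[of uminus _ f "- period_lattice \<tau>", unfolded o_def])
  from jacobi_fun_unique[OF f this z] show ?thesis by simp
qed

text \<open>Translation by \<open>2 * u\<close> takes -u to u without a sign, while oddness gives a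
  sign.\<close>

lemma jacobi_fun_half_period:
  assumes f: "jacobi_fun \<tau> a b f" and u: "u \<notin> period_lattice \<tau>"
    and 2: "2 * u = of_int m + of_int n * \<tau>" "a powi m * b powi n = 1"
  shows "f u = 0"
proof -
  have "f (- u + 2 * u) = a powi m * b powi n * f (- u)"
    unfolding 2(1) by (rule jacobi_fun_shift[OF f]) (use u in simp)
  thus ?thesis using jacobi_fun_uminus[OF f u] 2(2) by simp
qed

lemma period_lattice_ball:
  assumes "Im \<tau> > 0"
  shows "z \<in> ball 0 (min 1 (Im \<tau>)) - {0} \<Longrightarrow> z \<notin> period_lattice \<tau>"
  using period_lattice_separated[OF assms, of 0 z] by auto

text \<open>Oddness removes the constant term. Hence squares and products of two such functions have
  principal part 1/z^2 with no term in 1/z, as the next two comparisons require.\<close>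

lemma jacobi_fun_Laurent:
  assumes f: "jacobi_fun \<tau> a b f"
  obtains v where "v holomorphic_on ball 0 (min 1 (Im \<tau>))"
    "\<And>z. z \<in> ball 0 (min 1 (Im \<tau>)) - {0} \<Longrightarrow> f z = 1 / z + z * v z"
proof -
  define r where "r = min 1 (Im \<tau>)"
  have tau: "Im \<tau> > 0" using f by (simp add: jacobi_fun_def)
  have r: "r > 0" using tau by (simp add: r_def)
  have nL: "z \<notin> period_lattice \<tau>" if "z \<in> ball 0 r - {0}" for z
    using that period_lattice_ball[OF tau] by (simp add: r_def)
  have int: "0 \<in> interior (ball (0::complex) r)" using r by simp
  have "(\<lambda>z. f z - 1 / z) holomorphic_on ball 0 r - {0}"
    by (intro holomorphic_intros holomorphic_on_subset[OF jacobi_fun_holomorphic[OF f]]) (use nL in auto)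
  moreover have "((\<lambda>z. (z - 0) * (f z - 1 / z)) \<longlongrightarrow> 0) (at 0)"
  proof (rule Lim_transform_within_open[where s = UNIV])
    show "((\<lambda>z. z * f z - 1) \<longlongrightarrow> 0) (at 0)"
      using f tendsto_diff[OF _ tendsto_const[of 1], of "\<lambda>z. z * f z" 1] by (simp add: jacobi_fun_def)
  qed (use r in \<open>auto simp: field_simps intro: open_UNIV\<close>)
  ultimately obtain u where u: "u holomorphic_on ball 0 r" "\<And>z. z \<in> ball 0 r - {0} \<Longrightarrow> u z = f z - 1 / z"
    using holomorphic_on_extend_lim[OF _ int] by blast
  have cont: "(u \<longlongrightarrow> u 0) (at 0)"
    using holomorphic_on_imp_continuous_on[OF u(1)] r by (simp add: continuous_on_eq_continuous_at isCont_def)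
  have "((\<lambda>z. u (- z)) \<longlongrightarrow> u 0) (at 0)"
    by (rule tendsto_uminus_at_0[OF cont])
  moreover have "((\<lambda>z. u (- z)) \<longlongrightarrow> - u 0) (at 0)"
  proof (rule Lim_transform_within_open)
    show "((\<lambda>z. - u z) \<longlongrightarrow> - u 0) (at 0)" by (intro tendsto_intros cont)
    show "- u z = u (- z)" if "z \<in> ball 0 r" "z \<noteq> 0" for z
      using that u(2)[of z] u(2)[of "-z"] jacobi_fun_uminus[OF f, of z] nL[of z] by auto
  qed (use r in auto)
  ultimately have "u 0 = - u 0" by (rule tendsto_unique[OF at_neq_bot])
  hence u0: "u 0 = 0" by simp
  have "(\<lambda>z. u z / z) holomorphic_on ball 0 r - {0}"
    by (intro holomorphic_intros holomorphic_on_subset[OF u(1)]) auto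
  moreover have "((\<lambda>z. (z - 0) * (u z / z)) \<longlongrightarrow> 0) (at 0)"
    by (rule Lim_transform_within_open[of u _ _ _ UNIV]) (use cont u0 in auto)
  ultimately obtain v where v: "v holomorphic_on ball 0 r" "\<And>z. z \<in> ball 0 r - {0} \<Longrightarrow> v z = u z / z"
    using holomorphic_on_extend_lim[OF _ int] by blast
  show ?thesis
    by (rule that[of v]) (use v u(2) in \<open>auto simp: r_def\<close>)
qed

lemma tendsto_0_near:
  assumes "r > 0" "F holomorphic_on ball 0 r" "F 0 = l" "\<And>z. z \<in> ball 0 r - {0} \<Longrightarrow> G z = F z"
  shows "(G \<longlongrightarrow> (l :: complex)) (at 0)"
proof (rule Lim_transform_within_open[where s = "ball 0 r"])
  show "(F \<longlongrightarrow> l) (at 0)" using holomorphic_on_imp_continuous_on[OF assms(2)] assms(1,3)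
    by (auto simp: continuous_on_eq_continuous_at isCont_def)
qed (use assms in auto)

text \<open>Both squares are periodic with the same principal part, so their difference has no
  poles.\<close>

lemma jacobi_fun_sq_diff:
  assumes f: "jacobi_fun \<tau> a b f" and g: "jacobi_fun \<tau> a' b' g"
  obtains c where "\<And>z. z \<notin> period_lattice \<tau> \<Longrightarrow> (f z)\<^sup>2 - (g z)\<^sup>2 = c"
proof -
  define r where "r = min 1 (Im \<tau>)"
  have tau: "Im \<tau> > 0" using f by (simp add: jacobi_fun_def)
  obtain v where v: "v holomorphic_on ball 0 r" "\<And>z. z \<in> ball 0 r - {0} \<Longrightarrow> f z = 1 / z + z * v z"
    using jacobi_fun_Laurent[OF f] unfolding r_def by blast
  obtain w where w: "w holomorphic_on ball 0 r" "\<And>z. z \<in> ball 0 r - {0} \<Longrightarrow> g z = 1 / z + z * w z"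
    using jacobi_fun_Laurent[OF g] unfolding r_def by blast
  have "quasi_periodic \<tau> (a * a) (b * b) (\<lambda>z. f z * f z)" "quasi_periodic \<tau> (a' * a') (b' * b') (\<lambda>z. g z * g z)"
    using f g by (auto intro!: quasi_periodic_mult simp: jacobi_fun_def)
  moreover have "a * a = 1" "b * b = 1" "a' * a' = 1" "b' * b' = 1"
    using f g by (auto simp: jacobi_fun_def)
  ultimately have "quasi_periodic \<tau> 1 1 (\<lambda>z. (f z)\<^sup>2 - (g z)\<^sup>2)"
    unfolding power2_eq_square by (metis (no_types) quasi_periodic_lincomb(1))
  moreover have "((\<lambda>z. z * ((f z)\<^sup>2 - (g z)\<^sup>2)) \<longlongrightarrow> 0) (at 0)"
  proof (rule tendsto_0_near)
    show "r > 0" using tau by (simp add: r_def)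
    show "(\<lambda>z. z * (2 * v z - 2 * w z + z\<^sup>2 * ((v z)\<^sup>2 - (w z)\<^sup>2))) holomorphic_on ball 0 r"
      by (intro holomorphic_intros v(1) w(1))
    fix z :: complex assume z: "z \<in> ball 0 r - {0}"
    thus "z * ((f z)\<^sup>2 - (g z)\<^sup>2) = z * (2 * v z - 2 * w z + z\<^sup>2 * ((v z)\<^sup>2 - (w z)\<^sup>2))"
      unfolding v(2)[OF z] w(2)[OF z] by (simp add: field_simps power2_eq_square)
  qed simp
  ultimately show ?thesis
    by (rule quasi_periodic_Liouville[OF tau _ norm_one norm_one]) (rule that)
qed

text \<open>The characters of \<open>g\<close> and \<open>h\<close> multiply to that of
  \<open>f\<close>, which is also that of the derivative; the principal parts of \<open>f'\<close>
  and \<open>- g h\<close> are both -1/z^2. The difference is constant, and zero because the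
  character is non-trivial.\<close>

lemma jacobi_fun_deriv:
  assumes f: "jacobi_fun \<tau> a b f" and g: "jacobi_fun \<tau> a' b' g" and h: "jacobi_fun \<tau> (a * a') (b * b') h"
    and z: "z \<notin> period_lattice \<tau>"
  shows "(f has_field_derivative - (g z * h z)) (at z)"
proof -
  define L where "L = period_lattice \<tau>"
  define r where "r = min 1 (Im \<tau>)"
  have tau: "Im \<tau> > 0" using f by (simp add: jacobi_fun_def)
  have r: "r > 0" using tau by (simp add: r_def)
  have ab: "a \<in> {1, -1}" "b \<in> {1, -1}" "a' \<in> {1, -1}" "b' \<in> {1, -1}" "(a, b) \<noteq> (1, 1)"
    using f g by (auto simp: jacobi_fun_def)
  have op: "open (- L)" using tau by (simp add: L_def)
  have fh: "f holomorphic_on - L" using jacobi_fun_holomorphic[OF f] by (simp add: L_def)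
  have der: "(f has_field_derivative deriv f z) (at z)" if "z \<notin> L" for z
    using holomorphic_derivI[OF fh op] that by simp
  obtain u where u: "u holomorphic_on ball 0 r" "\<And>z. z \<in> ball 0 r - {0} \<Longrightarrow> f z = 1 / z + z * u z"
    using jacobi_fun_Laurent[OF f] unfolding r_def by blast
  obtain v where v: "v holomorphic_on ball 0 r" "\<And>z. z \<in> ball 0 r - {0} \<Longrightarrow> g z = 1 / z + z * v z"
    using jacobi_fun_Laurent[OF g] unfolding r_def by blast
  obtain w where w: "w holomorphic_on ball 0 r" "\<And>z. z \<in> ball 0 r - {0} \<Longrightarrow> h z = 1 / z + z * w z"
    using jacobi_fun_Laurent[OF h] unfolding r_def by blast
  have shift: "deriv f (z + p) = c * deriv f z"
    if p: "p \<in> L" and c: "\<And>z. z \<notin> L \<Longrightarrow> f (z + p) = c * f z" and z: "z \<notin> L" for p c z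
  proof -
    have zp: "z + p \<notin> L" using p z by (simp add: L_def)
    have "((\<lambda>z. f (z + p)) has_field_derivative deriv f (z + p)) (at z)"
      using der[OF zp] DERIV_shift[of f _ z p] by simp
    moreover have "((\<lambda>z. f (z + p)) has_field_derivative c * deriv f z) (at z)"
      by (rule has_field_derivative_transform_within_open[OF DERIV_cmult[OF der[OF z]] op])
         (use z c in auto)
    ultimately show ?thesis by (rule DERIV_unique)
  qed
  have "quasi_periodic \<tau> a b (deriv f)"
    unfolding quasi_periodic_def
    using shift[of 1 a] shift[of \<tau> b] f holomorphic_deriv[OF fh op]
    by (auto simp: L_def jacobi_fun_def quasi_periodic_def)
  moreover have "quasi_periodic \<tau> (a' * (a * a')) (b' * (b * b')) (\<lambda>z. g z * h z)"
    using g h by (auto intro!: quasi_periodic_mult simp: jacobi_fun_def)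
  moreover have "a' * (a * a') = a" "b' * (b * b') = b" using ab by auto
  ultimately have "quasi_periodic \<tau> a b (\<lambda>z. deriv f z + g z * h z)"
    using quasi_periodic_lincomb(2) by metis
  moreover have "((\<lambda>z. z * (deriv f z + g z * h z)) \<longlongrightarrow> 0) (at 0)"
  proof (rule tendsto_0_near)
    show "r > 0" by (rule r)
    show "(\<lambda>z. z * (u z + z * deriv u z + (v z + w z) + z\<^sup>2 * (v z * w z))) holomorphic_on ball 0 r"
      by (intro holomorphic_intros u(1) v(1) w(1)) auto
    fix z :: complex assume z: "z \<in> ball 0 r - {0}"
    have "((\<lambda>z. 1 / z + z * u z) has_field_derivative (- 1 / z\<^sup>2 + (u z + z * deriv u z))) (at z)"
      using z holomorphic_derivI[OF u(1), of z]
      by (auto intro!: derivative_eq_intros simp: field_simps power2_eq_square)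
    hence "(f has_field_derivative (- 1 / z\<^sup>2 + (u z + z * deriv u z))) (at z)"
      by (rule has_field_derivative_transform_within_open[of _ _ _ "ball 0 r - {0}"]) (use u(2) z in auto)
    hence df: "deriv f z = - 1 / z\<^sup>2 + (u z + z * deriv u z)" by (rule DERIV_imp_deriv)
    show "z * (deriv f z + g z * h z) = z * (u z + z * deriv u z + (v z + w z) + z\<^sup>2 * (v z * w z))"
      using z unfolding df v(2)[OF z] w(2)[OF z] by (simp add: field_simps power2_eq_square)
  qed simp
  moreover have "norm a = 1" "norm b = 1" and ne: "a \<noteq> 1 \<or> b \<noteq> 1" using ab by auto
  ultimately obtain c where "deriv f z + g z * h z = c" "c = 0"
    using quasi_periodic_Liouville[OF tau, of a b "\<lambda>z. deriv f z + g z * h z"] z by metis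
  hence "deriv f z = - (g z * h z)" using z by (simp add: L_def eq_neg_iff_add_eq_0)
  thus ?thesis using der[of z] z by (simp add: L_def)
qed

lemma connected_compl_period_lattice: "connected (- period_lattice \<tau>)"
  using connected_open_diff_countable[of UNIV "period_lattice \<tau>"] countable_period_lattice[of \<tau>]
    connected_UNIV by (simp add: Compl_eq_Diff_UNIV del: connected_UNIV)

text \<open>Near 0 the sum f + g behaves like 2/z and has no zeros, so equal squares would give f =
  g there, then everywhere by continuation, against the different characters. This is the source of
  the non-vanishing of the theta constants.\<close>

lemma jacobi_fun_sq_neq:
  assumes f: "jacobi_fun \<tau> a b f" and g: "jacobi_fun \<tau> a' b' g" and ne: "(a, b) \<noteq> (a', b')"
  obtains z where "z \<notin> period_lattice \<tau>" "(f z)\<^sup>2 \<noteq> (g z)\<^sup>2"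
proof (rule ccontr)
  define r where "r = min 1 (Im \<tau>)"
  define L where "L = period_lattice \<tau>"
  assume *: "\<not> thesis"
  note result = that
  have eq: "(f z)\<^sup>2 = (g z)\<^sup>2" if "z \<notin> L" for z using * that result[of z] unfolding L_def by blast
  have tau: "Im \<tau> > 0" using f by (simp add: jacobi_fun_def)
  have r: "r > 0" using tau by (simp add: r_def)
  have nL: "z \<notin> L" if "z \<in> ball 0 r - {0}" for z
    using that period_lattice_ball[OF tau] by (simp add: r_def L_def)
  have lf: "((\<lambda>z. z * f z) \<longlongrightarrow> 1) (at 0)" and lg: "((\<lambda>z. z * g z) \<longlongrightarrow> 1) (at 0)"
    using f g by (simp_all add: jacobi_fun_def)
  have "\<forall>\<^sub>F z in at 0. z * f z + z * g z \<noteq> 0" "\<forall>\<^sub>F z in at 0. z * f z \<noteq> 0"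
    using tendsto_imp_eventually_ne[OF tendsto_add[OF lf lg], of 0] tendsto_imp_eventually_ne[OF lf, of 0]
    by simp_all
  hence "\<forall>\<^sub>F z in at 0. f z + g z \<noteq> 0 \<and> f z \<noteq> 0" by eventually_elim (metis distrib_left mult_zero_right)
  then obtain d where d: "d > 0" "\<And>z. z \<noteq> 0 \<Longrightarrow> norm z < d \<Longrightarrow> f z + g z \<noteq> 0 \<and> f z \<noteq> 0"
    by (auto simp: eventually_at)
  define U where "U = ball 0 (min r d) - {0 :: complex}"
  have UL: "U \<subseteq> - L" using nL by (auto simp: U_def)
  have fg: "f z = g z" if "z \<in> U" for z
  proof -
    have "(f z - g z) * (f z + g z) = 0" using eq[of z] that UL by (auto simp: algebra_simps power2_eq_square)
    thus ?thesis using d(2)[of z] that by (auto simp: U_def)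
  qed
  define z0 where "z0 = (of_real (min r d / 2) :: complex)"
  have z0: "z0 \<in> U" using r d by (auto simp: U_def z0_def)
  have fgL: "f z = g z" if "z \<in> - L" for z
  proof (rule analytic_continuation_open[of U "- L" f g])
    show "open U" "open (- L)" using tau by (auto simp: U_def L_def open_delete)
    show "connected (- L)" by (simp add: L_def connected_compl_period_lattice)
  qed (use that z0 UL fg f g in \<open>auto simp: L_def jacobi_fun_holomorphic\<close>)
  have "z0 \<notin> L" using z0 UL by auto
  hence "f (z0 + 1) = a * f z0" "g (z0 + 1) = a' * g z0" "f (z0 + \<tau>) = b * f z0" "g (z0 + \<tau>) = b' * g z0"
    and "z0 + 1 \<in> - L" "z0 + \<tau> \<in> - L"
    using f g by (auto simp: jacobi_fun_def quasi_periodic_def L_def)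
  hence "a * f z0 = a' * f z0" "b * f z0 = b' * f z0" using fgL[of z0] \<open>z0 \<notin> L\<close> fgL by auto
  moreover have "f z0 \<noteq> 0" using d(2)[of z0] z0 by (auto simp: U_def)
  ultimately show False using ne by auto
qed

section \<open>Sums of cosecants\<close>

lemma summable_on_int_nat_abs:
  fixes g :: "nat \<Rightarrow> real"
  assumes "summable g" "\<And>n. g n \<ge> 0"
  shows "(\<lambda>m::int. g (nat \<bar>m\<bar>)) summable_on UNIV"
proof -
  have g: "g summable_on UNIV" using assms by (simp add: summable_on_UNIV_nonneg_real_iff)
  have inj: "inj int" "inj (\<lambda>n. - int n)" by (auto simp: inj_on_def)
  have "(\<lambda>m::int. g (nat \<bar>m\<bar>)) summable_on range int"
    "(\<lambda>m::int. g (nat \<bar>m\<bar>)) summable_on range (\<lambda>n. - int n)"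
    using g by (simp_all add: summable_on_reindex[OF inj(1)] summable_on_reindex[OF inj(2)] o_def)
  moreover have "(UNIV :: int set) = range int \<union> range (\<lambda>n. - int n)"
    by (auto simp: image_iff) (metis int_cases2)
  ultimately show ?thesis using summable_on_union by metis
qed

lemma summable_on_norm_bound:
  fixes f :: "'a \<Rightarrow> complex"
  assumes "M summable_on X" "\<And>m. m \<in> X \<Longrightarrow> norm (f m) \<le> M m"
  shows "f summable_on X"
  using Infinite_Sum.abs_summable_on_comparison_test'[OF assms] abs_summable_summable by blast

lemma holomorphic_on_infsum:
  fixes f :: "'a \<Rightarrow> complex \<Rightarrow> complex"
  assumes S: "open S" and hol: "\<And>m. m \<in> X \<Longrightarrow> f m holomorphic_on S"
    and le: "\<And>m z. m \<in> X \<Longrightarrow> z \<in> S \<Longrightarrow> norm (f m z) \<le> M m" and sum: "M summable_on X"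
  shows "(\<lambda>z. \<Sum>\<^sub>\<infinity>m\<in>X. f m z) holomorphic_on S"
proof -
  have "(\<lambda>z. \<Sum>\<^sub>\<infinity>m\<in>X. f m z) field_differentiable at z" if "z \<in> S" for z
  proof -
    obtain d where d: "d > 0" "cball z d \<subseteq> S" using S \<open>z \<in> S\<close> open_contains_cball by blast
    have ul: "uniform_limit (cball z d) (\<lambda>F w. \<Sum>m\<in>F. f m w) (\<lambda>w. \<Sum>\<^sub>\<infinity>m\<in>X. f m w) (finite_subsets_at_top X)"
      by (rule Weierstrass_m_test_general[OF _ sum]) (use d le in auto)
    have holF: "(\<lambda>w. \<Sum>m\<in>F. f m w) holomorphic_on S" if "F \<subseteq> X" for F
      using that by (intro holomorphic_intros hol) auto
    have "\<forall>\<^sub>F F in finite_subsets_at_top X. continuous_on (cball z d) (\<lambda>w. \<Sum>m\<in>F. f m w) \<and>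
        (\<lambda>w. \<Sum>m\<in>F. f m w) holomorphic_on ball z d"
    proof (rule eventually_finite_subsets_at_top_weakI)
      fix F assume F: "finite F" "F \<subseteq> X"
      show "continuous_on (cball z d) (\<lambda>w. \<Sum>m\<in>F. f m w) \<and> (\<lambda>w. \<Sum>m\<in>F. f m w) holomorphic_on ball z d"
        using holomorphic_on_subset[OF holF[OF F(2)]] d(2) ball_subset_cball[of z d]
          holomorphic_on_imp_continuous_on by blast
    qed
    from holomorphic_uniform_limit[OF this ul] 
    have "(\<lambda>w. \<Sum>\<^sub>\<infinity>m\<in>X. f m w) holomorphic_on ball z d" by auto
    thus ?thesis using d(1) by (simp add: holomorphic_on_imp_differentiable_at)
  qed
  thus ?thesis by (simp add: holomorphic_on_def field_differentiable_at_within)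
qed

text \<open>The growth is exponential, but a quadratic bound already compares the cosecant series
  with the sum of 1/m^2.\<close>

lemma norm_sin_ge: "norm (sin w) \<ge> (Im w)\<^sup>2 / 4"
proof -
  have "exp \<bar>Im w\<bar> - exp (- \<bar>Im w\<bar>) \<le> 2 * norm (sin w)"
  proof -
    have "norm (exp (\<i> * w) - exp (- (\<i> * w))) = 2 * norm (sin w)"
      by (simp add: sin_exp_eq norm_divide norm_mult)
    moreover have "norm (exp (\<i> * w)) = exp (- Im w)" "norm (exp (- (\<i> * w))) = exp (Im w)" by simp_all
    moreover have "\<bar>norm (exp (\<i> * w)) - norm (exp (- (\<i> * w)))\<bar> \<le> norm (exp (\<i> * w) - exp (- (\<i> * w)))"
      by (rule norm_triangle_ineq3)
    ultimately show ?thesis by (auto simp: abs_if split: if_splits)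
  qed
  moreover have "1 + \<bar>Im w\<bar> + \<bar>Im w\<bar>\<^sup>2 / 2 \<le> exp \<bar>Im w\<bar>" by (rule exp_lower_Taylor_quadratic) simp
  moreover have "exp (- \<bar>Im w\<bar>) \<le> 1" by simp
  ultimately show ?thesis by (simp del: exp_le_one_iff)
qed

lemma sin_pi_nonzero:
  assumes "Im w \<noteq> 0"
  shows "sin (of_real pi * w) \<noteq> 0"
proof -
  have "(pi * Im w)\<^sup>2 > 0" using assms by simp
  thus ?thesis using norm_sin_ge[of "of_real pi * w"] by auto
qed

lemma norm_csc_le:
  assumes "c > 0" "\<bar>Im w\<bar> \<ge> c"
  shows "norm (of_real pi / sin (of_real pi * w)) \<le> 2 / c\<^sup>2"
proof -
  have c2: "c\<^sup>2 \<le> (Im w)\<^sup>2" using assms by (metis abs_of_pos abs_le_square_iff)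
  \<comment> \<open>The sine bound yields 4/(\<pi> c^2); \<pi> \<ge> 2 rounds this up to
    2/c^2.\<close>
  have "2 * pi * c\<^sup>2 \<le> pi * pi * c\<^sup>2" using pi_ge_two by (intro mult_right_mono) auto
  also have "\<dots> \<le> pi * pi * (Im w)\<^sup>2" using c2 by (intro mult_left_mono) auto
  also have "\<dots> = (Im (of_real pi * w))\<^sup>2" by (simp add: power2_eq_square)
  also have "\<dots> \<le> 4 * norm (sin (of_real pi * w))" using norm_sin_ge[of "of_real pi * w"] by simp
  finally have le: "pi * c\<^sup>2 \<le> 2 * norm (sin (of_real pi * w))" by simp
  have "norm (sin (of_real pi * w)) > 0" using assms sin_pi_nonzero[of w] by auto
  thus ?thesis using le assms by (simp add: norm_divide field_simps)
qed

text \<open>\<pi>/sin(\<pi> w) is the symmetric sum of (-1)^n/(w + n) over all integers n, so each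
  term is one row of the lattice and the sign -1 under z + 1 is built in. The factor
  \<open>e powi m\<close> supplies the sign under z + \<tau>.\<close>

definition csc_term :: "complex \<Rightarrow> complex \<Rightarrow> int \<Rightarrow> complex \<Rightarrow> complex" where
  "csc_term e \<tau> m z = e powi m * (of_real pi / sin (of_real pi * (z + of_int m * \<tau>)))"

definition csc_sum :: "complex \<Rightarrow> complex \<Rightarrow> complex \<Rightarrow> complex" where
  "csc_sum e \<tau> z = (\<Sum>\<^sub>\<infinity>m. csc_term e \<tau> m z)"

lemma csc_term_le:
  assumes "norm e = 1" "c > 0" "\<bar>Im (z + of_int m * \<tau>)\<bar> \<ge> \<bar>of_int m\<bar> * c" "m \<noteq> 0"
  shows "norm (csc_term e \<tau> m z) \<le> 2 / c\<^sup>2 * (1 / real (nat \<bar>m\<bar>) ^ 2)"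
proof -
  have "norm (csc_term e \<tau> m z) \<le> 2 / (\<bar>of_int m\<bar> * c)\<^sup>2"
    using norm_csc_le[of "\<bar>of_int m\<bar> * c" "z + of_int m * \<tau>"] assms
    unfolding csc_term_def norm_mult[of "e powi m"] norm_power_int_1[OF assms(1)] by simp
  thus ?thesis by (simp add: power_mult_distrib mult.commute)
qed

lemma summable_on_inverse_squares: "(\<lambda>m::int. c * (1 / real (nat \<bar>m\<bar>) ^ 2)) summable_on X"
proof -
  have "summable (\<lambda>n. 1 / real n ^ 2)" using inverse_power_summable[of 2, where 'a = real] by (simp add: field_simps)
  hence "(\<lambda>m::int. 1 / real (nat \<bar>m\<bar>) ^ 2) summable_on UNIV"
    by (intro summable_on_int_nat_abs) auto
  thus ?thesis using summable_on_cmult_right summable_on_subset_banach by blast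
qed

text \<open>In the strip \<open>S\<close> only rows with |m| < N can have poles: for the others the
  imaginary part of z + m \<tau> is at least |m| Im \<tau>/2 in modulus, so the tail is holomorphic
  and dominated by 1/m^2.\<close>

lemma csc_tail:
  assumes tau: "Im \<tau> > 0" and e: "norm e = 1" and N: "N \<ge> (1::int)"
  defines "S \<equiv> {z. \<bar>Im z\<bar> < of_int N * Im \<tau> / 2}"
  shows "(\<lambda>z. \<Sum>\<^sub>\<infinity>m\<in>{m. \<bar>m\<bar> \<ge> N}. csc_term e \<tau> m z) holomorphic_on S"
    and "z \<in> S \<Longrightarrow> (\<lambda>m. csc_term e \<tau> m z) summable_on {m. \<bar>m\<bar> \<ge> N}"
    and "z \<in> S \<Longrightarrow> csc_sum e \<tau> z = (\<Sum>m\<in>{m. \<bar>m\<bar> < N}. csc_term e \<tau> m z) +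
           (\<Sum>\<^sub>\<infinity>m\<in>{m. \<bar>m\<bar> \<ge> N}. csc_term e \<tau> m z)"
proof -
  define c where "c = Im \<tau> / 2"
  have c: "c > 0" using tau by (simp add: c_def)
  have im: "\<bar>Im (z + of_int m * \<tau>)\<bar> \<ge> \<bar>of_int m\<bar> * c" if "z \<in> S" "\<bar>m\<bar> \<ge> N" for z m
  proof -
    have "\<bar>Im z\<bar> < of_int N * c" using that(1) by (simp add: S_def c_def)
    moreover have "of_int N * c \<le> of_int \<bar>m\<bar> * c" using that(2) c by (intro mult_right_mono) auto
    moreover have "\<bar>of_int m * Im \<tau>\<bar> = 2 * (of_int \<bar>m\<bar> * c)" using tau by (simp add: c_def abs_mult)
    moreover have "\<bar>Im (z + of_int m * \<tau>)\<bar> \<ge> \<bar>of_int m * Im \<tau>\<bar> - \<bar>Im z\<bar>" by simp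
    ultimately show ?thesis by (simp only: of_int_abs)
  qed
  have le: "norm (csc_term e \<tau> m z) \<le> 2 / c\<^sup>2 * (1 / real (nat \<bar>m\<bar>) ^ 2)"
    if "m \<in> {m. \<bar>m\<bar> \<ge> N}" "z \<in> S" for m z
    by (rule csc_term_le[OF e c im]) (use that N in auto)
  have opS: "open S" unfolding S_def by (intro open_Collect_less) (auto intro!: continuous_intros)
  show "(\<lambda>z. \<Sum>\<^sub>\<infinity>m\<in>{m. \<bar>m\<bar> \<ge> N}. csc_term e \<tau> m z) holomorphic_on S"
  proof (rule holomorphic_on_infsum[OF opS _ le summable_on_inverse_squares])
    fix m assume m: "m \<in> {m. \<bar>m\<bar> \<ge> N}"
    have "sin (of_real pi * (z + of_int m * \<tau>)) \<noteq> 0" if "z \<in> S" for z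
    proof -
      have "\<bar>of_int m\<bar> * c > 0" using m N c by auto
      thus ?thesis using im[OF that, of m] m by (intro sin_pi_nonzero) auto
    qed
    thus "csc_term e \<tau> m holomorphic_on S" unfolding csc_term_def by (intro holomorphic_intros)
  qed
  show sm: "(\<lambda>m. csc_term e \<tau> m z) summable_on {m. \<bar>m\<bar> \<ge> N}" if "z \<in> S" for z
    by (rule summable_on_norm_bound[OF summable_on_inverse_squares le]) (use that in auto)
  have fin: "finite {m::int. \<bar>m\<bar> < N}"
    by (rule finite_subset[of _ "{-N..N}"]) auto
  show "csc_sum e \<tau> z = (\<Sum>m\<in>{m. \<bar>m\<bar> < N}. csc_term e \<tau> m z) +
           (\<Sum>\<^sub>\<infinity>m\<in>{m. \<bar>m\<bar> \<ge> N}. csc_term e \<tau> m z)" if "z \<in> S"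
  proof -
    have "csc_sum e \<tau> z = infsum (\<lambda>m. csc_term e \<tau> m z) ({m. \<bar>m\<bar> < N} \<union> {m. \<bar>m\<bar> \<ge> N})"
      unfolding csc_sum_def by (rule arg_cong[where f = "infsum _"]) auto
    also have "\<dots> = infsum (\<lambda>m. csc_term e \<tau> m z) {m. \<bar>m\<bar> < N} + infsum (\<lambda>m. csc_term e \<tau> m z) {m. \<bar>m\<bar> \<ge> N}"
      by (rule infsum_Un_disjoint) (use sm[OF that] fin in \<open>auto intro: summable_on_finite\<close>)
    finally show ?thesis using fin by simp
  qed
qed

lemma sin_pi_eq_0: "sin (of_real pi * w) = 0 \<longleftrightarrow> w \<in> (\<int> :: complex set)"
proof -
  have "sin (of_real pi * w) = 0 \<longleftrightarrow> (\<exists>n::int. w = of_int n)"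
    by (auto simp: sin_eq_0)
  thus ?thesis by (auto elim!: Ints_cases)
qed

lemma csc_term_holomorphic: "csc_term e \<tau> m holomorphic_on - period_lattice \<tau>"
proof -
  have "z + of_int m * \<tau> \<notin> \<int>" if "z \<notin> period_lattice \<tau>" for z
  proof
    assume "z + of_int m * \<tau> \<in> \<int>"
    then obtain n where "z + of_int m * \<tau> = of_int n" by (auto elim: Ints_cases)
    hence "z = of_int n + of_int (- m) * \<tau>" by (simp add: algebra_simps)
    thus False using that by (metis period_latticeI)
  qed
  thus ?thesis unfolding csc_term_def by (intro holomorphic_intros) (auto simp: sin_pi_eq_0)
qed

lemma csc_sum_jacobi_fun:
  assumes tau: "Im \<tau> > 0" and e: "e \<in> {1, -1}"
  shows "jacobi_fun \<tau> (-1) e (csc_sum e \<tau>)"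
proof -
  define L where "L = period_lattice \<tau>"
  have en: "norm e = 1" using e by auto
  have hol: "csc_sum e \<tau> holomorphic_on - L"
  proof -
    have "csc_sum e \<tau> field_differentiable at z" if z: "z \<in> - L" for z
    proof -
      \<comment> \<open>Large enough for \<open>z\<close> to lie in the strip of
        \<open>csc_tail\<close>.\<close>
      define N where "N = max 1 (\<lceil>2 * \<bar>Im z\<bar> / Im \<tau>\<rceil> + 1)"
      define S where "S = {z. \<bar>Im z\<bar> < of_int N * Im \<tau> / 2}"
      have N: "N \<ge> 1" by (simp add: N_def)
      have "2 * \<bar>Im z\<bar> / Im \<tau> < of_int N" unfolding N_def by linarith
      hence zS: "z \<in> S" using tau by (simp add: S_def field_simps)
      have "open S" unfolding S_def by (intro open_Collect_less continuous_intros)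
      hence op: "open (S \<inter> - L)" using tau by (auto simp: L_def)
      have "(\<lambda>z. (\<Sum>m\<in>{m. \<bar>m\<bar> < N}. csc_term e \<tau> m z) + (\<Sum>\<^sub>\<infinity>m\<in>{m. \<bar>m\<bar> \<ge> N}. csc_term e \<tau> m z))
          holomorphic_on S \<inter> - L"
        using csc_tail(1)[OF tau en N] csc_term_holomorphic[of e \<tau>] unfolding S_def L_def
        by (intro holomorphic_intros) (auto intro: holomorphic_on_subset)
      hence "csc_sum e \<tau> holomorphic_on S \<inter> - L"
        by (rule holomorphic_transform) (use csc_tail(3)[OF tau en N] in \<open>auto simp: S_def\<close>)
      thus ?thesis using zS z op by (auto intro: holomorphic_on_imp_differentiable_at)
    qed
    thus ?thesis by (simp add: holomorphic_on_def field_differentiable_at_within)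
  qed
  have 1: "csc_sum e \<tau> (z + 1) = - csc_sum e \<tau> z" for z
  proof -
    have "csc_term e \<tau> m (z + 1) = - csc_term e \<tau> m z" for m
    proof -
      have "sin (of_real pi * (z + of_int m * \<tau>) + of_real pi) = - sin (of_real pi * (z + of_int m * \<tau>))"
        by (simp add: sin_add)
      moreover have "of_real pi * (z + of_int m * \<tau>) + of_real pi = of_real pi * (z + 1 + of_int m * \<tau>)"
        by (simp add: algebra_simps)
      ultimately show ?thesis by (simp add: csc_term_def)
    qed
    thus ?thesis by (simp add: csc_sum_def infsum_uminus)
  qed
  have 2: "csc_sum e \<tau> (z + \<tau>) = e * csc_sum e \<tau> z" for z
  proof -
    \<comment> \<open>As e^2 = 1, the factor e^m equals e times e^(m+1).\<close>
    have "csc_term e \<tau> m (z + \<tau>) = e * csc_term e \<tau> (m + 1) z" for m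
      using e by (auto simp: csc_term_def algebra_simps power_int_add)
    hence "csc_sum e \<tau> (z + \<tau>) = e * (\<Sum>\<^sub>\<infinity>m. csc_term e \<tau> (m + 1) z)"
      by (simp add: csc_sum_def infsum_cmult_right')
    also have "(\<Sum>\<^sub>\<infinity>m. csc_term e \<tau> (m + 1) z) = csc_sum e \<tau> z"
      unfolding csc_sum_def
      by (rule infsum_reindex_bij_witness[of _ "\<lambda>m. m - 1" "\<lambda>m. m + 1"]) auto
    finally show ?thesis .
  qed
  have "((\<lambda>z. z * csc_sum e \<tau> z) \<longlongrightarrow> 1) (at 0)"
  proof -
    define S where "S = {z. \<bar>Im z\<bar> < of_int 1 * Im \<tau> / 2}"
    define T where "T = (\<lambda>z. \<Sum>\<^sub>\<infinity>m\<in>{m. \<bar>m\<bar> \<ge> 1}. csc_term e \<tau> m z)"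
    have opS: "open S" unfolding S_def by (intro open_Collect_less continuous_intros)
    have 0: "0 \<in> S" using tau by (simp add: S_def)
    have "T holomorphic_on S" using csc_tail(1)[OF tau en, of 1] by (simp add: S_def T_def)
    hence T: "(T \<longlongrightarrow> T 0) (at 0)"
      using 0 opS by (auto dest!: holomorphic_on_imp_continuous_on simp: continuous_on_eq_continuous_at isCont_def)
    have "((\<lambda>z. sin (of_real pi * z)) has_field_derivative of_real pi) (at (0::complex))"
      by (auto intro!: derivative_eq_intros)
    hence "((\<lambda>z. sin (of_real pi * z) / z) \<longlongrightarrow> of_real pi) (at (0::complex))"
      by (simp add: has_field_derivative_iff)
    hence "((\<lambda>z. of_real pi / (sin (of_real pi * z) / z)) \<longlongrightarrow> of_real pi / of_real pi) (at (0::complex))"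
      by (intro tendsto_intros) auto
    hence "((\<lambda>z. of_real pi / (sin (of_real pi * z) / z) + z * T z) \<longlongrightarrow> 1 + 0 * T 0) (at (0::complex))"
      by (intro tendsto_add tendsto_mult T) auto
    hence lim: "((\<lambda>z. of_real pi / (sin (of_real pi * z) / z) + z * T z) \<longlongrightarrow> 1) (at (0::complex))" by simp
    show ?thesis
    proof (rule Lim_transform_within_open[OF lim opS 0])
      fix z assume z: "z \<in> S" "z \<noteq> 0"
      have "{m::int. \<bar>m\<bar> < 1} = {0}" by auto
      hence "csc_sum e \<tau> z = csc_term e \<tau> 0 z + T z"
        using csc_tail(3)[OF tau en, of 1 z] z by (simp add: S_def T_def)
      thus "of_real pi / (sin (of_real pi * z) / z) + z * T z = z * csc_sum e \<tau> z"
        by (simp add: csc_term_def algebra_simps)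
    qed
  qed
  thus ?thesis using tau e hol 1 2 by (auto simp: jacobi_fun_def quasi_periodic_def L_def)
qed

text \<open>Now the argument moves with \<tau>, through the half periods 1/2 and 1/2 + \<tau>/2. The
  majorant \<open>M y\<close> is uniform on Im \<tau> \<ge> y: this gives holomorphy by varying y,
  and boundedness towards the cusp by taking y = 1.\<close>

lemma csc_sum_half_holomorphic:
  assumes e: "norm e = 1" and s: "s = 0 \<or> s = (1/2 :: real)"
  shows "(\<lambda>\<tau>. csc_sum e \<tau> (1/2 + of_real s * \<tau>)) holomorphic_on uhp"
    and "\<exists>K. \<forall>\<tau>. Im \<tau> \<ge> 1 \<longrightarrow> norm (csc_sum e \<tau> (1/2 + of_real s * \<tau>)) \<le> K"
proof -
  \<comment> \<open>The entry at m = 0 covers both cases: the term is the constant \<pi> for s = 0,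
    and obeys the cosecant bound at height y/2 for s = 1/2.\<close>
  define M where "M = (\<lambda>y (m::int). if m = 0 then pi + 2 / (y/2)\<^sup>2 else 2 / (y/2)\<^sup>2 * (1 / real (nat \<bar>m\<bar>) ^ 2))"
  have Ms: "M y summable_on UNIV" for y
  proof -
    have "M y summable_on {m. m \<noteq> 0}"
      using summable_on_inverse_squares[of "2 / (y/2)\<^sup>2" "{m. m \<noteq> 0}"]
      by (rule summable_on_cong[THEN iffD1, rotated]) (auto simp: M_def)
    moreover have "M y summable_on {0}" by simp
    moreover have "UNIV = {m. m \<noteq> 0} \<union> {0::int}" by auto
    ultimately show ?thesis using summable_on_union by metis
  qed
  have le: "norm (csc_term e \<tau> m (1/2 + of_real s * \<tau>)) \<le> M y m" if y: "0 < y" "y \<le> Im \<tau>" for y \<tau> m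
  proof (cases "m = 0")
    case False
    have "\<bar>of_int m\<bar> * (y/2) \<le> \<bar>of_int m\<bar> * (Im \<tau>/2)" using y by (intro mult_left_mono) auto
    also have "\<dots> = (\<bar>of_int m\<bar> / 2) * Im \<tau>" by simp
    also have "\<dots> \<le> \<bar>s + of_int m\<bar> * Im \<tau>"
    proof (intro mult_right_mono)
      have "m \<ge> 1 \<or> m \<le> -1" using False by linarith
      hence "(of_int m :: real) \<ge> 1 \<or> (of_int m :: real) \<le> -1" by linarith
      thus "\<bar>of_int m\<bar> / 2 \<le> \<bar>s + of_int m\<bar>" using s by auto
    qed (use y in auto)
    also have "\<dots> = \<bar>(s + of_int m) * Im \<tau>\<bar>" using y by (simp add: abs_mult)
    finally show ?thesis using False csc_term_le[OF e, of "y/2" m "1/2 + of_real s * \<tau>" \<tau>] y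
      by (simp add: M_def algebra_simps)
  next
    case True
    show ?thesis using s
    proof
      assume "s = 0"
      thus ?thesis using True y by (simp add: csc_term_def M_def sin_of_real[symmetric] del: sin_of_real)
    next
      assume s: "s = 1/2"
      have "norm (csc_term e \<tau> m (1/2 + of_real s * \<tau>)) \<le> 2 / (y/2)\<^sup>2"
        using norm_csc_le[of "y/2" "1/2 + of_real s * \<tau>"] y True unfolding csc_term_def s by simp
      thus ?thesis using True by (simp add: M_def add_increasing)
    qed
  qed
  have hol: "(\<lambda>\<tau>. csc_term e \<tau> m (1/2 + of_real s * \<tau>)) holomorphic_on {\<tau>. Im \<tau> > y}" if "y > 0" for y m
  proof -
    have "sin (of_real pi * (1/2 + of_real s * \<tau> + of_int m * \<tau>)) \<noteq> 0" if "Im \<tau> > y" for \<tau>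
    proof (cases "s + of_int m = 0")
      case True
      have "s \<noteq> 1/2"
      proof
        assume "s = 1/2"
        hence "real_of_int (2 * m) = real_of_int (- 1)" using True by simp
        hence "2 * m = - 1" by (simp only: of_int_eq_iff)
        thus False by presburger
      qed
      hence "s = 0" "m = 0" using s True by auto
      thus ?thesis by (simp add: sin_of_real[symmetric] del: sin_of_real)
    next
      case False
      hence "Im (1/2 + of_real s * \<tau> + of_int m * \<tau>) \<noteq> 0" using that \<open>y > 0\<close>
        by (simp add: distrib_right[symmetric])
      thus ?thesis by (rule sin_pi_nonzero)
    qed
    thus ?thesis unfolding csc_term_def by (intro holomorphic_intros) auto
  qed
  show "(\<lambda>\<tau>. csc_sum e \<tau> (1/2 + of_real s * \<tau>)) holomorphic_on uhp"
  proof -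
    have "(\<lambda>\<tau>. csc_sum e \<tau> (1/2 + of_real s * \<tau>)) field_differentiable at \<tau>" if "\<tau> \<in> uhp" for \<tau>
    proof -
      define y where "y = Im \<tau> / 2"
      have y: "y > 0" "y < Im \<tau>" using that by (auto simp: uhp_def y_def)
      have op: "open {\<tau>. Im \<tau> > y}" by (rule open_halfspace_Im_gt)
      have "(\<lambda>\<tau>. csc_sum e \<tau> (1/2 + of_real s * \<tau>)) holomorphic_on {\<tau>. Im \<tau> > y}"
        unfolding csc_sum_def
        by (rule holomorphic_on_infsum[OF op hol le Ms]) (use y in auto)
      thus ?thesis using op y by (auto intro: holomorphic_on_imp_differentiable_at)
    qed
    thus ?thesis by (simp add: holomorphic_on_def field_differentiable_at_within)
  qed
  have "norm (csc_sum e \<tau> (1/2 + of_real s * \<tau>)) \<le> infsum (M 1) UNIV" if "Im \<tau> \<ge> 1" for \<tau>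
    unfolding csc_sum_def
    by (rule norm_infsum_le[OF has_sum_infsum has_sum_infsum])
       (use summable_on_norm_bound[OF Ms[of 1]] Ms le that in auto)
  thus "\<exists>K. \<forall>\<tau>. Im \<tau> \<ge> 1 \<longrightarrow> norm (csc_sum e \<tau> (1/2 + of_real s * \<tau>)) \<le> K" by blast
qed

section \<open>Values at half periods and the differential equation\<close>

lemma minus_one_powi: "(-1 :: complex) powi n = (if even n then 1 else -1)"
  by (cases n rule: int_cases2) (auto simp: power_int_minus)

lemma moebius_upper_half_plane:
  fixes a b c d :: int
  assumes tau: "Im \<tau> > 0" and det: "a * d - b * c = 1"
  defines "j \<equiv> of_int c * \<tau> + of_int d"
  defines "\<tau>' \<equiv> (of_int a * \<tau> + of_int b) / j"
  shows "Im \<tau>' > 0" "j \<noteq> 0"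
proof -
  have "j \<noteq> 0"
  proof
    assume "j = 0"
    moreover from this have "of_int c * Im \<tau> = 0" by (simp add: complex_eq_iff j_def)
    ultimately have "c = 0" "d = 0" using tau by (auto simp: j_def)
    thus False using det by simp
  qed
  hence j: "(cmod j)\<^sup>2 > 0" by simp
  have "Im \<tau>' * (cmod j)\<^sup>2 = Im (\<tau>' * j * cnj j)"
    unfolding cmod_power2 by (simp add: power2_eq_square algebra_simps)
  also have "\<tau>' * j = of_int a * \<tau> + of_int b" using \<open>j \<noteq> 0\<close> by (simp add: \<tau>'_def)
  also have "Im (\<dots> * cnj j) = of_int (a * d - b * c) * Im \<tau>"
    by (simp add: j_def algebra_simps)
  finally have "Im \<tau>' * (cmod j)\<^sup>2 > 0" using det tau by simp
  thus "Im \<tau>' > 0" using j by (simp add: zero_less_mult_iff)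
  show "j \<noteq> 0" by fact
qed

text \<open>Multiplication by \<open>j\<close> carries the lattice of \<tau>' onto that of \<tau>,
  with 1 = j (a - c \<tau>') and \<tau> = j (-b + d \<tau>'), whence the exponents; division by
  \<open>j\<close> restores residue 1. The odd determinant keeps the character non-trivial.\<close>

lemma jacobi_fun_moebius:
  fixes a b c d :: int
  assumes tau: "Im \<tau> > 0" and det: "a * d - b * c = 1"
    and f: "jacobi_fun ((of_int a * \<tau> + of_int b) / (of_int c * \<tau> + of_int d)) x y f"
  defines "j \<equiv> of_int c * \<tau> + of_int d"
  shows "jacobi_fun \<tau> (x powi a * y powi (- c)) (x powi (- b) * y powi d) (\<lambda>z. f (z / j) / j)"
    and "z / j \<in> period_lattice ((of_int a * \<tau> + of_int b) / j) \<longleftrightarrow> z \<in> period_lattice \<tau>"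
proof -
  define \<tau>' where "\<tau>' = (of_int a * \<tau> + of_int b) / j"
  have f: "jacobi_fun \<tau>' x y f" using f by (simp add: \<tau>'_def j_def)
  have xy: "x \<in> {1, -1}" "y \<in> {1, -1}" "(x, y) \<noteq> (1, 1)" using f by (auto simp: jacobi_fun_def)
  have j: "j \<noteq> 0" using moebius_upper_half_plane[OF tau det] by (simp add: j_def)
  have jt: "j * \<tau>' = of_int a * \<tau> + of_int b" using j by (simp add: \<tau>'_def)
  have det': "of_int a * of_int d - of_int b * of_int c = (1 :: complex)"
    using det by (metis of_int_1 of_int_diff of_int_mult)
  have p1: "1 = j * (of_int a + of_int (- c) * \<tau>')"
  proof -
    have "j * (of_int a + of_int (- c) * \<tau>') = of_int a * j - of_int c * (j * \<tau>')" by (simp add: algebra_simps)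
    also have "\<dots> = of_int a * of_int d - of_int b * of_int c" unfolding jt by (simp add: j_def algebra_simps)
    finally show ?thesis using det' by simp
  qed
  have p2: "\<tau> = j * (of_int (- b) + of_int d * \<tau>')"
  proof -
    have "j * (of_int (- b) + of_int d * \<tau>') = of_int d * (j * \<tau>') - of_int b * j" by (simp add: algebra_simps)
    also have "\<dots> = (of_int a * of_int d - of_int b * of_int c) * \<tau>" unfolding jt by (simp add: j_def algebra_simps)
    finally show ?thesis using det' by simp
  qed
  have L: "z / j \<in> period_lattice \<tau>' \<longleftrightarrow> z \<in> period_lattice \<tau>" for z
  proof
    assume "z / j \<in> period_lattice \<tau>'"
    then obtain m n where "z / j = of_int m + of_int n * \<tau>'" by (auto simp: period_lattice_def)
    hence "z = of_int m * j + of_int n * (j * \<tau>')" using j by (simp add: field_simps)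
    also have "\<dots> = of_int (m * d + n * b) + of_int (m * c + n * a) * \<tau>"
      unfolding jt by (simp add: j_def algebra_simps)
    finally show "z \<in> period_lattice \<tau>" by (simp only: period_latticeI)
  next
    assume "z \<in> period_lattice \<tau>"
    then obtain m n where z: "z = of_int m * 1 + of_int n * \<tau>" by (auto simp: period_lattice_def)
    have "z = j * (of_int m * (of_int a + of_int (- c) * \<tau>') + of_int n * (of_int (- b) + of_int d * \<tau>'))"
    proof -
      have "of_int m * (j * (of_int a + of_int (- c) * \<tau>')) + of_int n * (j * (of_int (- b) + of_int d * \<tau>')) = z"
        unfolding p1[symmetric] p2[symmetric] by (simp add: z)
      thus ?thesis by (simp only: ring_distribs mult_ac)
    qed
    hence "z / j = of_int m * (of_int a + of_int (- c) * \<tau>') + of_int n * (of_int (- b) + of_int d * \<tau>')"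
      using j by (simp only: nonzero_mult_div_cancel_left not_False_eq_True)
    hence "z / j = of_int (m * a - n * b) + of_int (- m * c + n * d) * \<tau>'"
      by (simp add: algebra_simps)
    thus "z / j \<in> period_lattice \<tau>'" by (simp only: period_latticeI)
  qed
  show "z / j \<in> period_lattice ((of_int a * \<tau> + of_int b) / j) \<longleftrightarrow> z \<in> period_lattice \<tau>"
    using L by (simp add: \<tau>'_def)
  have 1: "f ((z + 1) / j) / j = x powi a * y powi (- c) * (f (z / j) / j)" if "z \<notin> period_lattice \<tau>" for z
  proof -
    have "(z + 1) / j = z / j + (of_int a + of_int (- c) * \<tau>')" using j by (subst p1) (simp add: field_simps)
    hence "f ((z + 1) / j) = x powi a * y powi (- c) * f (z / j)"
      by (simp only:) (rule jacobi_fun_shift[OF f], use L that in simp)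
    thus ?thesis by simp
  qed
  have 2: "f ((z + \<tau>) / j) / j = x powi (- b) * y powi d * (f (z / j) / j)" if "z \<notin> period_lattice \<tau>" for z
  proof -
    have "(z + \<tau>) / j = z / j + (of_int (- b) + of_int d * \<tau>')" using j by (subst p2) (simp add: field_simps)
    hence "f ((z + \<tau>) / j) = x powi (- b) * y powi d * f (z / j)"
      by (simp only:) (rule jacobi_fun_shift[OF f], use L that in simp)
    thus ?thesis by simp
  qed
  have "filterlim (\<lambda>z. z / j) (at 0) (at 0)"
    by (rule filterlim_atI) (use j in \<open>auto intro!: tendsto_eq_intros simp: eventually_at_filter\<close>)
  moreover have "((\<lambda>z. z * f z) \<longlongrightarrow> 1) (at 0)" using f by (simp add: jacobi_fun_def)
  ultimately have lim: "((\<lambda>z. z / j * f (z / j)) \<longlongrightarrow> 1) (at 0)" by (rule filterlim_compose[rotated])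
  have hol: "(\<lambda>z. f (z / j) / j) holomorphic_on - period_lattice \<tau>"
    by (intro holomorphic_intros holomorphic_on_compose_gen[OF _ jacobi_fun_holomorphic[OF f], unfolded o_def])
       (use j L in auto)
  have "odd (a * d - b * c)" using det by simp
  hence nt: "(x powi a * y powi (- c), x powi (- b) * y powi d) \<noteq> (1, 1)"
    and "x powi a * y powi (- c) \<in> {1, -1}" "x powi (- b) * y powi d \<in> {1, -1}"
    using xy by (auto simp: minus_one_powi split: if_splits)
  thus "jacobi_fun \<tau> (x powi a * y powi (- c)) (x powi (- b) * y powi d) (\<lambda>z. f (z / j) / j)"
    using tau hol 1 2 lim unfolding jacobi_fun_def quasi_periodic_def by auto
qed

text \<open>The modular transformation \<open>\<tau> \<mapsto> -1/\<tau>\<close> produces the remaining sign character without summing cotangents.\<close>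

definition csc_sum_dual :: "complex \<Rightarrow> complex \<Rightarrow> complex" where
  "csc_sum_dual \<tau> z = csc_sum 1 (- 1 / \<tau>) (z / \<tau>) / \<tau>"

lemma csc_sum_dual_jacobi_fun:
  assumes "Im \<tau> > 0"
  shows "jacobi_fun \<tau> 1 (-1) (csc_sum_dual \<tau>)"
proof -
  have "Im (- 1 / \<tau>) = Im \<tau> / (cmod \<tau>)\<^sup>2" by (simp add: Im_divide cmod_power2)
  moreover have "\<tau> \<noteq> 0" using assms by auto
  ultimately have "Im (- 1 / \<tau>) > 0" using assms by simp
  hence "jacobi_fun (- 1 / \<tau>) (-1) 1 (csc_sum 1 (- 1 / \<tau>))" by (rule csc_sum_jacobi_fun) simp
  from jacobi_fun_moebius(1)[of \<tau> 0 0 "-1" 1, OF assms _, of "-1" 1] this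
  show ?thesis by (simp add: csc_sum_dual_def[abs_def])
qed

text \<open>
  Up to the factor \<open>\<pi>\<close>, these are the squares of the theta constants \<open>\<theta>\<^sub>3, \<theta>\<^sub>2, \<theta>\<^sub>4\<close> at \<open>\<tau>\<close>, that is,
  \<open>M + P\<close>, \<open>N\<close> and \<open>M - P\<close> in the notation of the paper.
\<close>

definition thA :: "complex \<Rightarrow> complex" where
  "thA \<tau> = (if \<tau> \<in> uhp then csc_sum 1 \<tau> (1/2) else 0)"
definition thB :: "complex \<Rightarrow> complex" where
  "thB \<tau> = (if \<tau> \<in> uhp then csc_sum 1 \<tau> (1/2 + \<tau>/2) else 0)"
definition thC :: "complex \<Rightarrow> complex" where
  "thC \<tau> = (if \<tau> \<in> uhp then csc_sum (-1) \<tau> (1/2) else 0)"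

lemma half_period_notin_lattice:
  assumes "Im \<tau> > 0" "odd m \<or> odd n"
  shows "(of_int m + of_int n * \<tau>) / 2 \<notin> period_lattice \<tau>"
proof
  assume "(of_int m + of_int n * \<tau>) / 2 \<in> period_lattice \<tau>"
  then obtain k l where "(of_int m + of_int n * \<tau>) / 2 = of_int k + of_int l * \<tau>"
    by (auto simp: period_lattice_def)
  hence eq: "of_int m + of_int n * \<tau> = of_int (2 * k) + of_int (2 * l) * \<tau>" by (simp add: field_simps)
  have "m = 2 * k" "n = 2 * l" using period_lattice_coords[OF assms(1) eq] .
  thus False using assms(2) by simp
qed

lemma half_periods_notin_lattice:
  assumes "Im \<tau> > 0"
  shows "1/2 \<notin> period_lattice \<tau>" "\<tau>/2 \<notin> period_lattice \<tau>" "1/2 + \<tau>/2 \<notin> period_lattice \<tau>"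
  using half_period_notin_lattice[OF assms, of 1 0] half_period_notin_lattice[OF assms, of 0 1]
    half_period_notin_lattice[OF assms, of 1 1] by (simp_all add: add_divide_distrib)

text \<open>The constant differences of squares are read off where one function vanishes: the one
  with signs (-1, -1) at 1/2 + \<tau>/2, the dual one at 1/2. Evaluating the first difference at 1/2
  gives Jacobi's identity between the fourth powers of the theta constants. Were a theta constant
  zero, two of the squares would coincide.\<close>

lemma csc_sum_relations:
  assumes tau: "Im \<tau> > 0" and z: "z \<notin> period_lattice \<tau>"
  shows "(csc_sum (-1) \<tau> z)\<^sup>2 = (csc_sum 1 \<tau> z)\<^sup>2 - (thB \<tau>)\<^sup>2"
    and "(csc_sum_dual \<tau> z)\<^sup>2 = (csc_sum 1 \<tau> z)\<^sup>2 - (thA \<tau>)\<^sup>2"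
    and "(thA \<tau>)\<^sup>2 = (thB \<tau>)\<^sup>2 + (thC \<tau>)\<^sup>2"
    and "thA \<tau> \<noteq> 0" "thB \<tau> \<noteq> 0" "thC \<tau> \<noteq> 0"
    and "csc_sum 1 \<tau> (\<tau>/2) = 0"
proof -
  define L where "L = period_lattice \<tau>"
  define f g h where "f = csc_sum 1 \<tau>" and "g = csc_sum (-1) \<tau>" and "h = csc_sum_dual \<tau>"
  have f: "jacobi_fun \<tau> (-1) 1 f" and g: "jacobi_fun \<tau> (-1) (-1) g" and h: "jacobi_fun \<tau> 1 (-1) h"
    using csc_sum_jacobi_fun[OF tau] csc_sum_dual_jacobi_fun[OF tau] by (simp_all add: f_def g_def h_def)
  note nL = half_periods_notin_lattice[OF tau]
  have th: "thA \<tau> = f (1/2)" "thB \<tau> = f (1/2 + \<tau>/2)" "thC \<tau> = g (1/2)"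
    using tau by (simp_all add: thA_def thB_def thC_def f_def g_def uhp_def)
  have f0: "f (\<tau>/2) = 0" by (rule jacobi_fun_half_period[OF f nL(2), of 0 1]) auto
  have g0: "g (1/2 + \<tau>/2) = 0" by (rule jacobi_fun_half_period[OF g nL(3), of 1 1]) auto
  have h0: "h (1/2) = 0" by (rule jacobi_fun_half_period[OF h nL(1), of 1 0]) auto
  obtain c1 where c1: "\<And>z. z \<notin> L \<Longrightarrow> (f z)\<^sup>2 - (g z)\<^sup>2 = c1"
    using jacobi_fun_sq_diff[OF f g] by (auto simp: L_def)
  obtain c2 where c2: "\<And>z. z \<notin> L \<Longrightarrow> (f z)\<^sup>2 - (h z)\<^sup>2 = c2"
    using jacobi_fun_sq_diff[OF f h] by (auto simp: L_def)
  have c1B: "c1 = (thB \<tau>)\<^sup>2" using c1[of "1/2 + \<tau>/2"] nL g0 by (simp add: th L_def)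
  have c2A: "c2 = (thA \<tau>)\<^sup>2" using c2[of "1/2"] nL h0 by (simp add: th L_def)
  have ABC: "(thA \<tau>)\<^sup>2 = (thB \<tau>)\<^sup>2 + (thC \<tau>)\<^sup>2" using c1[of "1/2"] nL by (simp add: th c1B L_def algebra_simps)
  have g2: "(g z)\<^sup>2 = (f z)\<^sup>2 - (thB \<tau>)\<^sup>2" if "z \<notin> L" for z
    using c1[OF that] by (simp add: c1B algebra_simps)
  have h2: "(h z)\<^sup>2 = (f z)\<^sup>2 - (thA \<tau>)\<^sup>2" if "z \<notin> L" for z
    using c2[OF that] by (simp add: c2A algebra_simps)
  show "(csc_sum (-1) \<tau> z)\<^sup>2 = (csc_sum 1 \<tau> z)\<^sup>2 - (thB \<tau>)\<^sup>2"
    "(csc_sum_dual \<tau> z)\<^sup>2 = (csc_sum 1 \<tau> z)\<^sup>2 - (thA \<tau>)\<^sup>2"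
    using g2[of z] h2[of z] z by (simp_all add: L_def f_def g_def h_def)
  show "(thA \<tau>)\<^sup>2 = (thB \<tau>)\<^sup>2 + (thC \<tau>)\<^sup>2" by (rule ABC)
  show "csc_sum 1 \<tau> (\<tau>/2) = 0" using f0 by (simp add: f_def)
  show "thB \<tau> \<noteq> 0"
  proof
    assume "thB \<tau> = 0"
    thus False using jacobi_fun_sq_neq[OF f g] g2 by (auto simp: L_def)
  qed
  show "thA \<tau> \<noteq> 0"
  proof
    assume "thA \<tau> = 0"
    thus False using jacobi_fun_sq_neq[OF f h] h2 by (auto simp: L_def)
  qed
  show "thC \<tau> \<noteq> 0"
  proof
    assume "thC \<tau> = 0"
    thus False using jacobi_fun_sq_neq[OF g h] g2 h2 ABC by (auto simp: L_def)
  qed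
qed

text \<open>The derivative is minus the product of the other two functions, and their squares are
  the function's own square minus constants. The second equation keeps \<open>- (- ...)\<close> so
  that both match the pattern with \<alpha> and \<beta> used for homothety below.\<close>

lemma csc_sum_ode:
  assumes tau: "Im \<tau> > 0" and z: "z \<notin> period_lattice \<tau>"
  shows "\<exists>D. (csc_sum 1 \<tau> has_field_derivative D) (at z) \<and>
     D\<^sup>2 = ((csc_sum 1 \<tau> z)\<^sup>2 - (thA \<tau>)\<^sup>2) * ((csc_sum 1 \<tau> z)\<^sup>2 - (thB \<tau>)\<^sup>2)"
    and "\<exists>D. (csc_sum (-1) \<tau> has_field_derivative D) (at z) \<and>
     D\<^sup>2 = ((csc_sum (-1) \<tau> z)\<^sup>2 - (thC \<tau>)\<^sup>2) * ((csc_sum (-1) \<tau> z)\<^sup>2 - (- (thB \<tau>)\<^sup>2))"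
proof -
  have f: "jacobi_fun \<tau> (-1) 1 (csc_sum 1 \<tau>)" and g: "jacobi_fun \<tau> (-1) (-1) (csc_sum (-1) \<tau>)"
    and h: "jacobi_fun \<tau> 1 (-1) (csc_sum_dual \<tau>)"
    using csc_sum_jacobi_fun[OF tau] csc_sum_dual_jacobi_fun[OF tau] by simp_all
  note r = csc_sum_relations[OF tau z]
  have "(csc_sum 1 \<tau> has_field_derivative - (csc_sum (-1) \<tau> z * csc_sum_dual \<tau> z)) (at z)"
    by (rule jacobi_fun_deriv[OF f g _ z]) (use h in simp)
  moreover have "(- (csc_sum (-1) \<tau> z * csc_sum_dual \<tau> z))\<^sup>2
      = ((csc_sum 1 \<tau> z)\<^sup>2 - (thA \<tau>)\<^sup>2) * ((csc_sum 1 \<tau> z)\<^sup>2 - (thB \<tau>)\<^sup>2)"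
    by (simp add: power_mult_distrib r(1,2))
  ultimately show "\<exists>D. (csc_sum 1 \<tau> has_field_derivative D) (at z) \<and>
     D\<^sup>2 = ((csc_sum 1 \<tau> z)\<^sup>2 - (thA \<tau>)\<^sup>2) * ((csc_sum 1 \<tau> z)\<^sup>2 - (thB \<tau>)\<^sup>2)" by blast
  have "(csc_sum (-1) \<tau> has_field_derivative - (csc_sum 1 \<tau> z * csc_sum_dual \<tau> z)) (at z)"
    by (rule jacobi_fun_deriv[OF g f _ z]) (use h in simp)
  moreover have "(- (csc_sum 1 \<tau> z * csc_sum_dual \<tau> z))\<^sup>2
      = ((csc_sum (-1) \<tau> z)\<^sup>2 - (thC \<tau>)\<^sup>2) * ((csc_sum (-1) \<tau> z)\<^sup>2 - (- (thB \<tau>)\<^sup>2))"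
    by (simp add: power_mult_distrib r(1,2,3) algebra_simps)
  ultimately show "\<exists>D. (csc_sum (-1) \<tau> has_field_derivative D) (at z) \<and>
     D\<^sup>2 = ((csc_sum (-1) \<tau> z)\<^sup>2 - (thC \<tau>)\<^sup>2) * ((csc_sum (-1) \<tau> z)\<^sup>2 - (- (thB \<tau>)\<^sup>2))" by blast
qed

section \<open>Uniqueness for the quartic differential equation, and homothety\<close>

lemma linear_ode_zero:
  fixes w k :: "complex \<Rightarrow> complex"
  assumes r: "r > 0" and k: "k holomorphic_on ball 0 r"
    and w: "\<And>z. z \<in> ball 0 r \<Longrightarrow> (w has_field_derivative w z * k z) (at z)" and w0: "w 0 = 0"
    and z: "z \<in> ball 0 r"
  shows "w z = 0"
proof -
  obtain K where K: "\<And>z. z \<in> ball 0 r \<Longrightarrow> (K has_field_derivative k z) (at z within ball 0 r)"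
    using holomorphic_convex_primitive'[OF convex_ball open_ball k] by auto
  have "((\<lambda>z. w z * exp (- K z)) has_field_derivative 0) (at z within ball 0 r)" if "z \<in> ball 0 r" for z
    using that K[OF that] w[OF that]
    by (auto intro!: derivative_eq_intros has_field_derivative_at_within[OF w] simp: algebra_simps)
  from has_field_derivative_zero_constant[OF convex_ball this] obtain c
    where "\<And>z. z \<in> ball 0 r \<Longrightarrow> w z * exp (- K z) = c" by blast
  from this[of z] this[of 0] z r w0 show ?thesis by auto
qed

text \<open>
  The difference of two solutions satisfies a linear homogeneous equation near \<open>0\<close>: divide the
  difference of the two squared equations by \<open>s' + t'\<close>, which is \<open>2\<close> at \<open>0\<close>.
\<close>

lemma quartic_ode_unique:
  fixes s t :: "complex \<Rightarrow> complex"
  assumes r: "r > 0" and s: "s holomorphic_on ball 0 r" "s 0 = 0" "deriv s 0 = 1"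
    and t: "t holomorphic_on ball 0 r" "t 0 = 0" "deriv t 0 = 1"
    and odes: "\<And>z. z \<in> ball 0 r - {0} \<Longrightarrow> (deriv s z)\<^sup>2 = (1 - \<alpha> * (s z)\<^sup>2) * (1 - \<beta> * (s z)\<^sup>2)"
    and odet: "\<And>z. z \<in> ball 0 r - {0} \<Longrightarrow> (deriv t z)\<^sup>2 = (1 - \<alpha> * (t z)\<^sup>2) * (1 - \<beta> * (t z)\<^sup>2)"
  obtains \<rho> where "\<rho> > 0" "\<rho> \<le> r" "\<And>z. z \<in> ball 0 \<rho> \<Longrightarrow> s z = t z"
proof -
  have hd: "(\<lambda>z. deriv s z + deriv t z) holomorphic_on ball 0 r"
    by (intro holomorphic_intros s t) auto
  hence "isCont (\<lambda>z. deriv s z + deriv t z) 0" using r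
    by (auto dest!: holomorphic_on_imp_continuous_on simp: continuous_on_eq_continuous_at)
  moreover have "deriv s 0 + deriv t 0 \<noteq> 0" using s t by simp
  ultimately obtain e where e: "e > 0" "\<And>z. dist 0 z < e \<Longrightarrow> deriv s z + deriv t z \<noteq> 0"
    using continuous_at_avoid by blast
  define \<rho> where "\<rho> = min e r"
  define Q where "Q = (\<lambda>z. (s z + t z) * (- (\<alpha> + \<beta>) + \<alpha> * \<beta> * ((s z)\<^sup>2 + (t z)\<^sup>2)))"
  define k where "k = (\<lambda>z. Q z / (deriv s z + deriv t z))"
  have \<rho>: "\<rho> > 0" "\<rho> \<le> r" using e r by (auto simp: \<rho>_def)
  have sub: "ball 0 \<rho> \<subseteq> ball (0::complex) r" using \<rho> by auto
  note s' = holomorphic_on_subset[OF s(1) sub] and t' = holomorphic_on_subset[OF t(1) sub]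
  have kh: "k holomorphic_on ball 0 \<rho>"
    unfolding k_def Q_def using e by (intro holomorphic_intros s' t') (auto simp: \<rho>_def)
  have wd: "((\<lambda>z. s z - t z) has_field_derivative (s z - t z) * k z) (at z)" if z: "z \<in> ball 0 \<rho>" for z
  proof -
    have zr: "z \<in> ball 0 r" using z sub by blast
    have nz: "deriv s z + deriv t z \<noteq> 0" using e z by (auto simp: \<rho>_def)
    have "(deriv s z)\<^sup>2 - (deriv t z)\<^sup>2 = (s z - t z) * Q z"
    \<comment> \<open>The equations are not assumed at 0, but there both sides vanish by the initial
      values.\<close>
    proof (cases "z = 0")
      case False
      hence "z \<in> ball 0 r - {0}" using zr by simp
      thus ?thesis unfolding odes[OF \<open>z \<in> ball 0 r - {0}\<close>] odet[OF \<open>z \<in> ball 0 r - {0}\<close>] Q_def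
        by (simp add: algebra_simps power2_eq_square)
    qed (use s t in simp)
    hence "deriv s z - deriv t z = (s z - t z) * k z"
      using nz by (simp add: k_def power2_eq_square field_simps)
    moreover have "((\<lambda>z. s z - t z) has_field_derivative deriv s z - deriv t z) (at z)"
      by (intro DERIV_diff holomorphic_derivI[OF s(1)] holomorphic_derivI[OF t(1)]) (use zr in auto)
    ultimately show ?thesis by simp
  qed
  show ?thesis
  proof (rule that[OF \<rho>])
    fix z :: complex assume "z \<in> ball 0 \<rho>"
    from linear_ode_zero[OF \<rho>(1) kh wd _ this] s(2) t(2) show "s z = t z" by simp
  qed
qed

text \<open>Passing to 1/f turns the pole with residue 1 into the initial values s(0) = 0 and s'(0)
  = 1; dividing the equation by f^4 reverses the polynomial.\<close>

lemma jacobi_fun_reciprocal: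
  assumes f: "jacobi_fun \<tau> a b f"
    and ode: "\<And>z. z \<notin> period_lattice \<tau> \<Longrightarrow> \<exists>D. (f has_field_derivative D) (at z) \<and>
       D\<^sup>2 = ((f z)\<^sup>2 - \<alpha>) * ((f z)\<^sup>2 - \<beta>)"
  obtains r s where "r > 0" "s holomorphic_on ball 0 r" "s 0 = 0" "deriv s 0 = 1"
    "\<And>z. z \<in> ball 0 r - {0} \<Longrightarrow> z \<notin> period_lattice \<tau> \<and> f z \<noteq> 0 \<and> s z = 1 / f z"
    "\<And>z. z \<in> ball 0 r - {0} \<Longrightarrow> (deriv s z)\<^sup>2 = (1 - \<alpha> * (s z)\<^sup>2) * (1 - \<beta> * (s z)\<^sup>2)"
proof -
  define q where "q = min 1 (Im \<tau>)"
  have tau: "Im \<tau> > 0" using f by (simp add: jacobi_fun_def)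
  have q: "q > 0" using tau by (simp add: q_def)
  obtain v where v: "v holomorphic_on ball 0 q" "\<And>z. z \<in> ball 0 q - {0} \<Longrightarrow> f z = 1 / z + z * v z"
    using jacobi_fun_Laurent[OF f] unfolding q_def by blast
  define u where "u = (\<lambda>z. 1 + z\<^sup>2 * v z)"
  have uh: "u holomorphic_on ball 0 q" unfolding u_def by (intro holomorphic_intros v)
  hence "isCont u 0" using q
    by (auto dest!: holomorphic_on_imp_continuous_on simp: continuous_on_eq_continuous_at)
  moreover have "u 0 \<noteq> 0" by (simp add: u_def)
  ultimately obtain e where e: "e > 0" "\<And>z. dist 0 z < e \<Longrightarrow> u z \<noteq> 0"
    using continuous_at_avoid by blast
  define r where "r = min e q"
  define s where "s = (\<lambda>z. z / u z)"
  have r: "r > 0" using e q by (simp add: r_def)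
  have uh': "u holomorphic_on ball 0 r" by (rule holomorphic_on_subset[OF uh]) (auto simp: r_def)
  have unz: "u z \<noteq> 0" if "z \<in> ball 0 r" for z using that e by (auto simp: r_def)
  have sh: "s holomorphic_on ball 0 r" unfolding s_def
    by (intro holomorphic_intros uh') (use unz in auto)
  have fs: "z \<notin> period_lattice \<tau> \<and> f z \<noteq> 0 \<and> s z = 1 / f z" if z: "z \<in> ball 0 r - {0}" for z
  proof -
    have "z \<in> ball 0 q - {0}" using z by (auto simp: r_def)
    moreover from this have "f z = u z / z" using z v(2)[of z] by (simp add: u_def field_simps power2_eq_square)
    moreover have "u z \<noteq> 0" using unz[of z] z by blast
    ultimately show ?thesis using period_lattice_ball[OF tau, of z] z by (auto simp: s_def q_def)
  qed
  have "(s has_field_derivative 1) (at 0)"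
  proof -
    have "(u has_field_derivative deriv u 0) (at 0)" using holomorphic_derivI[OF uh'] r by simp
    from DERIV_divide[OF DERIV_ident this] have "(s has_field_derivative 1 / u 0) (at 0)"
      using unz[of 0] r by (simp add: s_def[abs_def])
    thus ?thesis by (simp add: u_def)
  qed
  hence s': "deriv s 0 = 1" by (rule DERIV_imp_deriv)
  have sode: "(deriv s z)\<^sup>2 = (1 - \<alpha> * (s z)\<^sup>2) * (1 - \<beta> * (s z)\<^sup>2)" if z: "z \<in> ball 0 r - {0}" for z
  proof -
    from fs[OF z] ode obtain D where D: "(f has_field_derivative D) (at z)"
      "D\<^sup>2 = ((f z)\<^sup>2 - \<alpha>) * ((f z)\<^sup>2 - \<beta>)" by blast
    have "((\<lambda>z. 1 / f z) has_field_derivative - D / (f z)\<^sup>2) (at z)"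
      using D(1) fs[OF z] by (auto intro!: derivative_eq_intros simp: power2_eq_square)
    hence "(s has_field_derivative - D / (f z)\<^sup>2) (at z)"
      by (rule has_field_derivative_transform_within_open[of _ _ _ "ball 0 r - {0}"]) (use fs z in auto)
    hence "deriv s z = - D / (f z)\<^sup>2" by (rule DERIV_imp_deriv)
    hence "(deriv s z)\<^sup>2 = ((f z)\<^sup>2 - \<alpha>) * ((f z)\<^sup>2 - \<beta>) / ((f z)\<^sup>2 * (f z)\<^sup>2)"
      unfolding D(2)[symmetric] by (simp add: power_divide power2_eq_square)
    thus ?thesis using fs[OF z] by (simp add: field_simps power2_eq_square)
  qed
  show ?thesis by (rule that[OF r sh _ s' fs sode]) (auto simp: s_def)
qed

text \<open>If s is the reciprocal of f, then s(c z)/c solves the equation of 1/g with the same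
  initial values, so the two agree near 0. The identity then spreads over the complement of both
  pole sets, which is connected because these are countable.\<close>

lemma jacobi_fun_homothety:
  assumes f: "jacobi_fun \<tau> a b f" and g: "jacobi_fun \<tau>' a' b' g" and c: "c \<noteq> 0"
    and odef: "\<And>z. z \<notin> period_lattice \<tau> \<Longrightarrow> \<exists>D. (f has_field_derivative D) (at z) \<and>
       D\<^sup>2 = ((f z)\<^sup>2 - \<alpha>) * ((f z)\<^sup>2 - \<beta>)"
    and odeg: "\<And>z. z \<notin> period_lattice \<tau>' \<Longrightarrow> \<exists>D. (g has_field_derivative D) (at z) \<and>
       D\<^sup>2 = ((g z)\<^sup>2 - c\<^sup>2 * \<alpha>) * ((g z)\<^sup>2 - c\<^sup>2 * \<beta>)"
    and z: "z \<notin> period_lattice \<tau>'" "c * z \<notin> period_lattice \<tau>"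
  shows "g z = c * f (c * z)"
proof -
  obtain r1 s where s: "r1 > 0" "s holomorphic_on ball 0 r1" "s 0 = 0" "deriv s 0 = 1"
    "\<And>z. z \<in> ball 0 r1 - {0} \<Longrightarrow> z \<notin> period_lattice \<tau> \<and> f z \<noteq> 0 \<and> s z = 1 / f z"
    "\<And>z. z \<in> ball 0 r1 - {0} \<Longrightarrow> (deriv s z)\<^sup>2 = (1 - \<alpha> * (s z)\<^sup>2) * (1 - \<beta> * (s z)\<^sup>2)"
    using jacobi_fun_reciprocal[OF f odef] by metis
  obtain r2 t where t: "r2 > 0" "t holomorphic_on ball 0 r2" "t 0 = 0" "deriv t 0 = 1"
    "\<And>z. z \<in> ball 0 r2 - {0} \<Longrightarrow> z \<notin> period_lattice \<tau>' \<and> g z \<noteq> 0 \<and> t z = 1 / g z"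
    "\<And>z. z \<in> ball 0 r2 - {0} \<Longrightarrow> (deriv t z)\<^sup>2 = (1 - c\<^sup>2 * \<alpha> * (t z)\<^sup>2) * (1 - c\<^sup>2 * \<beta> * (t z)\<^sup>2)"
    using jacobi_fun_reciprocal[OF g odeg] by metis
  define r where "r = min (r1 / norm c) r2"
  have r: "r > 0" using s(1) t(1) c by (simp add: r_def)
  have cz: "c * z \<in> ball 0 r1" if "z \<in> ball 0 r" for z
    using that c by (auto simp: r_def norm_mult field_simps)
  define s' where "s' = (\<lambda>z. s (c * z) / c)"
  have s'h: "s' holomorphic_on ball 0 r" unfolding s'_def
    by (intro holomorphic_intros holomorphic_on_compose_gen[OF _ s(2), unfolded o_def]) (use cz c in auto)
  have s'd: "deriv s' z = deriv s (c * z)" if "z \<in> ball 0 r" for z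
  proof -
    have "(s has_field_derivative deriv s (c * z)) (at (c * z))"
      using holomorphic_derivI[OF s(2)] cz[OF that] by simp
    hence "(s' has_field_derivative deriv s (c * z)) (at z)"
      unfolding s'_def using c by (auto intro!: derivative_eq_intros DERIV_chain2)
    thus ?thesis by (rule DERIV_imp_deriv)
  qed
  have th: "t holomorphic_on ball 0 r" by (rule holomorphic_on_subset[OF t(2)]) (auto simp: r_def)
  obtain \<rho> where \<rho>: "\<rho> > 0" "\<rho> \<le> r" "\<And>z. z \<in> ball 0 \<rho> \<Longrightarrow> s' z = t z"
  proof (rule quartic_ode_unique[OF r s'h _ _ th, where \<alpha> = "c\<^sup>2 * \<alpha>" and \<beta> = "c\<^sup>2 * \<beta>"])
    show "s' 0 = 0" "deriv s' 0 = 1" "t 0 = 0" "deriv t 0 = 1"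
      using s t s'd[of 0] r by (auto simp: s'_def)
    fix z :: complex assume z: "z \<in> ball 0 r - {0}"
    have "c * z \<in> ball 0 r1 - {0}" using cz[of z] z c by auto
    from s(6)[OF this] show "(deriv s' z)\<^sup>2 = (1 - c\<^sup>2 * \<alpha> * (s' z)\<^sup>2) * (1 - c\<^sup>2 * \<beta> * (s' z)\<^sup>2)"
      using s'd[of z] z c by (simp add: s'_def power_divide)
    show "(deriv t z)\<^sup>2 = (1 - c\<^sup>2 * \<alpha> * (t z)\<^sup>2) * (1 - c\<^sup>2 * \<beta> * (t z)\<^sup>2)"
      using t(6)[of z] z by (simp add: r_def)
  qed blast
  define Z where "Z = period_lattice \<tau>' \<union> (\<lambda>z. c * z) -` period_lattice \<tau>"
  have "(\<lambda>z. c * z) -` period_lattice \<tau> = (\<lambda>z. z / c) ` period_lattice \<tau>"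
    using c by (auto simp: image_iff field_simps)
  hence "countable Z" by (simp add: Z_def countable_period_lattice)
  hence con: "connected (- Z)"
    using connected_open_diff_countable[of UNIV Z] connected_UNIV
    by (simp add: Compl_eq_Diff_UNIV del: connected_UNIV)
  have "closed Z" unfolding Z_def using f g
    by (intro closed_Un closed_vimage closed_period_lattice continuous_intros) (auto simp: jacobi_fun_def)
  hence op: "open (- Z)" by (rule open_Compl)
  have eq: "c * f (c * z) = g z" and nZ: "z \<in> - Z" if z: "z \<in> ball 0 \<rho> - {0}" for z
  proof -
    have zr: "z \<in> ball 0 r - {0}" using z \<rho>(2) by auto
    hence "c * z \<in> ball 0 r1 - {0}" using cz[of z] c by auto
    note 1 = s(5)[OF this]
    have 2: "z \<notin> period_lattice \<tau>' \<and> g z \<noteq> 0 \<and> t z = 1 / g z" using t(5)[of z] zr by (simp add: r_def)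
    show "z \<in> - Z" using 1 2 by (simp add: Z_def)
    have "s (c * z) / c = t z" using \<rho>(3)[of z] z by (simp add: s'_def)
    thus "c * f (c * z) = g z" using 1 2 c by (simp add: field_simps)
  qed
  have "c * f (c * z) = g z"
  proof (rule analytic_continuation_open[of "ball 0 \<rho> - {0}" "- Z" "\<lambda>z. c * f (c * z)" g])
    show "(\<lambda>z. c * f (c * z)) holomorphic_on - Z"
      by (intro holomorphic_intros holomorphic_on_compose_gen[OF _ jacobi_fun_holomorphic[OF f], unfolded o_def])
         (auto simp: Z_def)
    show "g holomorphic_on - Z"
      by (rule holomorphic_on_subset[OF jacobi_fun_holomorphic[OF g]]) (auto simp: Z_def)
    have "of_real (\<rho> / 2) \<in> ball (0 :: complex) \<rho> - {0}" using \<rho>(1) by auto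
    thus "ball (0 :: complex) \<rho> - {0} \<noteq> {}" by blast
    show "z \<in> - Z" using z by (simp add: Z_def)
  qed (use eq nZ con op in \<open>auto simp: open_delete\<close>)
  thus ?thesis by simp
qed

text \<open>\<open>g\<close> has a pole with residue 1 or -1 at each point w of its lattice, so c
  f(c z) cannot be regular there.\<close>

lemma homothety_lattice_subset:
  assumes f: "jacobi_fun \<tau> a b f" and g: "jacobi_fun \<tau>' a' b' g"
    and eq: "\<And>z. z \<notin> period_lattice \<tau>' \<Longrightarrow> c * z \<notin> period_lattice \<tau> \<Longrightarrow> g z = c * f (c * z)"
    and w: "w \<in> period_lattice \<tau>'"
  shows "c * w \<in> period_lattice \<tau>"
proof (rule ccontr)
  assume nin: "c * w \<notin> period_lattice \<tau>"
  have tau: "Im \<tau> > 0" "Im \<tau>' > 0" using f g by (auto simp: jacobi_fun_def)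
  obtain m n where wmn: "w = of_int m + of_int n * \<tau>'" using w by (auto simp: period_lattice_def)
  define x where "x = a' powi m * b' powi n"
  have x: "x \<noteq> 0" using g by (auto simp: x_def jacobi_fun_def)
  have "\<forall>\<^sub>F u in at 0. u \<in> ball 0 (min 1 (Im \<tau>')) - {0}"
    using tau by (intro eventually_at_in_open) auto
  hence ev1: "\<forall>\<^sub>F u in at 0. u \<notin> period_lattice \<tau>'"
    by eventually_elim (rule period_lattice_ball[OF tau(2)])
  have cont: "isCont (\<lambda>u. c * (u + w)) 0" by (intro continuous_intros)
  hence "\<forall>\<^sub>F u in at 0. c * (u + w) \<in> - period_lattice \<tau>"
    using tau nin unfolding isCont_def
    by (intro topological_tendstoD) auto
  with ev1 have ev: "\<forall>\<^sub>F u in at 0. u * (c * f (c * (u + w))) = x * (u * g u)"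
  proof eventually_elim
    case (elim u)
    have "g (u + w) = x * g u" unfolding wmn x_def by (rule jacobi_fun_shift[OF g elim(1)])
    moreover have "u + w \<notin> period_lattice \<tau>'" using elim w by simp
    ultimately show ?case using eq[of "u + w"] elim by simp
  qed
  have "isCont f (c * w)" using jacobi_fun_holomorphic[OF f] nin tau
    by (auto dest!: holomorphic_on_imp_continuous_on simp: continuous_on_eq_continuous_at)
  hence "isCont (\<lambda>u. u * (c * f (c * (u + w)))) 0"
    by (intro continuous_intros isCont_o2[OF cont]) auto
  hence "((\<lambda>u. u * (c * f (c * (u + w)))) \<longlongrightarrow> 0) (at 0)" by (simp add: isCont_def)
  hence "((\<lambda>u. x * (u * g u)) \<longlongrightarrow> 0) (at 0)" using tendsto_cong[OF ev] by blast
  moreover have "((\<lambda>u. x * (u * g u)) \<longlongrightarrow> x * 1) (at 0)"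
    using g by (intro tendsto_mult tendsto_const) (auto simp: jacobi_fun_def)
  ultimately show False using x tendsto_unique[OF at_neq_bot] by fastforce
qed

section \<open>Theta constants and \<open>\<Gamma>(4)\<close>\<close>

lemma csc_sum_shift:
  assumes "Im \<tau> > 0" "e \<in> {1, -1}" "z \<notin> period_lattice \<tau>"
  shows "csc_sum e \<tau> (z + (of_int m + of_int n * \<tau>)) = (-1) powi m * e powi n * csc_sum e \<tau> z"
  by (rule jacobi_fun_shift[OF csc_sum_jacobi_fun]) (use assms in auto)

text \<open>Homothety identifies c times the lattice of \<tau>' with the lattice of \<tau>, so c and
  c \<tau>' have integral coordinates: these are the rows of the matrix. One common factor for all
  three values, without free signs, is what forces the congruences modulo 4.\<close>

lemma theta_injective:
  assumes tau: "Im \<tau> > 0" and tau': "Im \<tau>' > 0"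
    and eqA: "thA \<tau>' = c * thA \<tau>" and eqB: "thB \<tau>' = c * thB \<tau>" and eqC: "thC \<tau>' = c * thC \<tau>"
  obtains a b k d :: int where "a * d - b * k = 1" "4 dvd a - 1" "4 dvd b" "4 dvd k" "4 dvd d - 1"
    "c = of_int k * \<tau> + of_int d" "c * \<tau>' = of_int a * \<tau> + of_int b"
proof -
  define f where "f = csc_sum 1 \<tau>"
  define f2 where "f2 = csc_sum (-1) \<tau>"
  define g where "g = csc_sum 1 \<tau>'"
  define g2 where "g2 = csc_sum (-1) \<tau>'"
  have f: "jacobi_fun \<tau> (-1) 1 f" and f2: "jacobi_fun \<tau> (-1) (-1) f2"
    and g: "jacobi_fun \<tau>' (-1) 1 g" and g2: "jacobi_fun \<tau>' (-1) (-1) g2"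
    unfolding f_def f2_def g_def g2_def by (intro csc_sum_jacobi_fun tau tau'; simp)+
  note nL = half_periods_notin_lattice[OF tau] and nL' = half_periods_notin_lattice[OF tau']
  note rel' = csc_sum_relations[OF tau' nL'(1)]
  note rel = csc_sum_relations[OF tau nL(1)]
  have c: "c \<noteq> 0" using eqA rel'(4) by auto
  have th: "thA \<tau> = f (1/2)" "thB \<tau> = f (1/2 + \<tau>/2)" "thC \<tau> = f2 (1/2)"
    "thA \<tau>' = g (1/2)" "thB \<tau>' = g (1/2 + \<tau>'/2)" "thC \<tau>' = g2 (1/2)"
    using tau tau' by (simp_all add: thA_def thB_def thC_def f_def g_def f2_def g2_def uhp_def)
  have sq: "c\<^sup>2 * (thA \<tau>)\<^sup>2 = (thA \<tau>')\<^sup>2" "c\<^sup>2 * (thB \<tau>)\<^sup>2 = (thB \<tau>')\<^sup>2"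
    "c\<^sup>2 * (thC \<tau>)\<^sup>2 = (thC \<tau>')\<^sup>2" "c\<^sup>2 * (- (thB \<tau>)\<^sup>2) = - (thB \<tau>')\<^sup>2"
    by (simp_all add: eqA eqB eqC power_mult_distrib)
  have hom: "g z = c * f (c * z)" if "z \<notin> period_lattice \<tau>'" "c * z \<notin> period_lattice \<tau>" for z
    by (rule jacobi_fun_homothety[OF f g c, where \<alpha> = "(thA \<tau>)\<^sup>2" and \<beta> = "(thB \<tau>)\<^sup>2", unfolded sq])
       (use that csc_sum_ode(1)[OF tau] csc_sum_ode(1)[OF tau'] in \<open>auto simp: f_def g_def\<close>)
  have hom2: "g2 z = c * f2 (c * z)" if "z \<notin> period_lattice \<tau>'" "c * z \<notin> period_lattice \<tau>" for z
    by (rule jacobi_fun_homothety[OF f2 g2 c, where \<alpha> = "(thC \<tau>)\<^sup>2" and \<beta> = "- (thB \<tau>)\<^sup>2", unfolded sq])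
       (use that csc_sum_ode(2)[OF tau] csc_sum_ode(2)[OF tau'] in \<open>auto simp: f2_def g2_def\<close>)
  have sub: "c * w \<in> period_lattice \<tau>" if "w \<in> period_lattice \<tau>'" for w
    using homothety_lattice_subset[OF f g hom that] .
  have sub': "1 / c * w \<in> period_lattice \<tau>'" if "w \<in> period_lattice \<tau>" for w
  proof (rule homothety_lattice_subset[OF g f _ that])
    fix z assume "z \<notin> period_lattice \<tau>" "1 / c * z \<notin> period_lattice \<tau>'"
    thus "f z = 1 / c * g (1 / c * z)" using hom[of "1 / c * z"] c by simp
  qed
  obtain k d where kd: "c = of_int d + of_int k * \<tau>"
    using sub[OF one_in_period_lattice] unfolding period_lattice_def by auto
  obtain a b where ab: "c * \<tau>' = of_int b + of_int a * \<tau>"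
    using sub[OF tau_in_period_lattice] unfolding period_lattice_def by auto
  obtain k' d' where kd': "1 / c = of_int d' + of_int k' * \<tau>'"
    using sub'[OF one_in_period_lattice] unfolding period_lattice_def by auto
  obtain a' b' where ab': "1 / c * \<tau> = of_int b' + of_int a' * \<tau>'"
    using sub'[OF tau_in_period_lattice] unfolding period_lattice_def by auto
  have "1 = of_int d' * c + of_int k' * (c * \<tau>')"
    using kd' c by (simp add: field_simps)
  hence "of_int 1 + of_int 0 * \<tau> = of_int (d' * d + k' * b) + of_int (d' * k + k' * a) * \<tau>"
    unfolding ab by (simp add: kd algebra_simps)
  note e1 = period_lattice_coords[OF tau this]
  have "\<tau> = of_int b' * c + of_int a' * (c * \<tau>')"
    using ab' c by (simp add: field_simps)
  hence "of_int 0 + of_int 1 * \<tau> = of_int (b' * d + a' * b) + of_int (b' * k + a' * a) * \<tau>"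
    unfolding ab by (simp add: kd algebra_simps)
  note e2 = period_lattice_coords[OF tau this]
  \<comment> \<open>The primed integers give 1/c and \<tau>/c in terms of \<tau>', so the two
    coordinate matrices are inverse to each other.\<close>
  have "(a * d - b * k) * (a' * d' - b' * k') = (b' * k + a' * a) * (d' * d + k' * b) - (b' * d + a' * b) * (d' * k + k' * a)"
    by (simp add: algebra_simps)
  hence "(a * d - b * k) * (a' * d' - b' * k') = 1" using e1 e2 by simp
  hence det1: "\<bar>a * d - b * k\<bar> = 1" by (metis abs_mult abs_1 zmult_eq_1_iff abs_ge_zero zdvd1_eq dvd_triv_left)
  \<comment> \<open>Orientation excludes determinant -1: both points lie in the upper half
    plane.\<close>
  have "Im \<tau>' * (cmod c)\<^sup>2 = Im (c * \<tau>' * cnj c)"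
    unfolding cmod_power2 by (simp add: power2_eq_square algebra_simps)
  also have "\<dots> = of_int (a * d - b * k) * Im \<tau>"
    unfolding ab by (simp add: kd algebra_simps)
  finally have "of_int (a * d - b * k) * Im \<tau> > 0" using tau' c by (metis zero_less_power2 norm_eq_zero mult_pos_pos)
  hence "real_of_int (a * d - b * k) > 0" using tau by (simp only: zero_less_mult_iff) auto
  hence "a * d - b * k > 0" by (simp only: of_int_0_less_iff)
  hence det: "a * d - b * k = 1" using det1 by simp
  have c2: "c * (1/2) \<notin> period_lattice \<tau>"
    using sub'[of "c * (1/2)"] nL'(1) c by auto
  have gv: "g (1/2) = c * f (c * (1/2))" "g2 (1/2) = c * f2 (c * (1/2))"
    using hom hom2 nL'(1) c2 by auto
  have nz: "g (1/2) \<noteq> 0" "g2 (1/2) \<noteq> 0" using rel'(4,6) th by auto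
  have w1: "g (1/2 + w) = c * f (c * (1/2) + c * w)" "g2 (1/2 + w) = c * f2 (c * (1/2) + c * w)"
    if w: "w \<in> period_lattice \<tau>'" for w
  proof -
    have "1/2 + w \<notin> period_lattice \<tau>'" using nL'(1) w by simp
    moreover have "c * (1/2 + w) \<notin> period_lattice \<tau>"
      using c2 sub[OF w] by (simp add: distrib_left del: times_divide_eq_right mult_1_right)
    ultimately show "g (1/2 + w) = c * f (c * (1/2) + c * w)" "g2 (1/2 + w) = c * f2 (c * (1/2) + c * w)"
      using hom[of "1/2 + w"] hom2[of "1/2 + w"] by (simp_all add: distrib_left)
  qed
  \<comment> \<open>A period of \<tau>' and its image under multiplication by c must act with the
    same sign. The function \<open>f\<close> sees only coefficients of 1 and settles d and b modulo
    2; \<open>f2\<close> also sees coefficients of \<tau> and settles k.\<close>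
  have d_odd: "odd d"
  proof -
    have "- g (1/2) = g (1/2 + 1)" using jacobi_fun_shift[OF g nL'(1), of 1 0] by simp
    also have "\<dots> = c * f (c * (1/2) + (of_int d + of_int k * \<tau>))" using w1(1)[of 1] kd by simp
    also have "\<dots> = (-1) powi d * g (1/2)" using jacobi_fun_shift[OF f c2, of d k] gv by simp
    finally show ?thesis using nz by (auto simp: minus_one_powi split: if_splits)
  qed
  have b_even: "even b"
  proof -
    have "g (1/2) = g (1/2 + \<tau>')" using jacobi_fun_shift[OF g nL'(1), of 0 1] by simp
    also have "\<dots> = c * f (c * (1/2) + (of_int b + of_int a * \<tau>))" using w1(1)[of \<tau>'] ab by simp
    also have "\<dots> = (-1) powi b * g (1/2)" using jacobi_fun_shift[OF f c2, of b a] gv by simp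
    finally show ?thesis using nz by (auto simp: minus_one_powi split: if_splits)
  qed
  have k_even: "even k"
  proof -
    have "- g2 (1/2) = g2 (1/2 + 1)" using jacobi_fun_shift[OF g2 nL'(1), of 1 0] by simp
    also have "\<dots> = c * f2 (c * (1/2) + (of_int d + of_int k * \<tau>))" using w1(2)[of 1] kd by simp
    also have "\<dots> = (-1) powi d * (-1) powi k * g2 (1/2)" using jacobi_fun_shift[OF f2 c2, of d k] gv by simp
    finally show ?thesis using nz d_odd by (auto simp: minus_one_powi split: if_splits)
  qed
  have "odd (a * d - b * k)" using det by simp
  hence a_odd: "odd a" using b_even by auto
  obtain d1 k1 b1 a1 where dv: "d = 2 * d1 + 1" "k = 2 * k1" "b = 2 * b1" "a = 2 * a1 + 1"
    using d_odd k_even b_even a_odd by (auto elim!: oddE evenE)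
  \<comment> \<open>From here on values are compared, not just translation signs: c moves each half
    period by a lattice vector, and equality of the values forces that vector to have trivial sign.
    Halving has gained one more factor 2 in each congruence.\<close>
  have ch: "c * (1/2) = 1/2 + (of_int d1 + of_int k1 * \<tau>)" unfolding kd dv by (simp add: field_simps)
  have d1: "even d1"
  proof -
    have "c * f (1/2) = c * ((-1) powi d1 * f (1/2))"
      using eqA gv(1) jacobi_fun_shift[OF f nL(1), of d1 k1] unfolding th ch by simp
    thus ?thesis using c rel(4) by (auto simp: th minus_one_powi split: if_splits)
  qed
  have k1: "even k1"
  proof -
    have "c * f2 (1/2) = c * ((-1) powi d1 * (-1) powi k1 * f2 (1/2))"
      using eqC gv(2) jacobi_fun_shift[OF f2 nL(1), of d1 k1] unfolding th ch by simp
    thus ?thesis using c d1 rel(6) by (auto simp: th minus_one_powi split: if_splits)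
  qed
  have b1: "even b1"
  proof -
    have ct: "c * (1/2 + \<tau>'/2) = 1/2 + \<tau>/2 + (of_int (d1 + b1) + of_int (k1 + a1) * \<tau>)"
    proof -
      have "c * (1/2 + \<tau>'/2) = c * (1/2) + c * \<tau>' / 2" by (simp add: distrib_left)
      also have "\<dots> = 1/2 + \<tau>/2 + (of_int (d1 + b1) + of_int (k1 + a1) * \<tau>)"
        unfolding ch ab dv by (simp add: algebra_simps add_divide_distrib)
      finally show ?thesis .
    qed
    hence "c * (1/2 + \<tau>'/2) \<notin> period_lattice \<tau>"
      using nL(3) period_lattice_add_iff[OF period_latticeI] by metis
    hence "g (1/2 + \<tau>'/2) = c * f (c * (1/2 + \<tau>'/2))" using hom nL'(3) by simp
    also have "\<dots> = c * ((-1) powi (d1 + b1) * f (1/2 + \<tau>/2))"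
      unfolding ct by (subst jacobi_fun_shift[OF f nL(3)]) simp
    finally have "c * f (1/2 + \<tau>/2) = c * ((-1) powi (d1 + b1) * f (1/2 + \<tau>/2))" using eqB by (simp add: th)
    thus ?thesis using c d1 rel(5) by (auto simp: th minus_one_powi split: if_splits)
  qed
  have 4: "4 dvd b" "4 dvd k" "4 dvd d - 1" using d1 k1 b1 unfolding dv by (auto elim!: evenE)
  have "a - 1 = b * k - a * (d - 1)" using det by (simp add: algebra_simps)
  hence "4 dvd a - 1" using 4 by (metis dvd_diff dvd_mult dvd_mult2)
  thus ?thesis using that[of a d b k] det 4 kd ab by (simp add: add.commute)
qed

text \<open>Congruence modulo 2 preserves the two characters, so uniqueness gives the factor
  \<open>j\<close> for the functions; congruence modulo 4 moves half periods by twice a lattice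
  vector, which costs no sign.\<close>

lemma theta_Gamma4:
  fixes a b c d :: int
  assumes tau: "Im \<tau> > 0" and det: "a * d - b * c = 1"
    and 4: "4 dvd a - 1" "4 dvd b" "4 dvd c" "4 dvd d - 1"
  defines "j \<equiv> of_int c * \<tau> + of_int d"
  defines "\<tau>' \<equiv> (of_int a * \<tau> + of_int b) / j"
  shows "thA \<tau>' = j * thA \<tau>" "thB \<tau>' = j * thB \<tau>" "thC \<tau>' = j * thC \<tau>"
proof -
  have tau': "Im \<tau>' > 0" and j: "j \<noteq> 0" using moebius_upper_half_plane[OF tau det] by (simp_all add: j_def \<tau>'_def)
  obtain d1 c1 b1 a1 where "d - 1 = 4 * d1" "c = 4 * c1" "b = 4 * b1" "a - 1 = 4 * a1"
    using 4 by (auto elim!: dvdE)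
  hence dv: "d = 4 * d1 + 1" "c = 4 * c1" "b = 4 * b1" "a = 4 * a1 + 1" by auto
  note nL = half_periods_notin_lattice[OF tau] and nL' = half_periods_notin_lattice[OF tau']
  have jt: "j * \<tau>' = of_int a * \<tau> + of_int b" using j by (simp add: \<tau>'_def)
  have inL: "z / j \<in> period_lattice \<tau>' \<longleftrightarrow> z \<in> period_lattice \<tau>" for z
    using jacobi_fun_moebius(2)[OF tau det, of "-1" 1 "csc_sum 1 \<tau>'"] csc_sum_jacobi_fun[OF tau', of 1]
    by (simp add: j_def \<tau>'_def)
  have main: "csc_sum e \<tau>' w = j * csc_sum e \<tau> (j * w)" if e: "e \<in> {1, -1}" and w: "w \<notin> period_lattice \<tau>'" for e w
  proof -
    have "jacobi_fun \<tau> ((-1) powi a * e powi (- c)) ((-1) powi (- b) * e powi d) (\<lambda>z. csc_sum e \<tau>' (z / j) / j)"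
      using jacobi_fun_moebius(1)[OF tau det, of "-1" e "csc_sum e \<tau>'"] csc_sum_jacobi_fun[OF tau' e]
      by (simp add: j_def \<tau>'_def)
    moreover have "(-1) powi a * e powi (- c) = -1" "(-1) powi (- b) * e powi d = e"
      using e by (auto simp: dv minus_one_powi)
    ultimately have "jacobi_fun \<tau> (-1) e (\<lambda>z. csc_sum e \<tau>' (z / j) / j)" by simp
    from jacobi_fun_unique[OF this csc_sum_jacobi_fun[OF tau e], of "j * w"] inL[of "j * w"] w j
    show ?thesis by (simp add: field_simps)
  qed
  have h1: "j * (1/2) = 1/2 + (of_int (2 * d1) + of_int (2 * c1) * \<tau>)" unfolding j_def dv by (simp add: field_simps)
  have h2: "j * (1/2 + \<tau>'/2) = 1/2 + \<tau>/2 + (of_int (2 * (d1 + b1)) + of_int (2 * (c1 + a1)) * \<tau>)"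
  proof -
    have "j * (1/2 + \<tau>'/2) = j * (1/2) + j * \<tau>' / 2" by (simp add: distrib_left)
    also have "\<dots> = 1/2 + \<tau>/2 + (of_int (2 * (d1 + b1)) + of_int (2 * (c1 + a1)) * \<tau>)"
      unfolding h1 jt dv by (simp add: algebra_simps add_divide_distrib)
    finally show ?thesis .
  qed
  have uhp: "\<tau> \<in> uhp" "\<tau>' \<in> uhp" using tau tau' by (simp_all add: uhp_def)
  show "thA \<tau>' = j * thA \<tau>"
    using main[of 1 "1/2"] nL'(1) csc_sum_shift[OF tau _ nL(1), of 1 "2 * d1" "2 * c1"] uhp
    unfolding h1 by (simp add: thA_def minus_one_powi)
  show "thC \<tau>' = j * thC \<tau>"
    using main[of "-1" "1/2"] nL'(1) csc_sum_shift[OF tau _ nL(1), of "-1" "2 * d1" "2 * c1"] uhp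
    unfolding h1 by (simp add: thC_def minus_one_powi)
  show "thB \<tau>' = j * thB \<tau>"
    using main[of 1 "1/2 + \<tau>'/2"] nL'(3) csc_sum_shift[OF tau _ nL(3), of 1 "2 * (d1 + b1)" "2 * (c1 + a1)"] uhp
    unfolding h2 by (simp add: thB_def minus_one_powi)
qed

section \<open>Bounds at all cusps\<close>

lemma csc_sum_half_period_sq:
  assumes tau: "Im \<tau> > 0" and odd: "odd m \<or> odd n"
  shows "norm ((csc_sum 1 \<tau> ((of_int m + of_int n * \<tau>) / 2))\<^sup>2) \<le> (norm (thA \<tau>))\<^sup>2 + (norm (thB \<tau>))\<^sup>2"
proof -
  note nL = half_periods_notin_lattice[OF tau]
  have uhp: "\<tau> \<in> uhp" using tau by (simp add: uhp_def)
  have sh: "(csc_sum 1 \<tau> (z + (of_int k + of_int l * \<tau>)))\<^sup>2 = (csc_sum 1 \<tau> z)\<^sup>2"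
    if "z \<notin> period_lattice \<tau>" for z k l
    using csc_sum_shift[OF tau _ that, of 1 k l] by (simp add: power_mult_distrib minus_one_powi)
  consider k l where "m = 2 * k + 1" "n = 2 * l" | k l where "m = 2 * k" "n = 2 * l + 1"
    | k l where "m = 2 * k + 1" "n = 2 * l + 1"
    using odd by (metis evenE oddE)
  thus ?thesis
  proof cases
    case 1
    hence eq: "(of_int m + of_int n * \<tau>) / 2 = 1/2 + (of_int k + of_int l * \<tau>)" by (simp add: field_simps)
    show ?thesis unfolding eq using sh[OF nL(1)] uhp by (simp add: thA_def norm_power)
  next
    case 2
    hence eq: "(of_int m + of_int n * \<tau>) / 2 = \<tau>/2 + (of_int k + of_int l * \<tau>)" by (simp add: field_simps)
    show ?thesis unfolding eq using sh[OF nL(2)] csc_sum_relations(7)[OF tau nL(1)] by simp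
  next
    case 3
    hence eq: "(of_int m + of_int n * \<tau>) / 2 = 1/2 + \<tau>/2 + (of_int k + of_int l * \<tau>)" by (simp add: field_simps)
    show ?thesis unfolding eq using sh[OF nL(3)] uhp by (simp add: thB_def norm_power)
  qed
qed

text \<open>This avoids a table of how SL(2,Z) permutes the theta constants. Whatever its character,
  the transported function \<open>F\<close> has a square differing from that of
  \<open>csc_sum 1 \<tau>\<close> by a constant, found where \<open>F\<close> vanishes, at j
  \<tau>'/2. So the squared values at \<tau>' are differences of squared half period values at
  \<tau>, each at most K/2 in modulus.\<close>

lemma theta_moebius_bound:
  fixes a b c d :: int
  assumes tau: "Im \<tau> > 0" and det: "a * d - b * c = 1"
  defines "j \<equiv> of_int c * \<tau> + of_int d"
  defines "\<tau>' \<equiv> (of_int a * \<tau> + of_int b) / j"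
  defines "K \<equiv> 2 * ((norm (thA \<tau>))\<^sup>2 + (norm (thB \<tau>))\<^sup>2)"
  shows "(norm (thA \<tau>' / j))\<^sup>2 \<le> K" "(norm (thB \<tau>' / j))\<^sup>2 \<le> K" "(norm (thC \<tau>' / j))\<^sup>2 \<le> 2 * K"
proof -
  have tau': "Im \<tau>' > 0" and j: "j \<noteq> 0" using moebius_upper_half_plane[OF tau det] by (simp_all add: j_def \<tau>'_def)
  have jt: "j * \<tau>' = of_int a * \<tau> + of_int b" using j by (simp add: \<tau>'_def)
  note nL' = half_periods_notin_lattice[OF tau']
  have inL: "z / j \<in> period_lattice \<tau>' \<longleftrightarrow> z \<in> period_lattice \<tau>" for z
    using jacobi_fun_moebius(2)[OF tau det, of "-1" 1 "csc_sum 1 \<tau>'"] csc_sum_jacobi_fun[OF tau', of 1]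
    by (simp add: j_def \<tau>'_def)
  define F where "F = (\<lambda>z. csc_sum 1 \<tau>' (z / j) / j)"
  have "jacobi_fun \<tau> ((-1) powi a * 1 powi (- c)) ((-1) powi (- b) * 1 powi d) F"
    using jacobi_fun_moebius(1)[OF tau det, of "-1" 1 "csc_sum 1 \<tau>'"] csc_sum_jacobi_fun[OF tau', of 1]
    by (simp add: j_def \<tau>'_def F_def)
  from jacobi_fun_sq_diff[OF this csc_sum_jacobi_fun[OF tau, of 1]]
  obtain q where q: "\<And>z. z \<notin> period_lattice \<tau> \<Longrightarrow> (F z)\<^sup>2 - (csc_sum 1 \<tau> z)\<^sup>2 = q" by auto
  define R where "R = (\<lambda>m n. csc_sum 1 \<tau> ((of_int m + of_int n * \<tau>) / 2))"
  have u: "j * (1/2) = (of_int d + of_int c * \<tau>) / 2" "j * (\<tau>'/2) = (of_int b + of_int a * \<tau>) / 2"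
    "j * (1/2 + \<tau>'/2) = (of_int (b + d) + of_int (a + c) * \<tau>) / 2"
    using jt by (simp_all add: j_def field_simps)
  have Fv: "F (j * w) = csc_sum 1 \<tau>' w / j" for w using j by (simp add: F_def)
  have nin: "j * w \<notin> period_lattice \<tau>" if "w \<notin> period_lattice \<tau>'" for w
    using inL[of "j * w"] that j by simp
  have "F (j * (\<tau>'/2)) = 0" unfolding Fv using csc_sum_relations(7)[OF tau' nL'(1)] by simp
  moreover have "(F (j * (\<tau>'/2)))\<^sup>2 - (csc_sum 1 \<tau> (j * (\<tau>'/2)))\<^sup>2 = q" by (rule q[OF nin[OF nL'(2)]])
  ultimately have qv: "q = - (R b a)\<^sup>2" unfolding u(2) R_def by simp
  have uhp: "\<tau> \<in> uhp" "\<tau>' \<in> uhp" using tau tau' by (simp_all add: uhp_def)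
  have A: "(thA \<tau>' / j)\<^sup>2 = (R d c)\<^sup>2 - (R b a)\<^sup>2"
    using q[OF nin[OF nL'(1)]] unfolding Fv qv using uhp unfolding u by (simp add: R_def thA_def algebra_simps)
  have B: "(thB \<tau>' / j)\<^sup>2 = (R (b + d) (a + c))\<^sup>2 - (R b a)\<^sup>2"
    using q[OF nin[OF nL'(3)]] unfolding Fv qv using uhp unfolding u by (simp add: R_def thB_def algebra_simps)
  have "odd (a * d - b * c)" using det by simp
  hence odd: "odd d \<or> odd c" "odd b \<or> odd a" "odd (b + d) \<or> odd (a + c)" by auto
  have le: "norm ((R m n)\<^sup>2) \<le> K / 2" if "odd m \<or> odd n" for m n
    unfolding R_def K_def using csc_sum_half_period_sq[OF tau that] by simp
  show A': "(norm (thA \<tau>' / j))\<^sup>2 \<le> K"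
    using norm_triangle_ineq4[of "(R d c)\<^sup>2" "(R b a)\<^sup>2"] le[OF odd(1)] le[OF odd(2)]
    unfolding norm_power[symmetric] A by linarith
  show B': "(norm (thB \<tau>' / j))\<^sup>2 \<le> K"
    using norm_triangle_ineq4[of "(R (b + d) (a + c))\<^sup>2" "(R b a)\<^sup>2"] le[OF odd(3)] le[OF odd(2)]
    unfolding norm_power[symmetric] B by linarith
  have "(thC \<tau>')\<^sup>2 = (thA \<tau>')\<^sup>2 - (thB \<tau>')\<^sup>2" using csc_sum_relations(3)[OF tau' nL'(1)] by simp
  hence C: "(thC \<tau>' / j)\<^sup>2 = (thA \<tau>' / j)\<^sup>2 - (thB \<tau>' / j)\<^sup>2"
    by (simp add: power_divide diff_divide_distrib)
  show "(norm (thC \<tau>' / j))\<^sup>2 \<le> 2 * K"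
    using norm_triangle_ineq4[of "(thA \<tau>' / j)\<^sup>2" "(thB \<tau>' / j)\<^sup>2"] A' B'
    unfolding norm_power[symmetric] C by linarith
qed

section \<open>Weight 1 forms and slash operators\<close>

text \<open>At 1/2 + \<tau>/2 each cosecant becomes \<pi>/cos(\<pi> (2m+1) \<tau>/2), that is 2
  \<pi> t^k/(1 + t^(2k)) with t = exp(\<pi> i \<tau>/2) and k = |2m+1|. Every k is at least 1, so a
  factor t splits off; the nonzero value of the quotient at 0 is what makes the zero at the cusp
  simple.\<close>

lemma thB_expansion:
  obtains h where "h holomorphic_on ball 0 1" "h 0 \<noteq> 0"
    "\<And>\<tau>. \<tau> \<in> uhp \<Longrightarrow> thB \<tau> = exp (of_real pi * \<i> * \<tau> / 2) * h (exp (of_real pi * \<i> * \<tau> / 2))"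
proof -
  define k where "k = (\<lambda>m::int. nat \<bar>2 * m + 1\<bar>)"
  have k1: "k m \<ge> 1" for m
  proof -
    have "2 * m + 1 \<noteq> 0" by presburger
    thus ?thesis unfolding k_def by linarith
  qed
  define T where "T = (\<lambda>(m::int) (t::complex). 2 * of_real pi * t ^ (k m - 1) / (1 + t ^ (2 * k m)))"
  define h where "h = (\<lambda>t. \<Sum>\<^sub>\<infinity>m. T m t)"
  have hol: "h holomorphic_on ball 0 1"
  proof -
    have "h field_differentiable at t" if t: "t \<in> ball 0 1" for t
    proof -
      obtain \<rho> where \<rho>: "norm t < \<rho>" "\<rho> < 1" using t dense[of "norm t" 1] by auto
      have \<rho>0: "\<rho> > 0" using \<rho> norm_ge_zero[of t] by linarith
      \<comment> \<open>|2m+1| \<ge> |m| bounds the power of t; truncated subtraction gives exponent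
        0 at n = 0, which is the right bound for m = 0.\<close>
      define G where "G = (\<lambda>n::nat. 2 * pi / (1 - \<rho>) * \<rho> ^ (n - 1))"
      have "summable (\<lambda>n. \<rho> ^ (n - 1))"
        using \<rho> \<rho>0 by (subst summable_Suc_iff[symmetric]) (simp add: summable_geometric)
      hence "summable G" unfolding G_def by (rule summable_mult)
      hence Gs: "(\<lambda>m. G (nat \<bar>m\<bar>)) summable_on UNIV"
        by (rule summable_on_int_nat_abs) (use \<rho> \<rho>0 in \<open>simp add: G_def\<close>)
      have den: "norm (1 + s ^ (2 * k m)) \<ge> 1 - \<rho>" if "s \<in> ball 0 \<rho>" for s :: complex and m
      proof -
        have "norm (s ^ (2 * k m)) \<le> \<rho> ^ (2 * k m)" using that by (auto simp: norm_power intro!: power_mono)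
        also have "\<dots> \<le> \<rho> ^ 1" using \<rho> \<rho>0 k1[of m] by (intro power_decreasing) auto
        finally show ?thesis using norm_triangle_ineq2[of 1 "- (s ^ (2 * k m))"] by simp
      qed
      have "h holomorphic_on ball 0 \<rho>" unfolding h_def
      proof (rule holomorphic_on_infsum[OF open_ball _ _ Gs])
        fix m :: int
        show "T m holomorphic_on ball 0 \<rho>" unfolding T_def
          using den[of _ m] \<rho>(2) by (intro holomorphic_intros) fastforce
      next
        fix m :: int and s :: complex assume s: "s \<in> ball 0 \<rho>"
        have "norm (s ^ (k m - 1)) \<le> \<rho> ^ (k m - 1)" using s by (auto simp: norm_power intro!: power_mono)
        also have "\<dots> \<le> \<rho> ^ (nat \<bar>m\<bar> - 1)"
          using \<rho> \<rho>0 by (intro power_decreasing) (auto simp: k_def)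
        finally have "norm (s ^ (k m - 1)) \<le> \<rho> ^ (nat \<bar>m\<bar> - 1)" .
        hence "2 * pi * norm (s ^ (k m - 1)) / norm (1 + s ^ (2 * k m)) \<le> 2 * pi * \<rho> ^ (nat \<bar>m\<bar> - 1) / (1 - \<rho>)"
          using den[OF s] \<rho> \<rho>0 by (intro frac_le mult_left_mono) auto
        thus "norm (T m s) \<le> G (nat \<bar>m\<bar>)" by (simp add: T_def G_def norm_mult norm_divide)
      qed
      thus ?thesis using \<rho> by (intro holomorphic_on_imp_differentiable_at[OF _ open_ball]) auto
    qed
    thus ?thesis by (simp add: holomorphic_on_def field_differentiable_at_within)
  qed
  have h0: "h 0 \<noteq> 0"
  proof -
    have "T m 0 = (if m \<in> {0, -1} then 2 * of_real pi else 0)" for m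
    proof -
      \<comment> \<open>Only m = 0 and m = -1 survive at t = 0, so h(0) = 4 \<pi>.\<close>
      have "k m - 1 = 0 \<longleftrightarrow> m \<in> {0, -1}" unfolding k_def by auto
      thus ?thesis using k1[of m] by (auto simp: T_def power_0_left)
    qed
    hence "h 0 = (\<Sum>\<^sub>\<infinity>m\<in>{0, -1}. T m 0)" unfolding h_def
      by (intro infsum_cong_neutral) auto
    thus ?thesis by (simp add: T_def k_def)
  qed
  show ?thesis
  proof (rule that[OF hol h0])
    fix \<tau> assume tau: "\<tau> \<in> uhp"
    define t where "t = exp (of_real pi * \<i> * \<tau> / 2)"
    have t0: "t \<noteq> 0" by (simp add: t_def)
    have "csc_term 1 \<tau> m (1/2 + \<tau>/2) = t * T m t" for m
    proof -
      define n where "n = 2 * m + 1"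
      have arg: "\<i> * (of_real pi * (of_int n * \<tau> / 2)) = of_int n * (of_real pi * \<i> * \<tau> / 2)" by simp
      have e: "exp (of_int n * (of_real pi * \<i> * \<tau> / 2)) = t powi n" unfolding t_def
        by (simp add: exp_power_int)
      have "sin (of_real pi * (1/2 + \<tau>/2 + of_int m * \<tau>)) = sin (of_real pi * (of_int n * \<tau> / 2) + of_real pi / 2)"
        by (simp add: n_def algebra_simps add_divide_distrib)
      also have "\<dots> = cos (of_real pi * (of_int n * \<tau> / 2))" by (simp add: sin_add)
      also have "\<dots> = (t powi n + t powi (- n)) / 2"
        unfolding cos_exp_eq arg exp_minus e by (simp add: power_int_minus)
      also have "t powi n + t powi (- n) = t ^ k m + inverse (t ^ k m)"
      proof (cases n rule: int_cases2)
        case (nonneg l)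
        hence "k m = l" by (simp add: k_def n_def)
        thus ?thesis using nonneg by (simp add: power_int_minus)
      next
        case (nonpos l)
        hence "k m = l" by (simp add: k_def n_def)
        thus ?thesis using nonpos by (simp add: power_int_minus)
      qed
      also have "\<dots> = (1 + t ^ (2 * k m)) / t ^ k m"
        using t0 unfolding mult_2 power_add by (simp add: divide_simps)
      finally have "csc_term 1 \<tau> m (1/2 + \<tau>/2) = 2 * of_real pi * t ^ k m / (1 + t ^ (2 * k m))"
        by (simp add: csc_term_def)
      moreover have "t ^ k m = t * t ^ (k m - 1)" using k1[of m] by (simp add: power_eq_if)
      ultimately show ?thesis by (simp add: T_def)
    qed
    thus "thB \<tau> = t * h t"
      using tau by (simp add: thB_def csc_sum_def h_def infsum_cmult_right')
  qed
qed

section \<open>Integral matrices, automorphy factors and the slash action\<close>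

abbreviation mat2 :: "int \<Rightarrow> int \<Rightarrow> int \<Rightarrow> int \<Rightarrow> imat" where
  "mat2 a b c d \<equiv> vector [vector [a, b], vector [c, d]]"

definition autom :: "imat \<Rightarrow> complex \<Rightarrow> complex" where
  "autom A z = of_int (A $ 2 $ 1) * z + of_int (A $ 2 $ 2)"

lemma slash_autom: "slash f A z = f (mat_moebius A z) / autom A z"
  by (simp add: slash_def autom_def)

lemma mat_moebius_autom: "mat_moebius A z = (of_int (A $ 1 $ 1) * z + of_int (A $ 1 $ 2)) / autom A z"
  by (simp add: mat_moebius_def moebius_def autom_def)

lemma imat_eq_iff: "(A :: imat) = B \<longleftrightarrow> A $ 1 $ 1 = B $ 1 $ 1 \<and> A $ 1 $ 2 = B $ 1 $ 2 \<and> A $ 2 $ 1 = B $ 2 $ 1 \<and> A $ 2 $ 2 = B $ 2 $ 2"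
  unfolding vec_eq_iff forall_2 by blast

lemma imat_mult_nth [simp]:
  "((A :: imat) ** B) $ i $ j = A $ i $ 1 * B $ 1 $ j + A $ i $ 2 * B $ 2 $ j"
  by (simp add: matrix_matrix_mult_def sum_2)

lemma mat_1_nth [simp]: "(mat 1 :: imat) $ 1 $ 1 = 1" "(mat 1 :: imat) $ 1 $ 2 = 0"
    "(mat 1 :: imat) $ 2 $ 1 = 0" "(mat 1 :: imat) $ 2 $ 2 = 1"
  by (simp_all add: mat_def)

lemma SL2Z_iff: "A \<in> SL2Z \<longleftrightarrow> A $ 1 $ 1 * A $ 2 $ 2 - A $ 1 $ 2 * A $ 2 $ 1 = 1"
  by (simp add: SL2Z_def det_2)

lemma autom_nonzero:
  assumes "det A \<noteq> 0" "Im z > 0"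
  shows "autom A z \<noteq> 0"
proof
  assume 0: "autom A z = 0"
  hence "of_int (A $ 2 $ 1) * Im z = 0" by (simp add: autom_def complex_eq_iff)
  hence "A $ 2 $ 1 = 0" using assms by simp
  moreover from this have "A $ 2 $ 2 = 0" using 0 by (simp add: autom_def)
  ultimately show False using assms by (simp add: det_2)
qed

lemma Im_mat_moebius:
  assumes "autom A z \<noteq> 0"
  shows "Im (mat_moebius A z) * (cmod (autom A z))\<^sup>2 = of_int (det A) * Im z"
proof -
  have "Im (mat_moebius A z) * (cmod (autom A z))\<^sup>2 = Im (mat_moebius A z * autom A z * cnj (autom A z))"
    unfolding cmod_power2 by (simp add: power2_eq_square algebra_simps)
  also have "mat_moebius A z * autom A z = of_int (A $ 1 $ 1) * z + of_int (A $ 1 $ 2)"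
    using assms by (simp add: mat_moebius_autom)
  finally show ?thesis by (simp add: autom_def det_2 algebra_simps)
qed

text \<open>Stated for all complex z, including the pole, where division by zero yields 0: thus
  slashing preserves the convention that forms vanish off \<open>uhp\<close>.\<close>

lemma mat_moebius_in_uhp_iff:
  assumes "det A > 0"
  shows "mat_moebius A z \<in> uhp \<longleftrightarrow> z \<in> uhp"
proof (cases "autom A z = 0")
  case True
  hence "mat_moebius A z = 0" by (simp add: mat_moebius_autom)
  thus ?thesis using autom_nonzero[of A z] assms True by (auto simp: uhp_def)
next
  case False
  hence "(cmod (autom A z))\<^sup>2 > 0" by simp
  hence "Im (mat_moebius A z) > 0 \<longleftrightarrow> Im (mat_moebius A z) * (cmod (autom A z))\<^sup>2 > 0"
    by (simp add: zero_less_mult_iff)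
  also have "\<dots> \<longleftrightarrow> Im z > 0" unfolding Im_mat_moebius[OF False] using assms by (simp add: zero_less_mult_iff)
  finally show ?thesis by (simp add: uhp_def)
qed

lemma autom_mult:
  assumes "autom B z \<noteq> 0"
  shows "autom (A ** B) z = autom A (mat_moebius B z) * autom B z"
    and "mat_moebius (A ** B) z = mat_moebius A (mat_moebius B z)"
proof -
  have m: "mat_moebius B z * autom B z = of_int (B $ 1 $ 1) * z + of_int (B $ 1 $ 2)"
    using assms by (simp add: mat_moebius_autom)
  show 1: "autom (A ** B) z = autom A (mat_moebius B z) * autom B z"
  proof -
    have "autom A (mat_moebius B z) * autom B z = of_int (A $ 2 $ 1) * (mat_moebius B z * autom B z) + of_int (A $ 2 $ 2) * autom B z"
      by (simp add: autom_def[of A] algebra_simps)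
    thus ?thesis unfolding m by (simp add: autom_def algebra_simps)
  qed
  have "(of_int (A $ 1 $ 1) * mat_moebius B z + of_int (A $ 1 $ 2)) * autom B z
      = of_int (A $ 1 $ 1) * (mat_moebius B z * autom B z) + of_int (A $ 1 $ 2) * autom B z"
    by (simp add: algebra_simps)
  hence 2: "of_int ((A ** B) $ 1 $ 1) * z + of_int ((A ** B) $ 1 $ 2)
      = (of_int (A $ 1 $ 1) * mat_moebius B z + of_int (A $ 1 $ 2)) * autom B z"
    unfolding m by (simp add: autom_def algebra_simps)
  show "mat_moebius (A ** B) z = mat_moebius A (mat_moebius B z)"
    unfolding mat_moebius_autom[of "A ** B"] mat_moebius_autom[of A] 1 2 using assms by simp
qed

lemma slash_slash:
  assumes "det B \<noteq> 0" "z \<in> uhp"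
  shows "slash (slash f A) B z = slash f (A ** B) z"
  using autom_mult[of B z A] autom_nonzero[of B z] assms by (simp add: slash_autom uhp_def)

lemma slash_outside:
  assumes "\<And>z. z \<notin> uhp \<Longrightarrow> f z = 0" "det A > 0" "z \<notin> uhp"
  shows "slash f A z = 0"
  using assms mat_moebius_in_uhp_iff[of A z] by (simp add: slash_def)

lemma slash_mat_1 [simp]: "slash f (mat 1) = f"
  by (simp add: slash_def mat_moebius_def moebius_def fun_eq_iff)

lemma slash_holomorphic:
  assumes f: "f holomorphic_on uhp" and A: "det A > 0"
  shows "slash f A holomorphic_on uhp"
proof -
  have nz: "autom A z \<noteq> 0" if "z \<in> uhp" for z using autom_nonzero[of A z] A that by (simp add: uhp_def)
  have "autom A holomorphic_on uhp" unfolding autom_def by (intro holomorphic_intros)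
  moreover from this have "mat_moebius A holomorphic_on uhp"
    unfolding mat_moebius_autom by (intro holomorphic_intros) (use nz in auto)
  ultimately show ?thesis unfolding slash_autom
    by (intro holomorphic_intros holomorphic_on_compose_gen[OF _ f, unfolded o_def])
       (use nz A in \<open>auto simp: mat_moebius_in_uhp_iff\<close>)
qed

section \<open>Congruence groups and modularity of the slashed forms\<close>

lemma principal_congruence_iff:
  "A \<in> principal_congruence N \<longleftrightarrow> A \<in> SL2Z \<and> int N dvd A $ 1 $ 1 - 1 \<and> int N dvd A $ 1 $ 2 \<and>
     int N dvd A $ 2 $ 1 \<and> int N dvd A $ 2 $ 2 - 1"
  by (auto simp: principal_congruence_def mat_cong_def forall_2 cong_iff_dvd_diff)

lemma Gamma_pm_iff:
  "A \<in> Gamma_pm p \<longleftrightarrow> A \<in> principal_congruence 4 \<and>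
     (\<exists>e\<in>{1, -1}. int p dvd A $ 1 $ 1 - e \<and> int p dvd A $ 1 $ 2 \<and> int p dvd A $ 2 $ 1 \<and> int p dvd A $ 2 $ 2 - e)"
  by (auto simp: Gamma_pm_def mat_cong_def forall_2 cong_iff_dvd_diff)

text \<open>
  With \<open>\<beta> = e I + n X\<close>, \<open>n = det \<alpha>\<close>, the conjugate \<open>\<alpha> \<beta> \<alpha>\<^sup>-\<^sup>1\<close> is the integral matrix \<open>e I + \<alpha> X adj \<alpha>\<close>.
\<close>

lemma conjugate_in_Gamma4:
  assumes p: "odd p" and \<beta>: "\<beta> \<in> Gamma_pm p" and \<alpha>: "det \<alpha> = 1 \<or> det \<alpha> = int p"
  obtains \<beta>' where "\<beta>' \<in> principal_congruence 4" "\<beta>' ** \<alpha> = \<alpha> ** \<beta>"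
proof -
  define n where "n = det \<alpha>"
  define a b c d where "a = \<alpha> $ 1 $ 1" and "b = \<alpha> $ 1 $ 2" and "c = \<alpha> $ 2 $ 1" and "d = \<alpha> $ 2 $ 2"
  have n: "n = a * d - b * c" by (simp add: n_def a_def b_def c_def d_def det_2)
  have n_odd: "odd n" using \<alpha> p by (auto simp: n_def)
  \<comment> \<open>For n = 1 one may take e = 0 and X = \<beta>; for n = p, e is the sign to which
    \<beta> is congruent modulo p.\<close>
  obtain e x y z w where X: "\<beta> $ 1 $ 1 = e + n * x" "\<beta> $ 1 $ 2 = n * y" "\<beta> $ 2 $ 1 = n * z" "\<beta> $ 2 $ 2 = e + n * w"
  proof (cases "n = 1")
    case True
    thus ?thesis using that[of 0 "\<beta> $ 1 $ 1" "\<beta> $ 1 $ 2" "\<beta> $ 2 $ 1" "\<beta> $ 2 $ 2"] by simp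
  next
    case False
    hence "n = int p" using \<alpha> by (simp add: n_def)
    with \<beta> obtain e where "n dvd \<beta> $ 1 $ 1 - e" "n dvd \<beta> $ 1 $ 2" "n dvd \<beta> $ 2 $ 1" "n dvd \<beta> $ 2 $ 2 - e"
      unfolding Gamma_pm_iff by blast
    then obtain x y z w where "\<beta> $ 1 $ 1 - e = n * x" "\<beta> $ 1 $ 2 = n * y" "\<beta> $ 2 $ 1 = n * z" "\<beta> $ 2 $ 2 - e = n * w"
      by (elim dvdE)
    thus ?thesis using that[of e x y z w] by (simp add: algebra_simps)
  qed
  define \<beta>' where "\<beta>' = mat2 (e + ((a*x + b*z) * d - (a*y + b*w) * c)) ((a*y + b*w) * a - (a*x + b*z) * b)
     ((c*x + d*z) * d - (c*y + d*w) * c) (e + ((c*y + d*w) * a - (c*x + d*z) * b))"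
  have eq: "\<beta>' ** \<alpha> = \<alpha> ** \<beta>"
    unfolding imat_eq_iff imat_mult_nth X n \<beta>'_def vector_2
    by (simp add: a_def b_def c_def d_def algebra_simps)
  have "det \<beta>' * n = n * det \<beta>" unfolding n_def det_mul[symmetric] eq by (rule refl)
  moreover have "det \<beta> = 1" using \<beta> by (simp add: Gamma_pm_iff principal_congruence_iff SL2Z_def)
  ultimately have det: "det \<beta>' = 1" using n_odd by auto
  obtain x' y' z' w' where Y: "\<beta> $ 1 $ 1 = 1 + 4 * x'" "\<beta> $ 1 $ 2 = 4 * y'" "\<beta> $ 2 $ 1 = 4 * z'" "\<beta> $ 2 $ 2 = 1 + 4 * w'"
  proof -
    have "4 dvd \<beta> $ 1 $ 1 - 1" "4 dvd \<beta> $ 1 $ 2" "4 dvd \<beta> $ 2 $ 1" "4 dvd \<beta> $ 2 $ 2 - 1"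
      using \<beta> by (simp_all add: Gamma_pm_iff principal_congruence_iff)
    then obtain x y z w where "\<beta> $ 1 $ 1 - 1 = 4 * x" "\<beta> $ 1 $ 2 = 4 * y" "\<beta> $ 2 $ 1 = 4 * z" "\<beta> $ 2 $ 2 - 1 = 4 * w"
      by (elim dvdE)
    thus ?thesis using that[of x y z w] by (simp add: algebra_simps)
  qed
  have E: "\<beta>' $ 1 $ 1 * a + \<beta>' $ 1 $ 2 * c = a * (1 + 4 * x') + b * (4 * z')"
    "\<beta>' $ 1 $ 1 * b + \<beta>' $ 1 $ 2 * d = a * (4 * y') + b * (1 + 4 * w')"
    "\<beta>' $ 2 $ 1 * a + \<beta>' $ 2 $ 2 * c = c * (1 + 4 * x') + d * (4 * z')"
    "\<beta>' $ 2 $ 1 * b + \<beta>' $ 2 $ 2 * d = c * (4 * y') + d * (1 + 4 * w')"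
    using eq unfolding imat_eq_iff imat_mult_nth Y a_def b_def c_def d_def by auto
  \<comment> \<open>With \<beta> = I + 4 Y one has n (\<beta>' - I) = 4 \<alpha> Y adj \<alpha>; the
    odd n is cancelled modulo 4.\<close>
  have co: "4 dvd u" if "n * u = 4 * v" for u v
  proof -
    have "coprime 4 n" using n_odd coprime_power_left_iff[of 2 2 n] by (simp add: coprime_commute)
    moreover have "4 dvd n * u" using that by simp
    ultimately show ?thesis by (simp add: coprime_dvd_mult_right_iff)
  qed
  have "n * (\<beta>' $ 1 $ 1 - 1) = 4 * (d * (a * x' + b * z') - c * (a * y' + b * w'))"
    "n * \<beta>' $ 1 $ 2 = 4 * (a * (a * y' + b * w') - b * (a * x' + b * z'))"
    "n * \<beta>' $ 2 $ 1 = 4 * (d * (c * x' + d * z') - c * (c * y' + d * w'))"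
    "n * (\<beta>' $ 2 $ 2 - 1) = 4 * (a * (c * y' + d * w') - b * (c * x' + d * z'))"
    using E unfolding n by algebra+
  from this[THEN co] det have "\<beta>' \<in> principal_congruence 4"
    by (simp add: principal_congruence_iff SL2Z_def)
  thus ?thesis using that eq by blast
qed

lemma slash_Gamma_pm:
  assumes f: "f \<in> modular_forms1 (principal_congruence 4)" and p: "odd p"
    and \<alpha>: "det \<alpha> = 1 \<or> det \<alpha> = int p" and \<beta>: "\<beta> \<in> Gamma_pm p" and z: "z \<in> uhp"
  shows "slash (slash f \<alpha>) \<beta> z = slash f \<alpha> z"
proof -
  obtain \<beta>' where \<beta>': "\<beta>' \<in> principal_congruence 4" "\<beta>' ** \<alpha> = \<alpha> ** \<beta>"
    by (rule conjugate_in_Gamma4[OF p \<beta> \<alpha>])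
  have pos: "det \<alpha> > 0" using \<alpha> p by (auto intro: Nat.gr0I)
  have "det \<beta> = 1" using \<beta> by (simp add: Gamma_pm_iff principal_congruence_iff SL2Z_def)
  hence "slash (slash f \<alpha>) \<beta> z = slash f (\<alpha> ** \<beta>) z" using z by (intro slash_slash) auto
  also have "\<dots> = slash (slash f \<beta>') \<alpha> z"
    unfolding \<beta>'(2)[symmetric] using z pos by (intro slash_slash[symmetric]) auto
  also have "\<dots> = slash f \<alpha> z"
    using f \<beta>'(1) mat_moebius_in_uhp_iff[OF pos, of z] z
    by (simp add: slash_autom[of _ \<alpha>] modular_forms1_def)
  finally show ?thesis .
qed

text \<open>Hermite normal form: the first column of \<sigma> is that of \<open>M\<close> divided by
  its gcd, completed by Bezout coefficients.\<close>

lemma SL2Z_decomposition: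
  fixes M :: imat
  assumes "det M > 0"
  obtains \<sigma> a b d where "\<sigma> \<in> SL2Z" "M = \<sigma> ** mat2 a b 0 d" "a > 0" "d > 0"
proof -
  define x y where "x = M $ 1 $ 1" and "y = M $ 2 $ 1"
  define g where "g = gcd x y"
  have g: "g > 0"
  proof -
    have "x \<noteq> 0 \<or> y \<noteq> 0" using assms by (auto simp: x_def y_def det_2)
    thus ?thesis by (simp add: g_def)
  qed
  obtain x' y' where xy: "x = g * x'" "y = g * y'" unfolding g_def by (meson dvdE gcd_dvd1 gcd_dvd2)
  obtain u v where "u * x + v * y = g" using bezout_int[of x y] by (auto simp: g_def)
  hence "g * (u * x' + v * y') = g * 1" by (simp add: xy algebra_simps)
  hence uv: "u * x' + v * y' = 1" using g by (simp only: mult_cancel_left) auto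
  define \<sigma> where "\<sigma> = mat2 x' (- v) y' u"
  define r s where "r = M $ 1 $ 2" and "s = M $ 2 $ 2"
  define d where "d = x' * s - y' * r"
  have "\<sigma> \<in> SL2Z" using uv by (simp add: SL2Z_iff \<sigma>_def algebra_simps)
  moreover have "M = \<sigma> ** mat2 g (u * r + v * s) 0 d"
  proof -
    have "r = x' * (u * r + v * s) + - v * d" "s = y' * (u * r + v * s) + u * d"
      using uv unfolding d_def by algebra+
    thus ?thesis unfolding imat_eq_iff imat_mult_nth
      by (simp add: \<sigma>_def x_def[symmetric] y_def[symmetric] r_def[symmetric] s_def[symmetric] xy)
  qed
  moreover have "d > 0"
  proof -
    have "det M = g * d" unfolding det_2 d_def
      by (simp add: x_def[symmetric] y_def[symmetric] r_def[symmetric] s_def[symmetric] xy algebra_simps)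
    thus ?thesis using assms g by (simp add: zero_less_mult_iff)
  qed
  ultimately show ?thesis using that g by blast
qed

text \<open>The triangular factor fixes the cusp at infinity and scales imaginary parts by a/d, so
  only the height and the bound change.\<close>

lemma slash_bounded:
  assumes f: "\<forall>A\<in>SL2Z. \<exists>B C. \<forall>z. Im z > 0 \<and> Im z \<ge> B \<longrightarrow> norm (slash f A z) \<le> C" and M: "det M > 0"
  shows "\<exists>B C. \<forall>z. Im z > 0 \<and> Im z \<ge> B \<longrightarrow> norm (slash f M z) \<le> C"
proof -
  obtain \<sigma> a b d where \<sigma>: "\<sigma> \<in> SL2Z" "M = \<sigma> ** mat2 a b 0 d" "a > 0" "d > 0"
    by (rule SL2Z_decomposition[OF M])
  obtain B C where BC: "\<And>z. Im z > 0 \<Longrightarrow> Im z \<ge> B \<Longrightarrow> norm (slash f \<sigma> z) \<le> C" using f \<sigma>(1) by blast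
  have "norm (slash f M z) \<le> C / of_int d" if z: "Im z > 0" "Im z \<ge> B * of_int d / of_int a" for z
  proof -
    have det: "det (mat2 a b 0 d) = a * d" by (simp add: det_2)
    have "slash f M z = slash (slash f \<sigma>) (mat2 a b 0 d) z"
      unfolding \<sigma>(2) by (rule slash_slash[symmetric]) (use det \<sigma> z in \<open>auto simp: uhp_def\<close>)
    also have "\<dots> = slash f \<sigma> ((of_int a * z + of_int b) / of_int d) / of_int d"
      by (simp add: slash_autom[of _ "mat2 a b 0 d"] mat_moebius_autom autom_def)
    finally have eq: "slash f M z = slash f \<sigma> ((of_int a * z + of_int b) / of_int d) / of_int d" .
    have im: "Im ((of_int a * z + of_int b) / of_int d) = of_int a * Im z / of_int d"
      using Im_divide_of_real[of "of_int a * z + of_int b" "of_int d"] by simp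
    have "norm (slash f \<sigma> ((of_int a * z + of_int b) / of_int d)) \<le> C"
      by (rule BC; unfold im; use \<sigma> z in \<open>simp add: field_simps\<close>)
    thus ?thesis using \<sigma>(4) by (simp add: eq norm_divide divide_right_mono)
  qed
  thus ?thesis by blast
qed

lemma slash_in_modular_forms1:
  assumes f: "f \<in> modular_forms1 (principal_congruence 4)" and p: "odd p"
    and \<alpha>: "det \<alpha> = 1 \<or> det \<alpha> = int p"
  shows "slash f \<alpha> \<in> modular_forms1 (Gamma_pm p)"
proof -
  have pos: "det \<alpha> > 0" using \<alpha> p by (auto intro: Nat.gr0I)
  have "\<exists>B C. \<forall>z. Im z > 0 \<and> Im z \<ge> B \<longrightarrow> norm (slash (slash f \<alpha>) \<sigma> z) \<le> C" if \<sigma>: "\<sigma> \<in> SL2Z" for \<sigma>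
  proof -
    have "det (\<alpha> ** \<sigma>) > 0" using pos \<sigma> by (simp add: det_mul SL2Z_def)
    then obtain B C where "\<forall>z. Im z > 0 \<and> Im z \<ge> B \<longrightarrow> norm (slash f (\<alpha> ** \<sigma>) z) \<le> C"
      using slash_bounded[of f "\<alpha> ** \<sigma>"] f by (auto simp: modular_forms1_def)
    moreover have "slash (slash f \<alpha>) \<sigma> z = slash f (\<alpha> ** \<sigma>) z" if "Im z > 0" for z
      using \<sigma> that by (intro slash_slash) (auto simp: SL2Z_def uhp_def)
    ultimately show ?thesis by metis
  qed
  moreover have "\<forall>z. z \<notin> uhp \<longrightarrow> slash f \<alpha> z = 0"
    using slash_outside[of f \<alpha>] f pos by (simp add: modular_forms1_def)
  moreover have "slash f \<alpha> holomorphic_on uhp"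
    using slash_holomorphic[of f \<alpha>] f pos by (simp add: modular_forms1_def)
  ultimately show ?thesis using slash_Gamma_pm[OF f p \<alpha>] by (auto simp: modular_forms1_def)
qed

lemma modular_forms1_lincomb:
  assumes "f \<in> modular_forms1 G" "g \<in> modular_forms1 G"
  shows "(\<lambda>z. f z - c * g z) \<in> modular_forms1 G"
proof -
  have sl: "slash (\<lambda>z. f z - c * g z) A z = slash f A z - c * slash g A z" for A z
    by (simp add: slash_def diff_divide_distrib)
  have "\<exists>B C. \<forall>z. Im z > 0 \<and> Im z \<ge> B \<longrightarrow> norm (slash (\<lambda>z. f z - c * g z) A z) \<le> C" if A: "A \<in> SL2Z" for A
  proof -
    obtain B1 C1 where 1: "\<And>z. Im z > 0 \<Longrightarrow> Im z \<ge> B1 \<Longrightarrow> norm (slash f A z) \<le> C1"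
      using assms(1) A unfolding modular_forms1_def by blast
    obtain B2 C2 where 2: "\<And>z. Im z > 0 \<Longrightarrow> Im z \<ge> B2 \<Longrightarrow> norm (slash g A z) \<le> C2"
      using assms(2) A unfolding modular_forms1_def by blast
    have "norm (slash f A z - c * slash g A z) \<le> C1 + norm c * C2" if "Im z > 0" "Im z \<ge> max B1 B2" for z
    proof -
      have "norm (slash f A z - c * slash g A z) \<le> norm (slash f A z) + norm (c * slash g A z)"
        by (rule norm_triangle_ineq4)
      also have "\<dots> \<le> C1 + norm c * C2"
        unfolding norm_mult using 1[of z] 2[of z] that by (intro add_mono mult_left_mono) auto
      finally show ?thesis .
    qed
    thus ?thesis unfolding sl by blast
  qed
  moreover have "(\<lambda>z. f z - c * g z) holomorphic_on uhp"
    using assms by (intro holomorphic_intros) (auto simp: modular_forms1_def)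
  ultimately show ?thesis using assms by (simp add: modular_forms1_def sl)
qed

lemma modular_forms1_mono: "H \<subseteq> G \<Longrightarrow> modular_forms1 G \<subseteq> modular_forms1 H"
  by (auto simp: modular_forms1_def)

lemma theta_in_modular_forms1:
  "thA \<in> modular_forms1 (principal_congruence 4)"
  "thB \<in> modular_forms1 (principal_congruence 4)"
  "thC \<in> modular_forms1 (principal_congruence 4)"
proof -
  have A: "thA holomorphic_on uhp"
    by (rule holomorphic_transform[OF csc_sum_half_holomorphic(1)[of 1 0]]) (auto simp: thA_def)
  have B: "thB holomorphic_on uhp"
    by (rule holomorphic_transform[OF csc_sum_half_holomorphic(1)[of 1 "1/2"]]) (auto simp: thB_def)
  have C: "thC holomorphic_on uhp"
    by (rule holomorphic_transform[OF csc_sum_half_holomorphic(1)[of "-1" 0]]) (auto simp: thC_def)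
  note hol = A B C
  obtain K1 where K1: "\<And>\<tau>. Im \<tau> \<ge> 1 \<Longrightarrow> norm (thA \<tau>) \<le> K1"
    using csc_sum_half_holomorphic(2)[of 1 0] by (auto simp: thA_def uhp_def)
  obtain K2 where K2: "\<And>\<tau>. Im \<tau> \<ge> 1 \<Longrightarrow> norm (thB \<tau>) \<le> K2"
    using csc_sum_half_holomorphic(2)[of 1 "1/2"] by (auto simp: thB_def uhp_def)
  have inv: "slash thA A z = thA z \<and> slash thB A z = thB z \<and> slash thC A z = thC z"
    if A: "A \<in> principal_congruence 4" and z: "z \<in> uhp" for A z
  proof -
    have "autom A z \<noteq> 0" using autom_nonzero[of A z] A z by (simp add: principal_congruence_iff SL2Z_def uhp_def)
    thus ?thesis
      using theta_Gamma4[of z "A $ 1 $ 1" "A $ 2 $ 2" "A $ 1 $ 2" "A $ 2 $ 1"] A z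
      by (simp add: principal_congruence_iff SL2Z_iff slash_autom mat_moebius_autom uhp_def autom_def)
  qed
  \<comment> \<open>The largest of the three bounds in \<open>theta_moebius_bound\<close>, so that
    one constant serves all three forms.\<close>
  define K where "K = 2 * (2 * (K1\<^sup>2 + K2\<^sup>2))"
  have bd: "norm (slash thA A z) \<le> sqrt K \<and> norm (slash thB A z) \<le> sqrt K \<and> norm (slash thC A z) \<le> sqrt K"
    if A: "A \<in> SL2Z" and z: "Im z \<ge> 1" for A z
  proof -
    have "(norm (thA z))\<^sup>2 \<le> K1\<^sup>2" "(norm (thB z))\<^sup>2 \<le> K2\<^sup>2"
      using K1[OF z] K2[OF z] by (auto intro: power_mono)
    hence le2: "2 * (2 * ((norm (thA z))\<^sup>2 + (norm (thB z))\<^sup>2)) \<le> K" by (simp add: K_def)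
    have "2 * ((norm (thA z))\<^sup>2 + (norm (thB z))\<^sup>2) \<le> 2 * (2 * ((norm (thA z))\<^sup>2 + (norm (thB z))\<^sup>2))"
      by simp
    note le = order_trans[OF this le2] le2
    have im: "Im z > 0" and det: "A $ 1 $ 1 * A $ 2 $ 2 - A $ 1 $ 2 * A $ 2 $ 1 = 1"
      using A z by (simp_all add: SL2Z_iff)
    note theta_moebius_bound(1)[OF im det, THEN order_trans, OF le(1)]
      theta_moebius_bound(2)[OF im det, THEN order_trans, OF le(1)]
      theta_moebius_bound(3)[OF im det, THEN order_trans, OF le(2)]
    hence "(norm (slash thA A z))\<^sup>2 \<le> K \<and> (norm (slash thB A z))\<^sup>2 \<le> K \<and> (norm (slash thC A z))\<^sup>2 \<le> K"
      unfolding slash_autom mat_moebius_autom autom_def by blast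
    thus ?thesis by (simp add: real_le_rsqrt)
  qed
  have bd': "\<exists>B C. \<forall>z. Im z > 0 \<and> Im z \<ge> B \<longrightarrow> norm (slash f A z) \<le> C"
    if "A \<in> SL2Z" "f \<in> {thA, thB, thC}" for A f
    by (rule exI[of _ 1], rule exI[of _ "sqrt K"]) (use bd that in auto)
  show "thA \<in> modular_forms1 (principal_congruence 4)"
    "thB \<in> modular_forms1 (principal_congruence 4)"
    "thC \<in> modular_forms1 (principal_congruence 4)"
    unfolding modular_forms1_def using hol inv bd'
    by (auto simp: thA_def thB_def thC_def)
qed

section \<open>Separation of points and tangent vectors\<close>

lemma primitive_matI:
  assumes "\<And>g. (\<forall>i j. g dvd A $ i $ j) \<Longrightarrow> g dvd 1"
  shows "primitive_mat A"
proof -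
  have "Gcd {A $ i $ j | i j. True} dvd 1"
    by (rule assms) (auto intro: Gcd_dvd)
  thus ?thesis unfolding primitive_mat_def by (metis Gcd_int_greater_eq_0 zdvd1_eq abs_of_nonneg)
qed

lemma V_spaceI:
  assumes "f \<in> modular_forms1 (principal_congruence 4)" "primitive_mat \<alpha>" "det \<alpha> = 1 \<or> det \<alpha> = int p"
  shows "slash f \<alpha> \<in> V_space p"
  unfolding V_space_def by (rule cfun.span_base) (use assms in blast)

lemma V_space_level4:
  assumes "f \<in> modular_forms1 (principal_congruence 4)"
  shows "f \<in> V_space p"
proof -
  have "primitive_mat (mat 1)" by (rule primitive_matI) (metis mat_1_nth(1))
  from V_spaceI[OF assms this, of p] show ?thesis by simp
qed

lemma V_space_lincomb:
  assumes "f \<in> V_space p" "g \<in> V_space p"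
  shows "(\<lambda>z. f z - c * g z) \<in> V_space p"
proof -
  have "f - scale_fun c g \<in> V_space p"
    using assms unfolding V_space_def by (intro cfun.span_diff cfun.span_scale)
  also have "f - scale_fun c g = (\<lambda>z. f z - c * g z)" by (simp add: fun_eq_iff scale_fun_def)
  finally show ?thesis .
qed

lemma V_space_slash:
  assumes p: "odd p" and \<beta>: "\<beta> \<in> Gamma_pm p" and z: "z \<in> uhp" and f: "f \<in> V_space p"
  shows "f (mat_moebius \<beta> z) = autom \<beta> z * f z"
proof -
  have det: "det \<beta> = 1" using \<beta> by (simp add: Gamma_pm_iff principal_congruence_iff SL2Z_def)
  have nz: "autom \<beta> z \<noteq> 0" using autom_nonzero[of \<beta> z] det z by (simp add: uhp_def)
  have "cfun.subspace {f. slash f \<beta> z = f z}"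
    unfolding cfun.subspace_def
    by (auto simp: slash_def scale_fun_def add_divide_distrib zero_fun_def)
      (metis times_divide_eq_right)
  hence "V_space p \<subseteq> {f. slash f \<beta> z = f z}"
    unfolding V_space_def by (rule cfun.span_minimal[rotated]) (use slash_Gamma_pm[OF _ p _ \<beta> z] in auto)
  hence "slash f \<beta> z = f z" using f by blast
  thus ?thesis using nz by (simp add: slash_autom field_simps)
qed

lemma theta_nonzero:
  assumes "z \<in> uhp"
  shows "thA z \<noteq> 0" "thB z \<noteq> 0" "thC z \<noteq> 0" "(thA z)\<^sup>2 = (thB z)\<^sup>2 + (thC z)\<^sup>2"
  using csc_sum_relations[of z "1/2"] half_periods_notin_lattice[of z] assms by (auto simp: uhp_def)

text \<open>
  Applied to \<open>(z + s)/p\<close> and \<open>(z' + s)/p\<close>, the injectivity of \<open>[thA : thB : thC]\<close> modulo \<open>\<Gamma>(4)\<close> shows that one and the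
  same \<open>\<beta>\<close> has an integral conjugate by the matrix with rows \<open>(1, s)\<close> and \<open>(0, p)\<close>, for each \<open>s\<close>.
  The values \<open>s = 0, 1, -1\<close> force \<open>\<beta>\<close> to be scalar modulo \<open>p\<close>.
\<close>

lemma proportional_imp_Gamma_pm:
  assumes p: "prime p" "odd p" and z: "z \<in> uhp" and z': "z' \<in> uhp"
    and prp: "\<And>f. f \<in> V_space p \<Longrightarrow> f z' = c * f z"
  shows "\<exists>\<beta>\<in>Gamma_pm p. z' = mat_moebius \<beta> z"
proof -
  have p0: "p > 0" using p(2) by (auto intro: Nat.gr0I)
  have im: "Im z > 0" "Im z' > 0" using z z' by (auto simp: uhp_def)
  note th = theta_in_modular_forms1
  have "thA z' = c * thA z" "thB z' = c * thB z" "thC z' = c * thC z"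
    using prp th by (auto intro: V_space_level4)
  from theta_injective[OF im this] obtain a b k d where
    G: "a * d - b * k = 1" "4 dvd a - 1" "4 dvd b" "4 dvd k" "4 dvd d - 1"
      "c = of_int k * z + of_int d" "c * z' = of_int a * z + of_int b" by metis
  \<comment> \<open>For \<alpha> with rows (1, s) and (0, p), this is p times the upper right entry
    of the conjugate of \<beta> by \<alpha>. The same c occurs at z and at (z + s)/p, so comparing
    coefficients identifies the matrix found at (z + s)/p with that conjugate, whose entries are
    therefore integers.\<close>
  have dvd: "int p dvd b + s * d - a * s - k * s * s" for s
  proof -
    define \<alpha> where "\<alpha> = mat2 1 s 0 (int p)"
    have "primitive_mat \<alpha>" by (rule primitive_matI, drule spec[of _ 1], drule spec[of _ 1]) (simp add: \<alpha>_def)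
    moreover have "det \<alpha> = int p" by (simp add: \<alpha>_def det_2)
    ultimately have V: "slash f \<alpha> \<in> V_space p" if "f \<in> {thA, thB, thC}" for f
      using that th by (auto intro: V_spaceI)
    have sl: "slash f \<alpha> w = f ((w + of_int s) / of_nat p) / of_nat p" for f w
      by (simp add: slash_autom mat_moebius_autom autom_def \<alpha>_def)
    have eq: "f ((z' + of_int s) / of_nat p) = c * f ((z + of_int s) / of_nat p)" if "f \<in> {thA, thB, thC}" for f
      using prp[OF V[OF that]] p0 by (simp add: sl)
    have im': "Im ((z + of_int s) / of_nat p) > 0" "Im ((z' + of_int s) / of_nat p) > 0"
      using im p0 by (simp_all add: Im_divide_of_nat)
    obtain a' b' k' d' where G': "c = of_int k' * ((z + of_int s) / of_nat p) + of_int d'"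
        "c * ((z' + of_int s) / of_nat p) = of_int a' * ((z + of_int s) / of_nat p) + of_int b'"
      using theta_injective[OF im'] eq by (metis insertCI)
    have "c * of_nat p = of_int k' * (z + of_int s) + of_int d' * of_nat p"
      using p0 by (subst G'(1)) (simp add: field_simps)
    hence "of_int (int p * d) + of_int (int p * k) * z = of_int (k' * s + d' * int p) + of_int k' * z"
      unfolding G(6) by (simp add: algebra_simps)
    note 1 = period_lattice_coords[OF im(1) this]
    have "c * (z' + of_int s) = of_int a' * (z + of_int s) + of_int b' * of_nat p"
      using G'(2) p0 by (simp add: field_simps)
    hence "c * z' + of_int s * c = of_int a' * (z + of_int s) + of_int b' * of_nat p"
      by (simp add: algebra_simps)
    hence "of_int (b + s * d) + of_int (a + s * k) * z = of_int (a' * s + b' * int p) + of_int a' * z"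
      unfolding G(7) unfolding G(6) by (simp add: algebra_simps)
    note 2 = period_lattice_coords[OF im(1) this]
    have "b + s * d - a * s - k * s * s = b' * int p" using 2 by algebra
    thus ?thesis by simp
  qed
  have pb: "int p dvd b" using dvd[of 0] by simp
  \<comment> \<open>Adding the cases s = 1 and s = -1 cancels d - a and leaves 2 (b - k).\<close>
  have "int p dvd (b + 1 * d - a * 1 - k * 1 * 1) + (b + (-1) * d - a * (-1) - k * (-1) * (-1))"
    by (intro dvd_add dvd)
  hence "int p dvd 2 * b - 2 * k" by (simp add: algebra_simps)
  hence "int p dvd 2 * k" using pb by (metis dvd_diff_right_iff dvd_mult)
  moreover have "coprime (int p) 2" using p by simp
  ultimately have pk: "int p dvd k" by (simp add: coprime_dvd_mult_right_iff)
  have "int p dvd (b + 1 * d - a * 1 - k * 1 * 1) - b + k" by (intro dvd_add dvd_diff dvd pb pk)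
  hence da: "int p dvd d - a" by (simp add: algebra_simps)
  \<comment> \<open>The determinant now gives a^2 = 1 modulo p, and primality gives the
    sign.\<close>
  have "(a - 1) * (a + 1) = b * k - a * (d - a)" using G(1) by (simp add: algebra_simps)
  hence "int p dvd (a - 1) * (a + 1)" using pb da by simp
  hence "int p dvd a - 1 \<or> int p dvd a - (-1)" using p(1) by (simp add: prime_dvd_mult_iff)
  hence "\<exists>e. e \<in> {1, -1} \<and> int p dvd a - e" by blast
  then obtain e where e: "e \<in> {1, -1}" "int p dvd a - e" by blast
  have "int p dvd (d - a) + (a - e)" using da e by (intro dvd_add)
  hence de: "int p dvd d - e" by simp
  define \<beta> where "\<beta> = mat2 a b k d"
  have "\<beta> \<in> Gamma_pm p"
    using G(1-5) pb pk e de by (auto simp: Gamma_pm_iff principal_congruence_iff SL2Z_iff \<beta>_def)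
  moreover have "z' = mat_moebius \<beta> z"
  proof -
    have "c \<noteq> 0" using \<open>thA z' = c * thA z\<close> theta_nonzero[OF z'] by auto
    thus ?thesis using G(6,7) by (simp add: mat_moebius_autom autom_def \<beta>_def field_simps)
  qed
  ultimately show ?thesis by blast
qed

section \<open>Group structure, stabilisers and cusp widths of \<Gamma>\<plusminus>(4p)\<close>

lemma congruence_mult:
  fixes A B :: imat
  assumes "m dvd A $ 1 $ 1 - e" "m dvd A $ 1 $ 2" "m dvd A $ 2 $ 1" "m dvd A $ 2 $ 2 - e"
    and "m dvd B $ 1 $ 1 - f" "m dvd B $ 1 $ 2" "m dvd B $ 2 $ 1" "m dvd B $ 2 $ 2 - f"
  shows "m dvd (A ** B) $ 1 $ 1 - e * f" "m dvd (A ** B) $ 1 $ 2" "m dvd (A ** B) $ 2 $ 1" "m dvd (A ** B) $ 2 $ 2 - e * f"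
proof -
  have 1: "(A ** B) $ 1 $ 1 - e * f = (A $ 1 $ 1 - e) * B $ 1 $ 1 + e * (B $ 1 $ 1 - f) + A $ 1 $ 2 * B $ 2 $ 1"
    and 2: "(A ** B) $ 2 $ 2 - e * f = (A $ 2 $ 2 - e) * B $ 2 $ 2 + e * (B $ 2 $ 2 - f) + A $ 2 $ 1 * B $ 1 $ 2"
    by (simp_all add: algebra_simps)
  show "m dvd (A ** B) $ 1 $ 1 - e * f" "m dvd (A ** B) $ 2 $ 2 - e * f"
    unfolding 1 2 by (intro dvd_add dvd_mult dvd_mult2 assms)+
  show "m dvd (A ** B) $ 1 $ 2" "m dvd (A ** B) $ 2 $ 1"
    unfolding imat_mult_nth using assms by simp_all
qed

lemma Gamma_pm_mult:
  assumes "A \<in> Gamma_pm p" "B \<in> Gamma_pm p"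
  shows "A ** B \<in> Gamma_pm p"
proof -
  have 4: "int 4 dvd A $ 1 $ 1 - 1" "int 4 dvd A $ 1 $ 2" "int 4 dvd A $ 2 $ 1" "int 4 dvd A $ 2 $ 2 - 1"
    "int 4 dvd B $ 1 $ 1 - 1" "int 4 dvd B $ 1 $ 2" "int 4 dvd B $ 2 $ 1" "int 4 dvd B $ 2 $ 2 - 1"
    and det: "det A = 1" "det B = 1"
    using assms unfolding Gamma_pm_iff principal_congruence_iff SL2Z_def by auto
  have "A ** B \<in> principal_congruence 4"
    using congruence_mult[OF 4] det unfolding principal_congruence_iff SL2Z_def by (simp add: det_mul)
  moreover obtain e f where ef: "e \<in> {1, -1}" "f \<in> {1, -1}"
    "int p dvd A $ 1 $ 1 - e" "int p dvd A $ 1 $ 2" "int p dvd A $ 2 $ 1" "int p dvd A $ 2 $ 2 - e"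
    "int p dvd B $ 1 $ 1 - f" "int p dvd B $ 1 $ 2" "int p dvd B $ 2 $ 1" "int p dvd B $ 2 $ 2 - f"
    using assms unfolding Gamma_pm_iff by blast
  moreover have "e * f \<in> {1, -1}" using ef(1,2) by auto
  ultimately show ?thesis unfolding Gamma_pm_iff using congruence_mult[OF ef(3-)] by blast
qed

lemma Gamma_pm_inverse:
  assumes "A \<in> Gamma_pm p"
  obtains B where "B \<in> Gamma_pm p" "B ** A = mat 1"
proof (rule that)
  define B where "B = mat2 (A $ 2 $ 2) (- A $ 1 $ 2) (- A $ 2 $ 1) (A $ 1 $ 1)"
  show "B \<in> Gamma_pm p" using assms
    by (auto simp: Gamma_pm_iff principal_congruence_iff SL2Z_iff B_def algebra_simps)
  show "B ** A = mat 1" using assms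
    by (auto simp: Gamma_pm_iff principal_congruence_iff SL2Z_iff B_def imat_eq_iff algebra_simps)
qed

lemma mat_1_in_Gamma_pm: "mat 1 \<in> Gamma_pm p"
  by (auto simp: Gamma_pm_iff principal_congruence_iff SL2Z_iff intro!: bexI[of _ 1])

lemma act_mat_1: "act (mat 1) x = x"
proof (cases x)
  case (Cusp s) thus ?thesis by (cases s) auto
qed (simp add: mat_moebius_def moebius_def)

lemma orbit_Gamma_pm_self: "x \<in> orbit (Gamma_pm p) x"
  unfolding orbit_def using mat_1_in_Gamma_pm act_mat_1 by (metis (mono_tags, lifting) mem_Collect_eq)

lemma orbit_Gamma_pm_eq:
  assumes \<beta>: "\<beta> \<in> Gamma_pm p" and z: "z \<in> uhp"
  shows "orbit (Gamma_pm p) (Inner z) = orbit (Gamma_pm p) (Inner (mat_moebius \<beta> z))"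
proof -
  have det: "det B = 1" if "B \<in> Gamma_pm p" for B
    using that by (simp add: Gamma_pm_iff principal_congruence_iff SL2Z_def)
  have comp: "mat_moebius A (mat_moebius B w) = mat_moebius (A ** B) w"
    if "w \<in> uhp" "B \<in> Gamma_pm p" for A B w
    using autom_mult(2)[of B w A] autom_nonzero[of B w] that det by (simp add: uhp_def)
  have sub: "orbit (Gamma_pm p) (Inner (mat_moebius B w)) \<subseteq> orbit (Gamma_pm p) (Inner w)"
    if "B \<in> Gamma_pm p" "w \<in> uhp" for B w
    using comp[OF that(2,1)] Gamma_pm_mult[OF _ that(1)] by (auto simp: orbit_def)
  obtain B where B: "B \<in> Gamma_pm p" "B ** \<beta> = mat 1" by (rule Gamma_pm_inverse[OF \<beta>])
  have "mat_moebius B (mat_moebius \<beta> z) = z"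
    using comp[OF z \<beta>, of B] B by (simp add: mat_moebius_def moebius_def)
  moreover have "mat_moebius \<beta> z \<in> uhp" using z det[OF \<beta>] mat_moebius_in_uhp_iff[of \<beta> z] by simp
  ultimately show ?thesis using sub[OF \<beta> z] sub[OF B(1), of "mat_moebius \<beta> z"] by auto
qed

text \<open>\<open>thA\<close> has no zeros, so at a fixed point its transformation law forces the
  automorphy factor to be 1; the lower row is then (0, 1) and the matrix is the identity. Thus w - z
  serves as a local parameter at every inner point.\<close>

lemma ramification_index_Gamma_pm:
  assumes z: "z \<in> uhp" and p: "odd p"
  shows "ramification_index (Gamma_pm p) z = 1"
proof -
  have "A = mat 1" if A: "A \<in> Gamma_pm p" and fixed: "mat_moebius A z = z" for A
  proof -
    have im: "Im z > 0" using z by (simp add: uhp_def)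
    have "thA z = autom A z * thA z"
      using V_space_slash[OF p A z V_space_level4[OF theta_in_modular_forms1(1)]] fixed by simp
    hence 1: "autom A z = 1" using theta_nonzero[OF z] by simp
    hence "of_int (A $ 2 $ 2) + of_int (A $ 2 $ 1) * z = of_int 1 + of_int 0 * z" by (simp add: autom_def add.commute)
    note 2 = period_lattice_coords[OF im this]
    moreover have "A $ 1 $ 1 * A $ 2 $ 2 - A $ 1 $ 2 * A $ 2 $ 1 = 1"
      using A by (simp add: Gamma_pm_iff principal_congruence_iff SL2Z_iff)
    ultimately have 3: "A $ 1 $ 1 = 1" by simp
    have "A $ 1 $ 2 = 0" using fixed 1 3 by (simp add: mat_moebius_autom)
    thus ?thesis using 2 3 by (simp add: imat_eq_iff)
  qed
  hence "{A \<in> Gamma_pm p. mat_moebius A z = z} = {mat 1}"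
    using mat_1_in_Gamma_pm by (auto simp: mat_moebius_def moebius_def)
  thus ?thesis by (simp add: ramification_index_def)
qed

text \<open>Modulo m, a scalar multiple e \<sigma> equals s \<sigma> times the translation. The
  first column gives e = s; the second then shows that m divides a h and c h, with a and c
  coprime.\<close>

lemma congruence_translation:
  fixes \<sigma> A :: imat
  assumes \<sigma>: "\<sigma> \<in> SL2Z"
    and A: "m dvd A $ 1 $ 1 - e" "m dvd A $ 1 $ 2" "m dvd A $ 2 $ 1" "m dvd A $ 2 $ 2 - e"
    and eq: "A ** \<sigma> = \<sigma> ** translation_mat h \<or> A ** \<sigma> = - (\<sigma> ** translation_mat h)"
  shows "m dvd int h"
proof -
  define a b c d where "a = \<sigma> $ 1 $ 1" and "b = \<sigma> $ 1 $ 2" and "c = \<sigma> $ 2 $ 1" and "d = \<sigma> $ 2 $ 2"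
  have det: "a * d - b * c = 1" using \<sigma> by (simp add: SL2Z_iff a_def b_def c_def d_def)
  obtain s where s: "s \<in> {1, -1 :: int}" "A $ 1 $ 1 * a + A $ 1 $ 2 * c = s * a" "A $ 2 $ 1 * a + A $ 2 $ 2 * c = s * c"
    "A $ 1 $ 1 * b + A $ 1 $ 2 * d = s * (a * int h + b)" "A $ 2 $ 1 * b + A $ 2 $ 2 * d = s * (c * int h + d)"
  proof -
    from eq show ?thesis
    proof
      assume "A ** \<sigma> = \<sigma> ** translation_mat h"
      thus ?thesis using that[of 1] unfolding imat_eq_iff imat_mult_nth
        by (simp add: translation_mat_def a_def b_def c_def d_def)
    next
      assume "A ** \<sigma> = - (\<sigma> ** translation_mat h)"
      thus ?thesis using that[of "-1"] unfolding imat_eq_iff vector_uminus_component imat_mult_nth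
        by (simp add: translation_mat_def a_def b_def c_def d_def)
    qed
  qed
  have 1: "m dvd (e - s) * a"
  proof -
    have "(e - s) * a = - ((A $ 1 $ 1 - e) * a + A $ 1 $ 2 * c)" using s(2) by (simp add: algebra_simps)
    thus ?thesis using A by simp
  qed
  have 2: "m dvd (e - s) * c"
  proof -
    have "(e - s) * c = - ((A $ 2 $ 2 - e) * c + A $ 2 $ 1 * a)" using s(3) by (simp add: algebra_simps)
    thus ?thesis using A by simp
  qed
  have "e - s = d * ((e - s) * a) - b * ((e - s) * c)" using det by algebra
  hence es: "m dvd e - s" using 1 2 by (metis dvd_diff dvd_mult)
  have 3: "m dvd s * (a * int h)"
  proof -
    have "s * (a * int h) = (A $ 1 $ 1 - e) * b + A $ 1 $ 2 * d + (e - s) * b" using s(4) by (simp add: algebra_simps)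
    thus ?thesis using A es by simp
  qed
  have 4: "m dvd s * (c * int h)"
  proof -
    have "s * (c * int h) = (A $ 2 $ 2 - e) * d + A $ 2 $ 1 * b + (e - s) * d" using s(5) by (simp add: algebra_simps)
    thus ?thesis using A es by simp
  qed
  have "s * int h = d * (s * (a * int h)) - b * (s * (c * int h))" using det by algebra
  hence "m dvd s * int h" using 3 4 by (metis dvd_diff dvd_mult)
  thus ?thesis using s(1) by auto
qed

text \<open>A translation by 4p stays congruent to the identity modulo 4p after conjugation.
  Conversely any admissible h is divisible by 4 and by p, which are coprime.\<close>

lemma cusp_width_Gamma_pm:
  assumes \<sigma>: "\<sigma> \<in> SL2Z" and p: "odd p"
  shows "cusp_width (Gamma_pm p) \<sigma> = 4 * p"
  unfolding cusp_width_def
proof (rule Least_equality)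
  define a b c d where "a = \<sigma> $ 1 $ 1" and "b = \<sigma> $ 1 $ 2" and "c = \<sigma> $ 2 $ 1" and "d = \<sigma> $ 2 $ 2"
  have det: "a * d - b * c = 1" using \<sigma> by (simp add: SL2Z_iff a_def b_def c_def d_def)
  define q where "q = 4 * int p"
  \<comment> \<open>The conjugate of translation by q under \<sigma>.\<close>
  define A where "A = mat2 (1 - q * a * c) (q * a * a) (- q * c * c) (1 + q * a * c)"
  have "A ** \<sigma> = \<sigma> ** translation_mat (4 * p)"
  proof -
    have q: "int (4 * p) = q" by (simp add: q_def)
    have "(1 - q * a * c) * b + q * a * a * d = a * q + b * 1" "- q * c * c * b + (1 + q * a * c) * d = c * q + d * 1"
      using det by algebra+
    moreover have "(1 - q * a * c) * a + q * a * a * c = a * 1 + b * 0" "- q * c * c * a + (1 + q * a * c) * c = c * 1 + d * 0"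
      by (simp_all add: algebra_simps)
    ultimately show ?thesis unfolding imat_eq_iff imat_mult_nth A_def translation_mat_def vector_2 q
        a_def[symmetric] b_def[symmetric] c_def[symmetric] d_def[symmetric] by blast
  qed
  moreover have "A \<in> Gamma_pm p"
  proof -
    have "4 dvd q" "int p dvd q" by (simp_all add: q_def)
    thus ?thesis by (auto simp: Gamma_pm_iff principal_congruence_iff SL2Z_iff A_def algebra_simps intro!: bexI[of _ 1])
  qed
  moreover have "4 * p > 0" using p by (auto intro: Nat.gr0I)
  ultimately show "4 * p > 0 \<and> (\<exists>A\<in>Gamma_pm p. A ** \<sigma> = \<sigma> ** translation_mat (4 * p) \<or>
      A ** \<sigma> = - (\<sigma> ** translation_mat (4 * p)))" by blast
next
  fix h assume h: "h > 0 \<and> (\<exists>A\<in>Gamma_pm p. A ** \<sigma> = \<sigma> ** translation_mat h \<or> A ** \<sigma> = - (\<sigma> ** translation_mat h))"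
  then obtain A where A: "A \<in> Gamma_pm p" "A ** \<sigma> = \<sigma> ** translation_mat h \<or> A ** \<sigma> = - (\<sigma> ** translation_mat h)"
    by blast
  have "int 4 dvd A $ 1 $ 1 - 1" "int 4 dvd A $ 1 $ 2" "int 4 dvd A $ 2 $ 1" "int 4 dvd A $ 2 $ 2 - 1"
    using A(1) unfolding Gamma_pm_iff principal_congruence_iff by auto
  from congruence_translation[OF \<sigma> this A(2)] have 4: "4 dvd h" by presburger
  obtain e where "int p dvd A $ 1 $ 1 - e" "int p dvd A $ 1 $ 2" "int p dvd A $ 2 $ 1" "int p dvd A $ 2 $ 2 - e"
    using A(1) unfolding Gamma_pm_iff by blast
  from congruence_translation[OF \<sigma> this A(2)] have "p dvd h" by simp
  moreover have "coprime 4 p" using p coprime_power_left_iff[of 2 2 p] by (simp add: coprime_commute)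
  ultimately have "4 * p dvd h" using 4 by (simp add: divides_mult)
  thus "4 * p \<le> h" using h by (simp add: dvd_imp_le)
qed

section \<open>Forms with simple zeros\<close>

lemma SL2Z_transitive_on_cusps: "\<exists>\<sigma>\<in>SL2Z. act \<sigma> (Cusp None) = Cusp s"
proof (cases s)
  case None
  thus ?thesis by (intro bexI[of _ "mat 1"]) (auto simp: SL2Z_iff)
next
  case (Some r)
  obtain x y where xy: "quotient_of r = (x, y)" by (cases "quotient_of r")
  have y: "y > 0" "coprime x y" "r = of_int x / of_int y"
    using quotient_of_denom_pos[OF xy] quotient_of_coprime[OF xy] quotient_of_div[OF xy] by auto
  obtain u v where "u * x + v * y = 1" using bezout_int[of x y] y(2) by (auto simp: coprime_iff_gcd_eq_1)
  hence "mat2 x (- v) y u \<in> SL2Z" by (simp add: SL2Z_iff algebra_simps)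
  moreover have "act (mat2 x (- v) y u) (Cusp None) = Cusp s" using Some y by simp
  ultimately show ?thesis by blast
qed

text \<open>\<open>M\<close> is diag(1, p) times the inverse of \<sigma>, so f|\<sigma> is
  thB(z/p)/p, whose expansion variable exp(\<pi> i z/(2p)) is exactly the local parameter for width
  4p. \<open>M\<close> is primitive since its first row is (d, -b).\<close>

lemma cusp_form_exists:
  assumes p: "odd p"
  shows "\<exists>f\<in>V_space p. f \<in> modular_forms1 (Gamma_pm p) \<and> vanishes_to_order_at (Gamma_pm p) f (Cusp s) 1"
proof -
  obtain \<sigma> where \<sigma>: "\<sigma> \<in> SL2Z" "act \<sigma> (Cusp None) = Cusp s" using SL2Z_transitive_on_cusps by blast
  have p0: "p > 0" using p by (auto intro: Nat.gr0I)
  define a b c d where "a = \<sigma> $ 1 $ 1" and "b = \<sigma> $ 1 $ 2" and "c = \<sigma> $ 2 $ 1" and "d = \<sigma> $ 2 $ 2"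
  have det: "a * d - b * c = 1" using \<sigma> by (simp add: SL2Z_iff a_def b_def c_def d_def)
  define M where "M = mat2 d (- b) (- int p * c) (int p * a)"
  define D where "D = mat2 1 0 0 (int p)"
  have prim: "primitive_mat M"
  proof (rule primitive_matI)
    fix g assume "\<forall>i j. g dvd M $ i $ j"
    hence "g dvd M $ 1 $ 1" "g dvd M $ 1 $ 2" by blast+
    hence "g dvd a * d - b * c" by (simp add: M_def)
    thus "g dvd 1" using det by simp
  qed
  have "det M = int p * (a * d - b * c)" by (simp add: M_def det_2 algebra_simps)
  hence detM: "det M = int p" using det by simp
  have MD: "M ** \<sigma> = D"
  proof -
    have "- int p * c * b + int p * a * d = int p" using det by algebra
    thus ?thesis unfolding imat_eq_iff imat_mult_nth
      using det by (simp add: M_def D_def a_def[symmetric] b_def[symmetric] c_def[symmetric] d_def[symmetric] algebra_simps)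
  qed
  define f where "f = slash thB M"
  have fV: "f \<in> V_space p" unfolding f_def by (rule V_spaceI[OF theta_in_modular_forms1(2) prim]) (simp add: detM)
  have fM: "f \<in> modular_forms1 (Gamma_pm p)" unfolding f_def
    by (rule slash_in_modular_forms1[OF theta_in_modular_forms1(2) p]) (simp add: detM)
  obtain h where h: "h holomorphic_on ball 0 1" "h 0 \<noteq> 0"
    "\<And>\<tau>. \<tau> \<in> uhp \<Longrightarrow> thB \<tau> = exp (of_real pi * \<i> * \<tau> / 2) * h (exp (of_real pi * \<i> * \<tau> / 2))"
    by (rule thB_expansion) blast
  define g where "g = (\<lambda>t. h t / of_nat p * t)"
  have gh: "g holomorphic_on ball 0 1" unfolding g_def by (intro holomorphic_intros h) (use p0 in auto)
  have fg: "slash f \<sigma> z = g (exp (2 * of_real pi * \<i> * z / of_nat (cusp_width (Gamma_pm p) \<sigma>)))" if z: "z \<in> uhp" for z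
  proof -
    have "slash f \<sigma> z = slash thB D z"
      unfolding f_def MD[symmetric] by (rule slash_slash) (use \<sigma> z in \<open>auto simp: SL2Z_def\<close>)
    also have "\<dots> = thB (z / of_nat p) / of_nat p"
      by (simp add: slash_autom mat_moebius_autom autom_def D_def)
    also have "z / of_nat p \<in> uhp" using z p0 by (simp add: uhp_def Im_divide_of_nat)
    hence "thB (z / of_nat p) = exp (of_real pi * \<i> * (z / of_nat p) / 2) * h (exp (of_real pi * \<i> * (z / of_nat p) / 2))"
      by (rule h(3))
    also have "of_real pi * \<i> * (z / of_nat p) / 2 = 2 * of_real pi * \<i> * z / of_nat (cusp_width (Gamma_pm p) \<sigma>)"
      using p0 by (simp add: cusp_width_Gamma_pm[OF \<sigma>(1) p] field_simps)
    finally show ?thesis by (simp add: g_def mult_ac)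
  qed
  have zo: "zorder g 0 = 1"
    by (rule zorder_eqI[of "ball 0 1" 0 "\<lambda>t. h t / of_nat p"])
       (use h p0 in \<open>auto simp: g_def intro!: holomorphic_intros\<close>)
  have fr: "\<exists>\<^sub>F w in at 0. g w \<noteq> 0"
  proof (rule eventually_frequently)
    have "isCont h 0" using h(1)
      by (auto dest!: holomorphic_on_imp_continuous_on simp: continuous_on_eq_continuous_at)
    hence "\<forall>\<^sub>F w in at 0. h w \<noteq> 0" unfolding isCont_def using h(2) tendsto_imp_eventually_ne by blast
    moreover have "\<forall>\<^sub>F w in at (0 :: complex). w \<noteq> 0" by (simp add: eventually_at_filter)
    ultimately show "\<forall>\<^sub>F w in at 0. g w \<noteq> 0" by eventually_elim (use p0 in \<open>simp add: g_def\<close>)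
  qed simp
  have "vanishes_to_order_at (Gamma_pm p) f (Cusp s) 1"
    unfolding vanishes_to_order_at.simps of_nat_1 using \<sigma> gh fg zo fr by blast
  thus ?thesis using fV fM by blast
qed

text \<open>
  For nearby \<open>w, w'\<close> with equal quotients, the automorphy factor \<open>c = thA w' / thA w\<close> is close to \<open>1\<close>; being of
  the form \<open>k w + d\<close>, it equals \<open>1\<close>, so that \<open>w' - w\<close> is a small integer.
\<close>

lemma theta_quotient_locally_injective:
  assumes z0: "z0 \<in> uhp"
  obtains r where "r > 0" "ball z0 r \<subseteq> uhp" "inj_on (\<lambda>z. thB z / thA z) (ball z0 r)"
proof -
  have op: "open uhp" unfolding uhp_def by (rule open_halfspace_Im_gt)
  have cont: "isCont thA z0" "isCont thC z0"
    using theta_in_modular_forms1 z0 op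
    by (auto simp: modular_forms1_def continuous_on_eq_continuous_at dest!: holomorphic_on_imp_continuous_on)
  \<comment> \<open>The square of \<open>Q\<close> is determined by thB/thA. Staying within |Q z0|
    of \<open>Q z0\<close> excludes opposite signs, so \<open>Q\<close> itself is
    determined.\<close>
  define Q where "Q = (\<lambda>z. thC z / thA z)"
  define y where "y = Im z0"
  have y: "y > 0" using z0 by (simp add: y_def uhp_def)
  \<comment> \<open>The bound y/2 rules out k \<noteq> 0, as then |c - 1| \<ge> |k| Im w > y/2. The
    bound 1/2 forces d = 1, and b = 0 since |b| < 2 \<epsilon>.\<close>
  define \<epsilon> where "\<epsilon> = min (1/2) (y/2)"
  have eps: "\<epsilon> > 0" "\<epsilon> \<le> 1/2" "\<epsilon> \<le> y/2" using y by (auto simp: \<epsilon>_def)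
  have Q0: "Q z0 \<noteq> 0" and A0: "thA z0 \<noteq> 0" using theta_nonzero[OF z0] by (auto simp: Q_def)
  have "isCont Q z0" unfolding Q_def using cont A0 by (intro continuous_intros) auto
  hence "\<forall>\<^sub>F z in nhds z0. dist (Q z) (Q z0) < norm (Q z0)"
    using Q0 by (intro tendstoD) (auto simp: isCont_def tendsto_at_iff_tendsto_nhds)
  \<comment> \<open>Two points this close differ in \<open>thA\<close> by less than half of
    \<epsilon> |thA z0|, and |thA z0|/2 < |thA w|; together |c - 1| < \<epsilon>.\<close>
  moreover have "\<forall>\<^sub>F z in nhds z0. dist (thA z) (thA z0) < \<epsilon> * norm (thA z0) / 4"
    using cont A0 eps by (intro tendstoD) (auto simp: isCont_def tendsto_at_iff_tendsto_nhds)
  moreover have "\<forall>\<^sub>F z in nhds z0. z \<in> uhp" using op z0 by (rule eventually_nhds_in_open)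
  moreover have "\<forall>\<^sub>F z in nhds z0. z \<in> ball z0 \<epsilon>" using eps by (intro eventually_nhds_in_open) auto
  ultimately have "\<forall>\<^sub>F z in nhds z0. dist (Q z) (Q z0) < norm (Q z0) \<and>
      dist (thA z) (thA z0) < \<epsilon> * norm (thA z0) / 4 \<and> z \<in> uhp \<and> z \<in> ball z0 \<epsilon>"
    by eventually_elim auto
  then obtain r where r: "r > 0" "\<And>z. dist z z0 < r \<Longrightarrow> dist (Q z) (Q z0) < norm (Q z0) \<and>
      dist (thA z) (thA z0) < \<epsilon> * norm (thA z0) / 4 \<and> z \<in> uhp \<and> z \<in> ball z0 \<epsilon>"
    unfolding eventually_nhds_metric by auto
  have "w = w'" if w: "w \<in> ball z0 r" and w': "w' \<in> ball z0 r" and eq: "thB w / thA w = thB w' / thA w'" for w w'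
  proof -
    note rw = r(2)[of w] and rw' = r(2)[of w']
    have uhp: "w \<in> uhp" "w' \<in> uhp" using rw rw' w w' by (auto simp: dist_commute)
    have nz: "thA w \<noteq> 0" "thA w' \<noteq> 0" using theta_nonzero uhp by auto
    have "(Q u)\<^sup>2 = 1 - (thB u / thA u)\<^sup>2" if "u \<in> uhp" for u
    proof -
      have "(thC u)\<^sup>2 = (thA u)\<^sup>2 - (thB u)\<^sup>2" using theta_nonzero(4)[OF that] by simp
      thus ?thesis using theta_nonzero(1)[OF that] by (simp add: Q_def power_divide diff_divide_distrib)
    qed
    hence "(Q w)\<^sup>2 = (Q w')\<^sup>2" using uhp eq by simp
    moreover have "Q w \<noteq> - Q w'"
    proof
      assume neg: "Q w = - Q w'"
      have "2 * norm (Q z0) = norm ((Q w - Q z0) + (Q w' - Q z0))" unfolding neg by (simp add: norm_mult flip: mult_2)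
      also have "\<dots> \<le> norm (Q w - Q z0) + norm (Q w' - Q z0)" by (rule norm_triangle_ineq)
      also have "\<dots> < norm (Q z0) + norm (Q z0)" using rw rw' w w' by (intro add_strict_mono) (auto simp: dist_norm norm_minus_commute)
      finally show False by simp
    qed
    ultimately have Qeq: "Q w = Q w'" by (auto simp: power2_eq_iff)
    define c where "c = thA w' / thA w"
    have "thA w' = c * thA w" "thB w' = c * thB w" "thC w' = c * thC w"
      using nz eq Qeq by (simp_all add: c_def Q_def field_simps)
    moreover have "Im w > 0" "Im w' > 0" using uhp by (auto simp: uhp_def)
    ultimately obtain a b k d where G: "a * d - b * k = 1" "c = of_int k * w + of_int d" "c * w' = of_int a * w + of_int b"
      using theta_injective by metis
    have c1: "norm (c - 1) < \<epsilon>"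
    proof -
      have 1: "dist (thA w) (thA z0) < \<epsilon> * norm (thA z0) / 4" "dist (thA w') (thA z0) < \<epsilon> * norm (thA z0) / 4"
        using rw rw' w w' by (auto simp: dist_commute)
      have 2: "norm (thA w' - thA w) < \<epsilon> * norm (thA z0) / 2"
        using dist_triangle_less_add[OF 1(2) 1(1)] by (simp add: dist_norm)
      have "\<epsilon> * norm (thA z0) \<le> 1/2 * norm (thA z0)" using eps by (intro mult_right_mono) auto
      moreover have "norm (thA z0) - norm (thA w) \<le> norm (thA w - thA z0)" by (metis norm_minus_commute norm_triangle_ineq2)
      ultimately have 3: "norm (thA z0) / 2 < norm (thA w)" using 1 zero_less_norm_iff[THEN iffD2, OF A0]
        unfolding dist_norm by linarith
      have "norm (thA w' - thA w) < \<epsilon> * norm (thA w)"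
        using 2 mult_strict_left_mono[OF 3 eps(1)] by simp
      hence lt: "norm (thA w' - thA w) / norm (thA w) < \<epsilon>" using nz by (simp add: pos_divide_less_eq)
      have "c - 1 = (thA w' - thA w) / thA w" using nz by (simp add: c_def field_simps)
      thus ?thesis using lt by (simp only: norm_divide)
    qed
    have imw: "Im w > y / 2"
    proof -
      have "\<bar>Im (w - z0)\<bar> \<le> norm (w - z0)" by (rule abs_Im_le_cmod)
      also have "\<dots> < \<epsilon>" using rw w by (auto simp: dist_norm norm_minus_commute)
      finally show ?thesis using eps by (simp add: y_def)
    qed
    have k0: "k = 0"
    proof (rule ccontr)
      assume "k \<noteq> 0"
      hence "1 * (y/2) \<le> \<bar>of_int k\<bar> * Im w" using imw y by (intro mult_mono) auto
      also have "\<dots> = \<bar>Im (c - 1)\<bar>" using imw y by (simp add: G(2) abs_mult)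
      also have "\<dots> \<le> norm (c - 1)" by (rule abs_Im_le_cmod)
      finally show False using c1 eps by simp
    qed
    have "d = 1"
    proof -
      have "c - 1 = of_int (d - 1)" using G(2) k0 by simp
      hence "norm (c - 1) = of_int \<bar>d - 1\<bar>" by (simp only: norm_of_int)
      thus ?thesis using c1 eps by linarith
    qed
    hence "a = 1" "c = 1" using G k0 by auto
    hence wb: "w' = w + of_int b" using G(3) by simp
    have "norm (w' - w) < \<epsilon> + \<epsilon>"
      using dist_triangle_less_add[of w' z0 \<epsilon> w \<epsilon>] rw rw' w w' by (simp add: dist_norm norm_minus_commute)
    hence "real_of_int \<bar>b\<bar> < 1" using eps wb by simp
    hence "b = 0" by linarith
    thus ?thesis using wb by simp
  qed
  hence "inj_on (\<lambda>z. thB z / thA z) (ball z0 r)" by (auto simp: inj_on_def)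
  moreover have "ball z0 r \<subseteq> uhp" using r(2) by (auto simp: dist_commute)
  ultimately show ?thesis using that r(1) by blast
qed

text \<open>A holomorphic function that is injective near z0 has nonzero derivative there. So thA (R
  - R z0), with R = thB/thA, has a simple zero, and it is already a form on \<Gamma>(4).\<close>

lemma inner_form_exists:
  assumes z0: "z0 \<in> uhp" and p: "odd p"
  shows "\<exists>f\<in>V_space p. f \<in> modular_forms1 (Gamma_pm p) \<and> vanishes_to_order_at (Gamma_pm p) f (Inner z0) 1"
proof -
  obtain r where r: "r > 0" "ball z0 r \<subseteq> uhp" "inj_on (\<lambda>z. thB z / thA z) (ball z0 r)"
    by (rule theta_quotient_locally_injective[OF z0])
  have holu: "thA holomorphic_on uhp" "thB holomorphic_on uhp"
    using theta_in_modular_forms1 by (auto simp: modular_forms1_def)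
  note hol = holu[THEN holomorphic_on_subset[OF _ r(2)]]
  define R where "R = (\<lambda>z. thB z / thA z)"
  have Rh: "R holomorphic_on ball z0 r"
    unfolding R_def by (intro holomorphic_intros hol) (use theta_nonzero r(2) in blast)
  have R': "deriv R z0 \<noteq> 0"
    by (rule holomorphic_injective_imp_regular[OF Rh open_ball]) (use r in \<open>auto simp: R_def\<close>)
  define f where "f = (\<lambda>z. thB z - R z0 * thA z)"
  have fhu: "f holomorphic_on ball z0 r" unfolding f_def by (intro holomorphic_intros hol)
  have "((\<lambda>z. thA z * (R z - R z0)) has_field_derivative (thA z0 * deriv R z0)) (at z0)"
    using holomorphic_derivI[OF Rh open_ball, of z0] holomorphic_derivI[OF hol(1) open_ball, of z0] r(1)
    by (auto intro!: derivative_eq_intros)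
  hence f': "(f has_field_derivative (thA z0 * deriv R z0)) (at z0)"
    by (rule has_field_derivative_transform_within_open[of _ _ _ "ball z0 r"])
       (use r theta_nonzero in \<open>auto simp: f_def R_def field_simps subset_iff\<close>)
  have D: "thA z0 * deriv R z0 \<noteq> 0" using R' theta_nonzero[OF z0] by simp
  have f0: "f z0 = 0" using theta_nonzero[OF z0] by (simp add: f_def R_def)
  have zo: "zorder f z0 = 1"
    by (rule zorder_zero_eqI[OF fhu open_ball])
       (use r f0 D DERIV_imp_deriv[OF f'] in auto)
  have fr: "\<exists>\<^sub>F w in at z0. f w \<noteq> 0"
  proof (rule eventually_frequently)
    have "((\<lambda>w. (f w - f z0) / (w - z0)) \<longlongrightarrow> thA z0 * deriv R z0) (at z0)"
      using f' by (simp add: has_field_derivative_iff)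
    hence "\<forall>\<^sub>F w in at z0. (f w - f z0) / (w - z0) \<noteq> 0" using D tendsto_imp_eventually_ne by blast
    thus "\<forall>\<^sub>F w in at z0. f w \<noteq> 0" by eventually_elim (auto simp: f0)
  qed simp
  have "f \<in> V_space p" unfolding f_def
    by (intro V_space_lincomb V_space_level4 theta_in_modular_forms1)
  moreover have "f \<in> modular_forms1 (Gamma_pm p)"
  proof -
    have "f \<in> modular_forms1 (principal_congruence 4)"
      unfolding f_def by (intro modular_forms1_lincomb theta_in_modular_forms1)
    moreover have "Gamma_pm p \<subseteq> principal_congruence 4" by (auto simp: Gamma_pm_def)
    ultimately show ?thesis using modular_forms1_mono by blast
  qed
  moreover have "vanishes_to_order_at (Gamma_pm p) f (Inner z0) 1"
    using zo fr ramification_index_Gamma_pm[OF z0 p] by simp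
  ultimately show ?thesis by blast
qed

section \<open>From projective equality to separation of points\<close>

lemma basis_proportional:
  assumes fs: "is_basis fs (V_space p)" and eq: "proj_map fs z = proj_map fs z'"
  obtains c where "\<And>f. f \<in> V_space p \<Longrightarrow> f z' = c * f z"
proof -
  have "map (\<lambda>f. f z') fs \<in> proj_point (map (\<lambda>f. f z') fs)"
    unfolding proj_point_def by (auto intro!: exI[of _ 1])
  hence "map (\<lambda>f. f z') fs \<in> proj_point (map (\<lambda>f. f z) fs)" using eq by (simp add: proj_map_def)
  then obtain c where "map (\<lambda>f. f z') fs = map (\<lambda>x. c * x) (map (\<lambda>f. f z) fs)"
    by (auto simp: proj_point_def)
  hence c: "f z' = c * f z" if "f \<in> set fs" for f using that by auto
  have "cfun.subspace {f. f z' = c * f z}"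
    unfolding cfun.subspace_def by (auto simp: scale_fun_def algebra_simps)
  hence "cfun.span (set fs) \<subseteq> {f. f z' = c * f z}"
    by (rule cfun.span_minimal[rotated]) (use c in auto)
  thus ?thesis using that[of c] fs by (auto simp: is_basis_def)
qed

text \<open>If every form vanishing at z vanished at z', subtracting multiples of the zero-free
  \<open>thA\<close> would make evaluation at z' proportional to evaluation at z.\<close>

lemma V_space_separates:
  assumes p: "prime p" "odd p" and z: "z \<in> uhp" and z': "z' \<in> uhp"
    and ne: "orbit (Gamma_pm p) (Inner z) \<noteq> orbit (Gamma_pm p) (Inner z')"
  obtains f where "f \<in> V_space p" "f z = 0" "f z' \<noteq> 0"
proof (rule ccontr)
  note result = that
  assume no: "\<not> thesis"
  have A: "thA \<in> V_space p" by (rule V_space_level4[OF theta_in_modular_forms1(1)])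
  have "f z' = thA z' / thA z * f z" if f: "f \<in> V_space p" for f
  proof -
    have "(\<lambda>w. f w - f z / thA z * thA w) \<in> V_space p" by (rule V_space_lincomb[OF f A])
    moreover have "f z - f z / thA z * thA z = 0" using theta_nonzero[OF z] by simp
    ultimately have "f z' - f z / thA z * thA z' = 0" using result no by blast
    thus ?thesis by (simp add: field_simps)
  qed
  from proportional_imp_Gamma_pm[OF p z z' this] obtain \<beta> where "\<beta> \<in> Gamma_pm p" "z' = mat_moebius \<beta> z" by blast
  thus False using orbit_Gamma_pm_eq[OF _ z] ne by blast
qed

theorem theorem3p2:
  fixes p :: nat
  assumes "prime p" and "odd p"
  shows
    "(\<forall>x\<in>modular_curve (Gamma_pm p).
        \<exists>f\<in>V_space p. f \<in> modular_forms1 (Gamma_pm p) \<and> vanishes_to_order (Gamma_pm p) f x 1) \<and>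
     (\<forall>fs. is_basis fs (V_space p) \<longrightarrow>
        (\<forall>z\<in>uhp. \<forall>z'\<in>uhp. proj_map fs z = proj_map fs z' \<longrightarrow>
           (\<exists>\<beta>\<in>Gamma_pm p. z' = mat_moebius \<beta> z) \<and>
           orbit (Gamma_pm p) (Inner z) = orbit (Gamma_pm p) (Inner z'))) \<and>
     (\<forall>x\<in>noncuspidal_points (Gamma_pm p). \<forall>y\<in>noncuspidal_points (Gamma_pm p).
        x \<noteq> y \<longrightarrow>
        (\<exists>f\<in>V_space p. (\<forall>z. Inner z \<in> x \<longrightarrow> f z = 0) \<and> (\<forall>z. Inner z \<in> y \<longrightarrow> f z \<noteq> 0)))"
proof (intro conjI ballI allI impI)
  fix x assume "x \<in> modular_curve (Gamma_pm p)"
  then obtain s where s: "s \<in> ext_uhp" "x = orbit (Gamma_pm p) s" by (auto simp: modular_curve_def)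
  have "\<exists>f\<in>V_space p. f \<in> modular_forms1 (Gamma_pm p) \<and> vanishes_to_order_at (Gamma_pm p) f s 1"
    using s(1) inner_form_exists[OF _ assms(2)] cusp_form_exists[OF assms(2)]
    unfolding ext_uhp_def by blast
  thus "\<exists>f\<in>V_space p. f \<in> modular_forms1 (Gamma_pm p) \<and> vanishes_to_order (Gamma_pm p) f x 1"
    using orbit_Gamma_pm_self unfolding vanishes_to_order_def s(2) by blast
next
  fix fs z z' assume fs: "is_basis fs (V_space p)" and z: "z \<in> uhp" "z' \<in> uhp" and eq: "proj_map fs z = proj_map fs z'"
  obtain c where "\<And>f. f \<in> V_space p \<Longrightarrow> f z' = c * f z" by (rule basis_proportional[OF fs eq]) blast
  from proportional_imp_Gamma_pm[OF assms z this]
  show \<beta>: "\<exists>\<beta>\<in>Gamma_pm p. z' = mat_moebius \<beta> z" .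
  thus "orbit (Gamma_pm p) (Inner z) = orbit (Gamma_pm p) (Inner z')"
    using orbit_Gamma_pm_eq[OF _ z(1)] by blast
next
  fix x y assume x: "x \<in> noncuspidal_points (Gamma_pm p)" and y: "y \<in> noncuspidal_points (Gamma_pm p)" and ne: "x \<noteq> y"
  obtain z z' where z: "z \<in> uhp" "z' \<in> uhp" "x = orbit (Gamma_pm p) (Inner z)" "y = orbit (Gamma_pm p) (Inner z')"
    using x y by (auto simp: noncuspidal_points_def)
  obtain f where f: "f \<in> V_space p" "f z = 0" "f z' \<noteq> 0"
    using V_space_separates[OF assms z(1,2)] ne z by metis
  \<comment> \<open>The automorphy factor is nonzero, so vanishing is constant along orbits.\<close>
  have tr: "f w = 0 \<longleftrightarrow> f u = 0" if u: "u \<in> uhp" and w: "Inner w \<in> orbit (Gamma_pm p) (Inner u)" for w u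
  proof -
    obtain \<beta> where \<beta>: "\<beta> \<in> Gamma_pm p" "w = mat_moebius \<beta> u" using w by (auto simp: orbit_def)
    have "autom \<beta> u \<noteq> 0" using autom_nonzero[of \<beta> u] \<beta>(1) u
      by (simp add: Gamma_pm_iff principal_congruence_iff SL2Z_def uhp_def)
    thus ?thesis using V_space_slash[OF assms(2) \<beta>(1) u f(1)] \<beta>(2) by simp
  qed
  show "\<exists>f\<in>V_space p. (\<forall>z. Inner z \<in> x \<longrightarrow> f z = 0) \<and> (\<forall>z. Inner z \<in> y \<longrightarrow> f z \<noteq> 0)"
    by (rule bexI[OF _ f(1)]) (use tr f z in blast)
qed

end
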